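(* Let $d\ge 3$, let $\alpha=(\alpha_1,\dots,\alpha_{2d})\in(0,\infty)^{2d}$ and let $Z=(Z_{i,j})_{1\le i,j\le 2d}$ be a matrix with strictly positive entries. Let $\tilde\kappa:=\min_{1\le i\le 2d}\alpha_i$ and fix a directed edge $e_0$ of $\mathbb{Z}^d$. If $s<\tilde\kappa$, then $$\mathbb{E}^{(\alpha,Z)}\big[G_\omega(e_0,e_0)^s\big]<\infty .$$ In particular, for $\mathbb{P}^{(\alpha,Z)}$-almost every $\omega$, the Markov chain $(X_n)$ is transient under the quenched law $P_{e_0,\omega}$.
   Context: Let $(e_1,\dots,e_d)$ be the canonical basis of $\mathbb{R}^d$ and $e_{d+i}=-e_i$ for $i=1,\dots,d$. Let $E=\{(x,x+e_i): x\in\mathbb{Z}^d,\ 1\le i\le 2d\}$ be the set of directed nearest-neighbor edges of $\mathbb{Z}^d$ and let $K=\{((x-e_i,x),(x,x+e_j)): x\in\mathbb{Z}^d,\ 1\le i,j\le 2d\}\subset E\times E$ (pairs of consecutive edges). The space of environments is $\Omega_K=\{\omega\in(0,1]^K:\ \sum_{e':(e,e')\in K}\omega(e,e')=1\ \text{for all } e\in E\}$. Let $\Delta^{(2d)}=\{u\in(0,1]^{2d}:\sum_i u_i=1\}$, with Lebesgue measure $du=du_1\cdots du_{2d-1}$. For $u\in\Delta^{(2d)}$ put $$\varphi(\alpha,\alpha;Z;u)=\prod_{i=1}^{2d}u_i^{\alpha_i-1}\prod_{j=1}^{2d}\Big(\sum_{l=1}^{2d}Z_{j,l}u_l\Big)^{-\alpha_j},\qquad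 \Phi(\alpha,\alpha;Z)=\int_{\Delta^{(2d)}}\varphi(\alpha,\alpha;Z;u)\,du<\infty .$$ Under $\mathbb{P}^{(\alpha,Z)}$ (with expectation $\mathbb{E}^{(\alpha,Z)}$) the vectors $(u_{(x,x+e_i)})_{1\le i\le 2d}$, $x\in\mathbb{Z}^d$, are i.i.d. on $\Delta^{(2d)}$ with density $\varphi(\alpha,\alpha;Z;u)/\Phi(\alpha,\alpha;Z)$, and the random environment $\omega\in\Omega_K$ is $$\omega\big((x-e_i,x),(x,x+e_j)\big)=\frac{Z_{i,j}\,u_{(x,x+e_j)}}{\sum_{l=1}^{2d}Z_{i,l}\,u_{(x,x+e_l)}} .$$ For $\omega\in\Omega_K$ and $e\in E$, $P_{e,\omega}$ denotes the law of the Markov chain $(X_n)_{n\ge0}$ on the state space $E$ started at $X_0=e$ with transition probabilities $\omega$ (the quenched law). The Green function is $G_\omega(e_0,e_0)=\sum_{n\ge 0}P_{e_0,\omega}(X_n=e_0)\in[1,\infty]$. *)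

theory Defs
  imports "HOL-Probability.Probability" "HOL-Library.Function_Algebras"
begin

text \<open>Points of \<open>\<int>\<^sup>d\<close> are functions \<open>nat \<Rightarrow> int\<close> supported on the coordinates \<open>{1..d}\<close>;
  \<open>+\<close>, \<open>-\<close> and unary minus on them are pointwise.\<close>

type_synonym site = "nat \<Rightarrow> int"
type_synonym edge = "site \<times> site"

definition sites :: "nat \<Rightarrow> site set" where
  "sites d = {x. \<forall>k. k \<notin> {1..d} \<longrightarrow> x k = 0}"

definition unit_step :: "nat \<Rightarrow> nat \<Rightarrow> site" where
  "unit_step d i = (if i \<le> d then (\<lambda>k. of_bool (k = i)) else - (\<lambda>k. of_bool (k = i - d)))"

definition edges :: "nat \<Rightarrow> edge set" where
  "edges d = {(x, x + unit_step d i) | x i. x \<in> sites d \<and> i \<in> {1..2*d}}"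

definition edge_pairs :: "nat \<Rightarrow> (edge \<times> edge) set" where
  "edge_pairs d = {((x - unit_step d i, x), (x, x + unit_step d j)) | x i j.
     x \<in> sites d \<and> i \<in> {1..2*d} \<and> j \<in> {1..2*d}}"

definition environments :: "nat \<Rightarrow> (edge \<times> edge \<Rightarrow> real) set" where
  "environments d = {\<omega> \<in> edge_pairs d \<rightarrow>\<^sub>E {0<..1}.
     \<forall>e\<in>edges d. (\<Sum>e' | (e, e') \<in> edge_pairs d. \<omega> (e, e')) = 1}"

definition environment_space :: "nat \<Rightarrow> (edge \<times> edge \<Rightarrow> real) measure" where
  "environment_space d = restrict_space (PiM (edge_pairs d) (\<lambda>_. borel)) (environments d)"


definition weight_simplex :: "nat \<Rightarrow> (nat \<Rightarrow> real) set" where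
  "weight_simplex d = {u \<in> {1..2*d} \<rightarrow>\<^sub>E {0<..1}. (\<Sum>i\<in>{1..2*d}. u i) = 1}"

text \<open>The measure \<open>du\<^sub>1 \<dots> du\<^sub>2\<^sub>d\<^sub>-\<^sub>1\<close> on the simplex: Lebesgue measure in the first \<open>2d - 1\<close>
  coordinates, the last coordinate being one minus the sum of the others.\<close>

definition lebesgue_simplex :: "nat \<Rightarrow> (nat \<Rightarrow> real) measure" where
  "lebesgue_simplex d = restrict_space
     (distr (PiM {1..<2*d} (\<lambda>_. lborel)) (PiM {1..2*d} (\<lambda>_. borel))
        (\<lambda>v. v(2*d := 1 - (\<Sum>i\<in>{1..<2*d}. v i))))
     (weight_simplex d)"

definition phi :: "nat \<Rightarrow> (nat \<Rightarrow> real) \<Rightarrow> (nat \<Rightarrow> nat \<Rightarrow> real) \<Rightarrow> (nat \<Rightarrow> real) \<Rightarrow> real" where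
  "phi d \<alpha> Z u = (\<Prod>i\<in>{1..2*d}. u i powr (\<alpha> i - 1)) *
     (\<Prod>j\<in>{1..2*d}. (\<Sum>l\<in>{1..2*d}. Z j l * u l) powr (- \<alpha> j))"

definition Phi :: "nat \<Rightarrow> (nat \<Rightarrow> real) \<Rightarrow> (nat \<Rightarrow> nat \<Rightarrow> real) \<Rightarrow> ennreal" where
  "Phi d \<alpha> Z = (\<integral>\<^sup>+u. ennreal (phi d \<alpha> Z u) \<partial>lebesgue_simplex d)"

definition site_law :: "nat \<Rightarrow> (nat \<Rightarrow> real) \<Rightarrow> (nat \<Rightarrow> nat \<Rightarrow> real) \<Rightarrow> (nat \<Rightarrow> real) measure" where
  "site_law d \<alpha> Z = density (lebesgue_simplex d) (\<lambda>u. ennreal (phi d \<alpha> Z u) / Phi d \<alpha> Z)"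

text \<open>The steps \<open>unit_step d i\<close>, \<open>i \<in> {1..2*d}\<close>, are distinct, so the index is unique for
  \<open>e \<in> edges d\<close>.\<close>

definition direction :: "nat \<Rightarrow> edge \<Rightarrow> nat" where
  "direction d e = (THE i. i \<in> {1..2*d} \<and> snd e = fst e + unit_step d i)"

text \<open>Here \<open>u x j\<close> stands for the weight of the edge \<open>(x, x + unit_step d j)\<close>.\<close>

definition environment_of ::
  "nat \<Rightarrow> (nat \<Rightarrow> nat \<Rightarrow> real) \<Rightarrow> (site \<Rightarrow> nat \<Rightarrow> real) \<Rightarrow> edge \<times> edge \<Rightarrow> real" where
  "environment_of d Z u = (\<lambda>(e, e')\<in>edge_pairs d.
     Z (direction d e) (direction d e') * u (fst e') (direction d e') /
       (\<Sum>l\<in>{1..2*d}. Z (direction d e) l * u (fst e') l))"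

definition environment_law ::
  "nat \<Rightarrow> (nat \<Rightarrow> real) \<Rightarrow> (nat \<Rightarrow> nat \<Rightarrow> real) \<Rightarrow> (edge \<times> edge \<Rightarrow> real) measure" where
  "environment_law d \<alpha> Z =
     distr (PiM (sites d) (\<lambda>_. site_law d \<alpha> Z)) (environment_space d) (environment_of d Z)"


definition transition :: "nat \<Rightarrow> (edge \<times> edge \<Rightarrow> real) \<Rightarrow> edge \<Rightarrow> edge measure" where
  "transition d \<omega> e = point_measure (edges d)
     (\<lambda>e'. if (e, e') \<in> edge_pairs d then ennreal (\<omega> (e, e')) else 0)"

definition chain_kernel ::
  "nat \<Rightarrow> (edge \<times> edge \<Rightarrow> real) \<Rightarrow> edge \<Rightarrow> nat \<Rightarrow> (nat \<Rightarrow> edge) \<Rightarrow> edge measure" where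
  "chain_kernel d \<omega> e n X =
     (if n = 0 then return (count_space (edges d)) e else transition d \<omega> (X (n - 1)))"

text \<open>The law of the Markov chain on \<open>nat \<Rightarrow> edge\<close>, obtained from the Ionescu-Tulcea theorem;
  \<open>chain_kernel d \<omega> e n\<close> is the conditional law of \<open>X n\<close> given \<open>X 0, \<dots>, X (n - 1)\<close>.\<close>

definition quenched_law ::
  "nat \<Rightarrow> (edge \<times> edge \<Rightarrow> real) \<Rightarrow> edge \<Rightarrow> (nat \<Rightarrow> edge) measure" where
  "quenched_law d \<omega> e = projective_family.lim UNIV
     (Ionescu_Tulcea.CI (chain_kernel d \<omega> e) (\<lambda>_. count_space (edges d)))
     (\<lambda>_. count_space (edges d))"

definition green :: "nat \<Rightarrow> (edge \<times> edge \<Rightarrow> real) \<Rightarrow> edge \<Rightarrow> edge \<Rightarrow> ennreal" where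
  "green d \<omega> e e' = (\<Sum>n. emeasure (quenched_law d \<omega> e)
     {X \<in> space (quenched_law d \<omega> e). X n = e'})"

text \<open>Real powers, also for \<open>s \<le> 0\<close>. Only used for \<open>x \<ge> 1\<close>; the value at \<open>x = 0\<close>, \<open>s \<le> 0\<close>
  inherits the conventions of \<open>powr\<close>.\<close>

definition ennreal_powr :: "ennreal \<Rightarrow> real \<Rightarrow> ennreal" where
  "ennreal_powr x s =
     (if x = \<infinity> then if s > 0 then \<infinity> else if s = 0 then 1 else 0
      else ennreal (enn2real x powr s))"

definition transient_from :: "nat \<Rightarrow> (edge \<times> edge \<Rightarrow> real) \<Rightarrow> edge \<Rightarrow> bool" where
  "transient_from d \<omega> e \<longleftrightarrow>
     (\<forall>e'\<in>edges d. AE X in quenched_law d \<omega> e. finite {n. X n = e'})"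

end

theory Submission
  imports Defs
begin

text \<open>
  The Green function in \<open>e\<^sub>0\<close> is \<open>1 / (1 - R)\<close>, where \<open>R\<close> is the quenched probability of returning to
  \<open>e\<^sub>0\<close>. So a moment of \<open>1 / (1 - R)\<close> has to be bounded, and it is enough to do so uniformly over finite boxes outside of
  which the walk is killed.

  \<^emph>\<open>Reversal.\<close> Expand \<open>(1 - R) powr (- r)\<close> into powers of \<open>R\<close>. The coefficients are nonnegative, and
  \<open>R ^ k\<close> is the total weight of the closed words made of \<open>k\<close> excursions. The expected weight of a word is a product over the sites
  of quotients of integrals \<open>\<Phi>\<close>. These integrals satisfy a duality that exchanges the two families of exponents and transposes
  \<open>Z\<close> (\<open>hyp_mass_duality\<close>). If every edge has the same exponent at its tail and at its head, and the exponents
  balance at every site, then duality shows that a closed word and its reversal have the same expected weight, the latter in an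
  environment of transposed type (\<open>closed_word_duality\<close>). Now let there be, in the tail \<open>x\<close> of \<open>e\<^sub>0\<close>, one more incoming
  slot, of exponent \<open>\<gamma>\<close>. The reversed walk disappears through it in its first step with a probability \<open>Y\<close>, so its return
  probability is at most \<open>1 - Y\<close>. This gives \<open>E[(1 - R) powr (- r)] \<le> E[Y powr (- r)]\<close>, and the right-hand side is finite for
  \<open>r < \<gamma>\<close> (\<open>nn_integral_discounted_return\<close>, \<open>escape_moment_finite\<close>).

  \<^emph>\<open>Flow.\<close> The slot of exponent \<open>\<gamma>\<close> has to be balanced by increasing the exponents \<open>\<alpha>\<close> along a flow of strength
  \<open>\<gamma>\<close> from \<open>x\<close> to infinity. In dimension at least three there is a unit flow that is bounded by one and square summable, for
  instance the one given by Polya's urn (\<open>urn_flow_in\<close>, \<open>urn_mass_square_summable\<close>).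

  \<^emph>\<open>Change of law.\<close> The environment with exponents \<open>\<alpha>\<close> is compared with the one tilted by the flow by means of Young's
  inequality with exponents \<open>p\<close> and \<open>q\<close>. The price is a negative moment of the density. At each site its first-order terms cancel
  against the normalization, and the logarithm of what is left is bounded by a multiple of the squared flow through the site
  (\<open>tilt_moment_bound\<close>). So the price is bounded in all boxes. The requirements are \<open>s * q < \<gamma>\<close> and
  \<open>(p - 1) * \<gamma> < \<alpha> i\<close> for all \<open>i\<close>. As \<open>(p - 1) * q = p\<close>, which may be taken arbitrarily close to \<open>1\<close>, they can be met
  exactly when \<open>s\<close> is smaller than all \<open>\<alpha> i\<close> (\<open>discounted_return_moment\<close>).

  \<^emph>\<open>Transience.\<close> A finite moment of positive order makes the Green function finite almost surely. Since all edges communicate, every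
  edge is then visited finitely often by the Borel-Cantelli lemma (\<open>transient_of_green_finite\<close>).
\<close>

section \<open>Polar coordinates on the positive orthant\<close>

text \<open>Index sets are intervals \<open>{1..n}\<close>. Rewriting \<open>1\<close> to \<open>Suc 0\<close> inside them would hide their common shape.\<close>

declare One_nat_def [simp del]

definition open_simplex :: "nat \<Rightarrow> (nat \<Rightarrow> real) set" where
  "open_simplex n = {u \<in> {1..n} \<rightarrow>\<^sub>E {0<..1}. (\<Sum>i=1..n. u i) = 1}"

text \<open>The same reference measure as \<^const>\<open>lebesgue_simplex\<close>, for a simplex of arbitrary dimension: the
reversed environment lives at one site on a simplex with \<open>2 * d + 1\<close> coordinates.\<close>

definition simplex_measure :: "nat \<Rightarrow> (nat \<Rightarrow> real) measure" where
  "simplex_measure n = restrict_space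
     (distr (PiM {1..<n} (\<lambda>_. lborel)) (PiM {1..n} (\<lambda>_. borel))
        (\<lambda>v. v(n := 1 - (\<Sum>i\<in>{1..<n}. v i)))) (open_simplex n)"

lemma open_simplex_measurable [measurable]: "open_simplex n \<in> sets (PiM {1..n} (\<lambda>_. borel))"
proof -
  have eq: "open_simplex n = {u \<in> space (PiM {1..n} (\<lambda>_. borel)).
     (\<forall>i\<in>{1..n}. 0 < u i \<and> u i \<le> 1) \<and> (\<Sum>i=1..n. u i) = 1}"
    by (auto simp: open_simplex_def space_PiM PiE_iff)
  show ?thesis unfolding eq by measurable
qed

lemma last_coordinate_measurable [measurable]:
  fixes n :: nat
  assumes "n \<ge> 1"
  shows "(\<lambda>v. v(n := 1 - (\<Sum>i\<in>{1..<n}. v i)))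
    \<in> measurable (PiM {1..<n} (\<lambda>_. lborel)) (PiM {1..n} (\<lambda>_. borel :: real measure))"
proof -
  have eq: "{1..n} = {1..<n} \<union> {n}" using assms by auto
  show ?thesis
    by (rule measurable_fun_upd[OF eq]) auto
qed

lemma space_simplex_measure [simp]: "space (simplex_measure n) = open_simplex n"
  using sets.sets_into_space[OF open_simplex_measurable[of n]]
  by (auto simp: simplex_measure_def space_restrict_space space_PiM)

lemma sets_simplex_measure: "sets (simplex_measure n) = sets (restrict_space (PiM {1..n} (\<lambda>_. borel)) (open_simplex n))"
  by (simp add: simplex_measure_def sets_restrict_space)

lemma measurable_simplexI:
  assumes "f \<in> measurable (PiM {1..n} (\<lambda>_. borel)) N"
  shows "f \<in> measurable (simplex_measure n) N"
  using measurable_restrict_space1[OF assms, of "open_simplex n"]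
  by (simp add: measurable_cong_sets[OF sets_simplex_measure])

lemma measurable_simplex_component:
  assumes "i \<in> {1..n}"
  shows "(\<lambda>u. u i) \<in> borel_measurable (simplex_measure n)"
  by (rule measurable_simplexI) (use assms in measurable)

lemma nn_integral_simplex:
  assumes "n \<ge> 1" and f: "f \<in> borel_measurable (PiM {1..n} (\<lambda>_. borel))"
  shows "(\<integral>\<^sup>+u. f u \<partial>simplex_measure n) =
    (\<integral>\<^sup>+v. (let u = v(n := 1 - (\<Sum>i\<in>{1..<n}. v i)) in f u * indicator (open_simplex n) u)
       \<partial>PiM {1..<n} (\<lambda>_. lborel))"
proof -
  note f[measurable]
  have "(\<integral>\<^sup>+u. f u \<partial>simplex_measure n) = (\<integral>\<^sup>+u. f u * indicator (open_simplex n) u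
     \<partial>distr (PiM {1..<n} (\<lambda>_. lborel)) (PiM {1..n} (\<lambda>_. borel)) (\<lambda>v. v(n := 1 - (\<Sum>i\<in>{1..<n}. v i))))"
    unfolding simplex_measure_def
    using sets.Int[OF open_simplex_measurable[of n] sets.top]
    by (subst nn_integral_restrict_space) auto
  also have "\<dots> = (\<integral>\<^sup>+v. (let u = v(n := 1 - (\<Sum>i\<in>{1..<n}. v i)) in f u * indicator (open_simplex n) u)
       \<partial>PiM {1..<n} (\<lambda>_. lborel))"
    unfolding Let_def by (subst nn_integral_distr[OF last_coordinate_measurable[OF assms(1)]]) auto
  finally show ?thesis .
qed

interpretation lborel_product: product_sigma_finite "\<lambda>_::nat. lborel :: real measure"
  by standard

lemma measurable_PiM_lborel: "measurable (PiM I (\<lambda>_. lborel :: real measure)) N = measurable (PiM I (\<lambda>_. borel)) N"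
  by (intro measurable_cong_sets sets_PiM_cong) auto

text \<open>Scaling one coordinate at a time, each of them contributing a factor \<open>t\<close>.\<close>

lemma nn_integral_PiM_lborel_scale:
  fixes J :: "nat set"
  assumes "finite J" "t > 0" "f \<in> borel_measurable (PiM J (\<lambda>_. borel))"
  shows "(\<integral>\<^sup>+v. f v \<partial>PiM J (\<lambda>_. lborel)) =
    ennreal (t ^ card J) * (\<integral>\<^sup>+v. f (\<lambda>i\<in>J. t * v i) \<partial>PiM J (\<lambda>_. lborel))"
  using assms(1,3)
proof (induction J arbitrary: f)
  case empty
  then show ?case by (simp add: PiM_empty nn_integral_count_space_finite restrict_def)
next
  case (insert j J)
  have f[measurable]: "f \<in> borel_measurable (PiM (insert j J) (\<lambda>_. borel))" by fact
  have f': "f \<in> borel_measurable (PiM (insert j J) (\<lambda>_. lborel))" by (simp add: measurable_PiM_lborel)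
  have fs: "(\<lambda>v. f (\<lambda>i\<in>insert j J. t * v i)) \<in> borel_measurable (PiM (insert j J) (\<lambda>_. lborel))"
    unfolding measurable_PiM_lborel by measurable
  have upd: "(\<lambda>x. x(j := y)) \<in> measurable (PiM J (\<lambda>_. borel)) (PiM (insert j J) (\<lambda>_. borel :: real measure))" for y
    by measurable
  have "(\<integral>\<^sup>+v. f v \<partial>PiM (insert j J) (\<lambda>_. lborel)) =
     (\<integral>\<^sup>+y. \<integral>\<^sup>+x. f (x(j := y)) \<partial>PiM J (\<lambda>_. lborel) \<partial>lborel)"
    using insert.hyps f' by (intro lborel_product.product_nn_integral_insert_rev) auto
  also have "\<dots> = (\<integral>\<^sup>+y. ennreal (t ^ card J) * (\<integral>\<^sup>+x. f ((\<lambda>i\<in>J. t * x i)(j := y)) \<partial>PiM J (\<lambda>_. lborel)) \<partial>lborel)"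
    by (intro nn_integral_cong insert.IH measurable_compose[OF upd f])
  also have "\<dots> = ennreal t * (\<integral>\<^sup>+y. ennreal (t ^ card J) * (\<integral>\<^sup>+x. f ((\<lambda>i\<in>J. t * x i)(j := t * y)) \<partial>PiM J (\<lambda>_. lborel)) \<partial>lborel)"
  proof -
    have m0: "(\<lambda>p. (\<lambda>i\<in>J. t * snd p i)(j := fst p)) \<in> measurable (lborel \<Otimes>\<^sub>M PiM J (\<lambda>_. lborel)) (PiM (insert j J) (\<lambda>_. borel :: real measure))"
    proof (rule measurable_fun_upd[of "insert j J" J j])
      show "(\<lambda>x. \<lambda>i\<in>J. t * snd x i) \<in> lborel \<Otimes>\<^sub>M Pi\<^sub>M J (\<lambda>_. lborel) \<rightarrow>\<^sub>M Pi\<^sub>M J (\<lambda>_. borel)"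
        by (rule measurable_restrict) (auto intro!: borel_measurable_times measurable_compose[OF measurable_snd] simp: measurable_PiM_lborel)
    qed auto
    have "(\<lambda>y. \<integral>\<^sup>+x. f ((\<lambda>i\<in>J. t * x i)(j := y)) \<partial>PiM J (\<lambda>_. lborel)) \<in> borel_measurable lborel"
      using lborel_product.sigma_finite[OF insert.hyps(1)]
      by (intro sigma_finite_measure.borel_measurable_nn_integral)
         (use measurable_compose[OF m0 f] in \<open>simp_all add: case_prod_unfold\<close>)
    then show ?thesis
      using \<open>t > 0\<close> by (subst nn_integral_real_affine[where c = t and t = 0]) auto
  qed
  also have "\<dots> = ennreal t * (ennreal (t ^ card J) * (\<integral>\<^sup>+y. (\<integral>\<^sup>+x. f ((\<lambda>i\<in>insert j J. t * (x(j := y)) i)) \<partial>PiM J (\<lambda>_. lborel)) \<partial>lborel))"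
  proof -
    have "(\<lambda>i\<in>J. t * x i)(j := t * y) = (\<lambda>i\<in>insert j J. t * (x(j := y)) i)" for x y
      using insert.hyps by (auto simp: fun_eq_iff)
    moreover have "(\<lambda>y. \<integral>\<^sup>+x. f ((\<lambda>i\<in>insert j J. t * (x(j := y)) i)) \<partial>PiM J (\<lambda>_. lborel)) \<in> borel_measurable lborel"
    proof (intro sigma_finite_measure.borel_measurable_nn_integral lborel_product.sigma_finite insert.hyps)
      have "(\<lambda>p. (\<lambda>i\<in>insert j J. t * ((snd p)(j := fst p)) i)) \<in> measurable (lborel \<Otimes>\<^sub>M PiM J (\<lambda>_. lborel)) (PiM (insert j J) (\<lambda>_. borel :: real measure))"
        by (rule measurable_restrict) (auto simp: fun_upd_def intro!: borel_measurable_times measurable_compose[OF measurable_snd] simp: measurable_PiM_lborel)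
      from measurable_compose[OF this f]
      show "(\<lambda>(y, x). f ((\<lambda>i\<in>insert j J. t * (x(j := y)) i))) \<in> borel_measurable (lborel \<Otimes>\<^sub>M PiM J (\<lambda>_. lborel))"
        by (simp add: case_prod_unfold)
    qed
    ultimately show ?thesis by (subst nn_integral_cmult[symmetric]) auto
  qed
  also have "\<dots> = ennreal (t ^ card (insert j J)) * (\<integral>\<^sup>+v. f (\<lambda>i\<in>insert j J. t * v i) \<partial>PiM (insert j J) (\<lambda>_. lborel))"
    using insert.hyps fs \<open>t > 0\<close>
    by (subst lborel_product.product_nn_integral_insert_rev[OF insert.hyps(1,2)])
       (auto simp: ennreal_mult mult.assoc)
  finally show ?case .
qed

text \<open>A positive vector is \<open>t * u\<close> with \<open>t\<close> the sum of its entries and \<open>u\<close> in the simplex. In the coordinates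
\<open>v 1, \<dots>, v (m - 1), v m\<close> this is a shift of the last coordinate, which introduces \<open>t\<close>, followed by a scaling
of the first \<open>m - 1\<close> coordinates, which produces the Jacobian \<open>t ^ (m - 1)\<close>.\<close>

lemma nn_integral_polar:
  assumes "m \<ge> 1" and f: "f \<in> borel_measurable (PiM {1..m} (\<lambda>_. borel))"
  shows "(\<integral>\<^sup>+v. f v * indicator {v. \<forall>i\<in>{1..m}. 0 < v i} v \<partial>PiM {1..m} (\<lambda>_. lborel)) =
    (\<integral>\<^sup>+t. indicator {0<..} t * (ennreal (t ^ (m - 1)) *
       (\<integral>\<^sup>+u. f (\<lambda>i\<in>{1..m}. t * u i) \<partial>simplex_measure m)) \<partial>lborel)"
proof -
  let ?I = "\<lambda>t. \<integral>\<^sup>+u. f (\<lambda>i\<in>{1..m}. t * u i) \<partial>simplex_measure m"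
  note f[measurable]
  define J where "J = {1..<m}"
  have J: "finite J" "m \<notin> J" "{1..m} = insert m J" "{1..m} = J \<union> {m}" "card J = m - 1"
    using assms(1) by (auto simp: J_def)
  define pos where "pos = {v :: nat \<Rightarrow> real. \<forall>i\<in>{1..m}. 0 < v i}"
  define g where "g v = f v * indicator pos v" for v
  have [measurable]: "g \<in> borel_measurable (PiM {1..m} (\<lambda>_. borel))"
  proof -
    have "(indicator pos :: _ \<Rightarrow> ennreal) \<in> borel_measurable (PiM {1..m} (\<lambda>_. borel))"
      by (rule borel_measurable_indicator', simp add: pos_def) measurable
    then show ?thesis unfolding g_def by measurable
  qed
  have upd: "(\<lambda>p. (snd p)(m := fst p - (\<Sum>i\<in>J. snd p i)))
      \<in> measurable (lborel \<Otimes>\<^sub>M PiM J (\<lambda>_. lborel)) (PiM {1..m} (\<lambda>_. borel :: real measure))"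
  proof -
    have sets_eq: "sets ((lborel :: real measure) \<Otimes>\<^sub>M PiM J (\<lambda>_. lborel :: real measure)) =
        sets ((borel :: real measure) \<Otimes>\<^sub>M PiM J (\<lambda>_. borel :: real measure))"
      by (intro sets_pair_measure_cong sets_PiM_cong) auto
    show ?thesis
      unfolding measurable_cong_sets[OF sets_eq refl]
      by (rule measurable_fun_upd[OF J(4)]) measurable
  qed
  have upd': "(\<lambda>x. x(m := y - (\<Sum>i\<in>J. x i))) \<in> measurable (PiM J (\<lambda>_. borel)) (PiM {1..m} (\<lambda>_. borel :: real measure))" for y
    by (rule measurable_fun_upd[OF J(4)]) auto
  interpret pair_sigma_finite "PiM J (\<lambda>_. lborel :: real measure)" "lborel :: real measure"
    using lborel_product.sigma_finite[OF J(1)]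
    by (simp add: pair_sigma_finite_def sigma_finite_lborel)
  have "(\<integral>\<^sup>+v. g v \<partial>PiM {1..m} (\<lambda>_. lborel)) =
      (\<integral>\<^sup>+x. \<integral>\<^sup>+y. g (x(m := y)) \<partial>lborel \<partial>PiM J (\<lambda>_. lborel))"
    unfolding J(3) by (rule lborel_product.product_nn_integral_insert)
      (use J(1,2) in \<open>simp_all add: measurable_PiM_lborel flip: J(3)\<close>)
  also have "\<dots> = (\<integral>\<^sup>+x. \<integral>\<^sup>+y. g (x(m := y - (\<Sum>i\<in>J. x i))) \<partial>lborel \<partial>PiM J (\<lambda>_. lborel))"
  proof (rule nn_integral_cong)
    fix x :: "nat \<Rightarrow> real" assume "x \<in> space (PiM J (\<lambda>_. lborel))"
    then have "(\<lambda>y. x(m := y)) \<in> measurable borel (PiM {1..m} (\<lambda>_. borel :: real measure))"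
      by (intro measurable_fun_upd[OF J(4)]) (auto simp: space_PiM)
    then have "(\<lambda>y. g (x(m := y))) \<in> borel_measurable borel" by measurable
    from nn_integral_real_affine[OF this, of 1 "- (\<Sum>i\<in>J. x i)"]
    show "(\<integral>\<^sup>+y. g (x(m := y)) \<partial>lborel) = (\<integral>\<^sup>+y. g (x(m := y - (\<Sum>i\<in>J. x i))) \<partial>lborel)"
      by simp
  qed
  also have "\<dots> = (\<integral>\<^sup>+y. \<integral>\<^sup>+x. g (x(m := y - (\<Sum>i\<in>J. x i))) \<partial>PiM J (\<lambda>_. lborel) \<partial>lborel)"
  proof (rule Fubini'[symmetric])
    have sw: "(\<lambda>p. (snd p, fst p)) \<in> measurable (PiM J (\<lambda>_. lborel :: real measure) \<Otimes>\<^sub>M (lborel :: real measure)) (lborel \<Otimes>\<^sub>M PiM J (\<lambda>_. lborel))"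
      by (intro measurable_Pair measurable_snd measurable_fst)
    show "(\<lambda>(x, y). g (x(m := y - (\<Sum>i\<in>J. x i)))) \<in> borel_measurable (PiM J (\<lambda>_. lborel) \<Otimes>\<^sub>M lborel)"
      using measurable_compose[OF measurable_compose[OF sw upd], of g borel]
      by (simp add: case_prod_unfold)
  qed
  also have "\<dots> = (\<integral>\<^sup>+t. indicator {0<..} t * (ennreal (t ^ (m - 1)) *
       ?I t) \<partial>lborel)"
  proof (rule nn_integral_cong)
    fix t :: real
    \<comment> \<open>A positive vector has a positive sum, so only \<open>t > 0\<close> contributes.\<close>
    show "(\<integral>\<^sup>+x. g (x(m := t - (\<Sum>i\<in>J. x i))) \<partial>PiM J (\<lambda>_. lborel)) = indicator {0<..} t * (ennreal (t ^ (m - 1)) *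
       ?I t)"
    proof (cases "t > 0")
      case False
      have "g (x(m := t - (\<Sum>i\<in>J. x i))) = 0" for x
      proof -
        have "x(m := t - (\<Sum>i\<in>J. x i)) \<notin> pos"
        proof
          assume h: "x(m := t - (\<Sum>i\<in>J. x i)) \<in> pos"
          then have p: "0 < (x(m := t - (\<Sum>i\<in>J. x i))) i" if "i \<in> {1..m}" for i
            using that by (auto simp: pos_def)
          have "0 < x i" if "i \<in> J" for i using p[of i] that J(2,3) by (auto split: if_splits)
          then have "(\<Sum>i\<in>J. x i) \<ge> 0" by (intro sum_nonneg) (auto intro: less_imp_le)
          moreover have "t - (\<Sum>i\<in>J. x i) > 0" using p[of m] assms(1) by auto
          ultimately show False using False by simp
        qed
        then show ?thesis by (simp add: g_def)
      qed
      then show ?thesis using False by simp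
    next
      case True
      have "(\<integral>\<^sup>+x. g (x(m := t - (\<Sum>i\<in>J. x i))) \<partial>PiM J (\<lambda>_. lborel)) =
         ennreal (t ^ (m - 1)) * (\<integral>\<^sup>+x. g ((\<lambda>i\<in>J. t * x i)(m := t - (\<Sum>i\<in>J. (\<lambda>i\<in>J. t * x i) i))) \<partial>PiM J (\<lambda>_. lborel))"
        using measurable_compose[OF upd'[of t], of g borel]
        by (subst nn_integral_PiM_lborel_scale[OF J(1) True]) (auto simp: J(5))
      also have "(\<integral>\<^sup>+x. g ((\<lambda>i\<in>J. t * x i)(m := t - (\<Sum>i\<in>J. (\<lambda>i\<in>J. t * x i) i))) \<partial>PiM J (\<lambda>_. lborel)) =
         (\<integral>\<^sup>+x. f (\<lambda>i\<in>{1..m}. t * (x(m := 1 - sum x J)) i) * indicator (open_simplex m) (x(m := 1 - sum x J)) \<partial>PiM J (\<lambda>_. lborel))"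
      proof (rule nn_integral_cong)
        fix x :: "nat \<Rightarrow> real" assume x: "x \<in> space (PiM J (\<lambda>_. lborel))"
        define u where "u = x(m := 1 - (\<Sum>i\<in>J. x i))"
        have eq: "(\<lambda>i\<in>J. t * x i)(m := t - (\<Sum>i\<in>J. (\<lambda>i\<in>J. t * x i) i)) = (\<lambda>i\<in>{1..m}. t * u i)"
          using J(2,3) by (auto simp: fun_eq_iff u_def sum_distrib_left right_diff_distrib)
        have sum1: "(\<Sum>i=1..m. u i) = 1"
        proof -
          have "(\<Sum>i\<in>J. u i) = (\<Sum>i\<in>J. x i)" using J(2) by (intro sum.cong) (auto simp: u_def)
          then show ?thesis unfolding J(3) using J(1,2) by (simp add: u_def)
        qed
        have ext: "u \<in> extensional {1..m}" using x J(3) by (auto simp: u_def space_PiM PiE_def extensional_def)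
        have "(\<lambda>i\<in>{1..m}. t * u i) \<in> pos \<longleftrightarrow> (\<forall>i\<in>{1..m}. 0 < u i)"
          using True by (auto simp: pos_def zero_less_mult_iff)
        also have "\<dots> \<longleftrightarrow> u \<in> open_simplex m"
        proof
          assume h: "\<forall>i\<in>{1..m}. 0 < u i"
          have "u i \<le> 1" if "i \<in> {1..m}" for i
            using member_le_sum[of i "{1..m}" u] that h sum1 by (force intro: less_imp_le)
          then show "u \<in> open_simplex m"
            using h sum1 ext by (auto simp: open_simplex_def PiE_def)
        qed (auto simp: open_simplex_def PiE_def)
        finally have "indicator pos (\<lambda>i\<in>{1..m}. t * u i) = (indicator (open_simplex m) u :: ennreal)"
          by (auto simp: indicator_def)
        then show "g ((\<lambda>i\<in>J. t * x i)(m := t - (\<Sum>i\<in>J. (\<lambda>i\<in>J. t * x i) i))) =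
          f (\<lambda>i\<in>{1..m}. t * (x(m := 1 - sum x J)) i) * indicator (open_simplex m) (x(m := 1 - sum x J))"
          unfolding eq g_def by (simp add: u_def)
      qed
      also have "\<dots> = ?I t"
        by (subst nn_integral_simplex[OF assms(1)]) (simp_all add: J_def Let_def)
      finally show ?thesis using True by (simp add: fun_upd_def)
    qed
  qed
  finally show ?thesis by (simp add: g_def pos_def)
qed

lemma nn_integral_gamma_kernel:
  fixes b c :: real
  assumes "b > 0" "c > 0"
  shows "(\<integral>\<^sup>+t. ennreal (t powr (b - 1) * exp (- c * t)) * indicator {0<..} t \<partial>lborel) =
    ennreal (Gamma b * c powr (- b))"
proof -
  have ae: "AE t::real in lborel. t \<noteq> 0" by (rule AE_lborel_singleton)
  have "ennreal (Gamma b) = (\<integral>\<^sup>+t. ennreal (t powr (b - 1) * exp (- t)) * indicator {0<..} t \<partial>lborel)"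
    unfolding Gamma_conv_nn_integral_real[OF assms(1)]
    by (rule nn_integral_cong_AE, use ae in eventually_elim)
       (auto simp: indicator_def exp_minus field_simps)
  also have "\<dots> = ennreal c * (\<integral>\<^sup>+t. ennreal ((c * t) powr (b - 1) * exp (- (c * t))) * indicator {0<..} (c * t) \<partial>lborel)"
    using assms by (subst nn_integral_real_affine[where c = c and t = 0]) auto
  also have "(\<integral>\<^sup>+t. ennreal ((c * t) powr (b - 1) * exp (- (c * t))) * indicator {0<..} (c * t) \<partial>lborel) =
     (\<integral>\<^sup>+t. ennreal (c powr (b - 1)) * (ennreal (t powr (b - 1) * exp (- c * t)) * indicator {0<..} t) \<partial>lborel)"
    using assms by (intro nn_integral_cong)
      (auto simp: indicator_def powr_mult zero_less_mult_iff mult.assoc simp flip: ennreal_mult)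
  also have "\<dots> = ennreal (c powr (b - 1)) * (\<integral>\<^sup>+t. ennreal (t powr (b - 1) * exp (- c * t)) * indicator {0<..} t \<partial>lborel)"
    by (rule nn_integral_cmult) auto
  finally have "ennreal (Gamma b) = ennreal (c powr b) * (\<integral>\<^sup>+t. ennreal (t powr (b - 1) * exp (- c * t)) * indicator {0<..} t \<partial>lborel)" (is "_ = _ * ?I")
    using assms by (simp add: ennreal_mult[symmetric] mult.assoc[symmetric] powr_diff)
  then have "ennreal (c powr (- b)) * ennreal (Gamma b) = ennreal (c powr (- b) * c powr b) * ?I"
    by (simp add: ennreal_mult mult.assoc)
  then show ?thesis using assms by (simp add: powr_add[symmetric] mult.commute flip: ennreal_mult)
qed

section \<open>Feynman parametrization and the duality of hypergeometric masses\<close>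

lemma open_simplexD:
  assumes "u \<in> open_simplex n"
  shows "i \<in> {1..n} \<Longrightarrow> 0 < u i" "i \<in> {1..n} \<Longrightarrow> u i \<le> 1" "(\<Sum>i=1..n. u i) = 1"
  using assms by (auto simp: open_simplex_def PiE_iff)

text \<open>The first \<open>n - 1\<close> coordinates of a point of the simplex range in a unit cube.\<close>

lemma finite_simplex_measure:
  assumes "n \<ge> 1"
  shows "finite_measure (simplex_measure n)"
proof
  have "emeasure (simplex_measure n) (space (simplex_measure n)) = (\<integral>\<^sup>+u. 1 \<partial>simplex_measure n)"
    by simp
  also have "\<dots> = (\<integral>\<^sup>+v. indicator (open_simplex n) (v(n := 1 - (\<Sum>i\<in>{1..<n}. v i))) \<partial>PiM {1..<n} (\<lambda>_. lborel))"
    by (subst nn_integral_simplex[OF assms]) (auto simp: Let_def)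
  also have "\<dots> \<le> (\<integral>\<^sup>+v. (\<Prod>i\<in>{1..<n}. indicator {0..1::real} (v i)) \<partial>PiM {1..<n} (\<lambda>_. lborel))"
  proof (rule nn_integral_mono)
    fix v :: "nat \<Rightarrow> real"
    show "indicator (open_simplex n) (v(n := 1 - (\<Sum>i\<in>{1..<n}. v i))) \<le> (\<Prod>i\<in>{1..<n}. indicator {0..1} (v i) :: ennreal)"
    proof (cases "v(n := 1 - (\<Sum>i\<in>{1..<n}. v i)) \<in> open_simplex n")
      case True
      have "v i \<in> {0..1}" if "i \<in> {1..<n}" for i
        using open_simplexD(1,2)[OF True, of i] that by auto
      then show ?thesis using True by simp
    qed simp
  qed
  also have "\<dots> = 1"
    by (subst lborel_product.product_nn_integral_prod) auto
  finally show "emeasure (simplex_measure n) (space (simplex_measure n)) \<noteq> \<infinity>"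
    by (auto simp: top_unique)
qed

text \<open>Each factor \<open>Gamma (b i) * c i powr (- b i)\<close> is a Gamma integral over \<open>v i > 0\<close>. In polar coordinates
\<open>v = t * w\<close> the radial part of the product of these integrals is again a Gamma integral, of exponent \<open>\<Sum>i. b i\<close> and rate
\<open>\<Sum>i. c i * w i\<close>.\<close>

lemma feynman_parametrization:
  fixes b c :: "nat \<Rightarrow> real"
  assumes "m \<ge> 1" and b: "\<And>i. i \<in> {1..m} \<Longrightarrow> b i > 0" and c: "\<And>i. i \<in> {1..m} \<Longrightarrow> c i > 0"
  shows "ennreal (\<Prod>i=1..m. Gamma (b i) * c i powr (- b i)) =
    ennreal (Gamma (\<Sum>i=1..m. b i)) *
    (\<integral>\<^sup>+w. ennreal ((\<Prod>i=1..m. w i powr (b i - 1)) * (\<Sum>i=1..m. c i * w i) powr (- (\<Sum>i=1..m. b i)))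
      \<partial>simplex_measure m)"
proof -
  let ?W = "\<lambda>w. \<Prod>i=1..m. w i powr (b i - 1)" and ?c = "\<lambda>w. \<Sum>i=1..m. c i * w i"
  define S where "S = (\<Sum>i=1..m. b i)"
  have S: "S > 0" unfolding S_def using assms by (intro sum_pos) auto
  define f :: "(nat \<Rightarrow> real) \<Rightarrow> ennreal" where "f v = (\<Prod>i=1..m. ennreal (v i powr (b i - 1) * exp (- c i * v i)))" for v
  have f[measurable]: "f \<in> borel_measurable (PiM {1..m} (\<lambda>_. borel))"
    unfolding f_def by measurable
  have "ennreal (\<Prod>i=1..m. Gamma (b i) * c i powr (- b i)) = (\<Prod>i=1..m. ennreal (Gamma (b i) * c i powr (- b i)))"
    by (subst prod_ennreal) (use b in \<open>auto intro!: mult_nonneg_nonneg Gamma_real_nonneg less_imp_le\<close>)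
  also have "\<dots> = (\<Prod>i=1..m. \<integral>\<^sup>+t. ennreal (t powr (b i - 1) * exp (- c i * t)) * indicator {0<..} t \<partial>lborel)"
    by (intro prod.cong refl nn_integral_gamma_kernel[symmetric] b c)
  also have "\<dots> = (\<integral>\<^sup>+v. (\<Prod>i=1..m. ennreal (v i powr (b i - 1) * exp (- c i * v i)) * indicator {0<..} (v i)) \<partial>PiM {1..m} (\<lambda>_. lborel))"
    by (subst lborel_product.product_nn_integral_prod) auto
  also have "\<dots> = (\<integral>\<^sup>+v. f v * indicator {v. \<forall>i\<in>{1..m}. 0 < v i} v \<partial>PiM {1..m} (\<lambda>_. lborel))"
    by (intro nn_integral_cong) (auto simp: f_def prod.distrib indicator_def)
  also have "\<dots> = (\<integral>\<^sup>+t. indicator {0<..} t * (ennreal (t ^ (m - 1)) *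
       (\<integral>\<^sup>+u. f (\<lambda>i\<in>{1..m}. t * u i) \<partial>simplex_measure m)) \<partial>lborel)"
    by (rule nn_integral_polar[OF assms(1) f])
  also have "\<dots> = (\<integral>\<^sup>+t. \<integral>\<^sup>+w. ennreal (?W w * (t powr (S - 1) * exp (- (?c w) * t))) * indicator {0<..} t
       \<partial>simplex_measure m \<partial>lborel)"
  proof (rule nn_integral_cong)
    fix t :: real
    show "indicator {0<..} t * (ennreal (t ^ (m - 1)) * (\<integral>\<^sup>+u. f (\<lambda>i\<in>{1..m}. t * u i) \<partial>simplex_measure m)) =
      (\<integral>\<^sup>+w. ennreal (?W w * (t powr (S - 1) * exp (- (?c w) * t))) * indicator {0<..} t
       \<partial>simplex_measure m)"
    proof (cases "t > 0")
      case True
      have "ennreal (t ^ (m - 1)) * f (\<lambda>i\<in>{1..m}. t * w i) =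
          ennreal (?W w * (t powr (S - 1) * exp (- (?c w) * t)))"
        if w: "w \<in> open_simplex m" for w
      proof -
        have "f (\<lambda>i\<in>{1..m}. t * w i) = (\<Prod>i=1..m. ennreal ((t * w i) powr (b i - 1) * exp (- c i * (t * w i))))"
          unfolding f_def by (intro prod.cong) auto
        also have "\<dots> = ennreal (\<Prod>i=1..m. (t * w i) powr (b i - 1) * exp (- c i * (t * w i)))"
          by (rule prod_ennreal) auto
        also have "(\<Prod>i=1..m. (t * w i) powr (b i - 1) * exp (- c i * (t * w i))) =
            (\<Prod>i=1..m. t powr (b i - 1)) * ?W w * (\<Prod>i=1..m. exp (- c i * (t * w i)))"
          unfolding prod.distrib[symmetric]
          by (intro prod.cong) (use True w in \<open>auto simp: powr_mult dest: open_simplexD\<close>)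
        also have "(\<Prod>i=1..m. t powr (b i - 1)) = t powr (S - real m)"
          using True by (simp add: powr_sum[symmetric] sum_subtractf S_def)
        also have "(\<Prod>i=1..m. exp (- c i * (t * w i))) = exp (- (?c w) * t)"
          by (simp add: exp_sum[symmetric] sum_distrib_left sum_negf mult_ac)
        finally have fe: "f (\<lambda>i\<in>{1..m}. t * w i) =
          ennreal (t powr (S - real m) * ?W w * exp (- (?c w) * t))" .
        have "ennreal (t ^ (m - 1)) * f (\<lambda>i\<in>{1..m}. t * w i) = ennreal (t ^ (m - 1) *
          (t powr (S - real m) * ?W w * exp (- (?c w) * t)))"
          unfolding fe using True by (subst ennreal_mult'[symmetric]) simp_all
        also have "t ^ (m - 1) * (t powr (S - real m) * ?W w * exp (- (?c w) * t)) =
           (t ^ (m - 1) * t powr (S - real m)) * (?W w * exp (- (?c w) * t))"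
          by (simp add: ac_simps)
        also have "t ^ (m - 1) * t powr (S - real m) = t powr (S - 1)"
          using True assms(1) by (simp add: powr_realpow[symmetric] powr_add[symmetric] of_nat_diff)
        finally show ?thesis by (simp only: mult_ac)
      qed
      moreover have mf: "(\<lambda>u. f (\<lambda>i\<in>{1..m}. t * u i)) \<in> borel_measurable (simplex_measure m)"
        by (rule measurable_simplexI) measurable
      ultimately show ?thesis using True
        by (subst nn_integral_cmult[symmetric]) (auto intro!: nn_integral_cong)
    qed simp
  qed
  also have "\<dots> = (\<integral>\<^sup>+w. \<integral>\<^sup>+t. ennreal (?W w * (t powr (S - 1) * exp (- (?c w) * t))) * indicator {0<..} t
       \<partial>lborel \<partial>simplex_measure m)"
  proof -
    interpret finite_measure "simplex_measure m" by (rule finite_simplex_measure[OF assms(1)])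
    interpret pair_sigma_finite "simplex_measure m" "lborel :: real measure" ..
    have [measurable]: "(\<lambda>p. fst p i) \<in> borel_measurable (simplex_measure m \<Otimes>\<^sub>M (lborel :: real measure))" if "i \<in> {1..m}" for i
      by (rule measurable_compose[OF measurable_fst measurable_simplex_component[OF that]])
    show ?thesis
      by (rule Fubini', unfold case_prod_unfold,
          intro measurable_compose[OF _ measurable_ennreal] borel_measurable_times_ennreal borel_measurable_times borel_measurable_prod
            borel_measurable_sum powr_real_measurable borel_measurable_exp) measurable
  qed
  also have "\<dots> = (\<integral>\<^sup>+w. ennreal (Gamma S) * ennreal (?W w * ?c w powr (- S)) \<partial>simplex_measure m)"
  proof (rule nn_integral_cong)
    fix w assume "w \<in> space (simplex_measure m)"
    then have w: "w \<in> open_simplex m" by simp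
    have cw: "?c w > 0"
      using assms(1) by (intro sum_pos) (use c open_simplexD(1)[OF w] in auto)
    have "(\<integral>\<^sup>+t. ennreal (?W w * (t powr (S - 1) * exp (- (?c w) * t))) * indicator {0<..} t \<partial>lborel)
      = (\<integral>\<^sup>+t. ennreal (?W w) * (ennreal (t powr (S - 1) * exp (- (?c w) * t)) * indicator {0<..} t) \<partial>lborel)"
      by (intro nn_integral_cong) (simp add: ennreal_mult prod_nonneg mult.assoc)
    also have "\<dots> = ennreal (?W w) * ennreal (Gamma S * ?c w powr (- S))"
      by (subst nn_integral_cmult) (simp_all only: nn_integral_gamma_kernel[OF S cw], measurable)
    also have "\<dots> = ennreal (Gamma S) * ennreal (?W w * ?c w powr (- S))"
      using S by (simp add: ennreal_mult[symmetric] prod_nonneg Gamma_real_nonneg mult_ac)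
    finally show "(\<integral>\<^sup>+t. ennreal (?W w * (t powr (S - 1) * exp (- (?c w) * t))) * indicator {0<..} t \<partial>lborel)
      = ennreal (Gamma S) * ennreal (?W w * ?c w powr (- S))" .
  qed
  also have "\<dots> = ennreal (Gamma S) * (\<integral>\<^sup>+w. ennreal (?W w * ?c w powr (- S)) \<partial>simplex_measure m)"
    by (rule nn_integral_cmult, rule measurable_simplexI) measurable
  finally show ?thesis unfolding S_def .
qed

text \<open>The density \<open>\<phi>\<close> with \<open>n\<close> outgoing and \<open>m\<close> incoming slots and independent exponents: \<open>a\<close> for the coordinates and
\<open>b\<close> for the linear forms. The exponents have to vary, because moments and tilted laws are again of this form.\<close>

definition hyp_weight :: "nat \<Rightarrow> nat \<Rightarrow> (nat \<Rightarrow> real) \<Rightarrow> (nat \<Rightarrow> real) \<Rightarrow> (nat \<Rightarrow> nat \<Rightarrow> real) \<Rightarrow> (nat \<Rightarrow> real) \<Rightarrow> real" where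
  "hyp_weight m n a b Z u = (\<Prod>j=1..n. u j powr (a j - 1)) *
     (\<Prod>i=1..m. (\<Sum>l=1..n. Z i l * u l) powr (- b i))"

definition hyp_mass :: "nat \<Rightarrow> nat \<Rightarrow> (nat \<Rightarrow> real) \<Rightarrow> (nat \<Rightarrow> real) \<Rightarrow> (nat \<Rightarrow> nat \<Rightarrow> real) \<Rightarrow> ennreal" where
  "hyp_mass m n a b Z = (\<integral>\<^sup>+u. ennreal (hyp_weight m n a b Z u) \<partial>simplex_measure n)"

definition hyp_law :: "nat \<Rightarrow> nat \<Rightarrow> (nat \<Rightarrow> real) \<Rightarrow> (nat \<Rightarrow> real) \<Rightarrow> (nat \<Rightarrow> nat \<Rightarrow> real) \<Rightarrow> (nat \<Rightarrow> real) measure" where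
  "hyp_law m n a b Z = density (simplex_measure n) (\<lambda>u. ennreal (hyp_weight m n a b Z u) / hyp_mass m n a b Z)"

lemma hyp_weight_nonneg [simp]: "hyp_weight m n a b Z u \<ge> 0"
  by (auto simp: hyp_weight_def intro!: mult_nonneg_nonneg prod_nonneg)

lemma hyp_weight_measurable [measurable]: "hyp_weight m n a b Z \<in> borel_measurable (simplex_measure n)"
  unfolding hyp_weight_def[abs_def] by (rule measurable_simplexI) measurable

lemma double_kernel_measurable:
  "(\<lambda>(w, u). ennreal ((\<Prod>j=1..n. u j powr (a j - 1)) * (\<Prod>i=1..m. w i powr (b i - 1)) *
      (\<Sum>i=1..m. \<Sum>j=1..n. Z i j * w i * u j) powr S))
    \<in> borel_measurable (simplex_measure m \<Otimes>\<^sub>M simplex_measure n)"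
proof -
  have [measurable]: "(\<lambda>p. fst p i) \<in> borel_measurable (simplex_measure m \<Otimes>\<^sub>M simplex_measure n)" if "i \<in> {1..m}" for i
    by (rule measurable_compose[OF measurable_fst measurable_simplex_component[OF that]])
  have [measurable]: "(\<lambda>p. snd p j) \<in> borel_measurable (simplex_measure m \<Otimes>\<^sub>M simplex_measure n)" if "j \<in> {1..n}" for j
    by (rule measurable_compose[OF measurable_snd measurable_simplex_component[OF that]])
  show ?thesis
    unfolding case_prod_unfold
    by (intro measurable_compose[OF _ measurable_ennreal] borel_measurable_times borel_measurable_prod
        borel_measurable_sum powr_real_measurable) measurable
qed

text \<open>The powers of the linear forms are replaced by an integral over a second simplex. The resulting kernel depends on
\<open>u\<close> and \<open>w\<close> through the bilinear form \<open>\<Sum>i j. Z i j * w i * u j\<close> only.\<close>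

lemma hyp_mass_eq_double_integral:
  assumes "m \<ge> 1" "n \<ge> 1" and b: "\<And>i. i \<in> {1..m} \<Longrightarrow> b i > 0"
    and Z: "\<And>i j. i \<in> {1..m} \<Longrightarrow> j \<in> {1..n} \<Longrightarrow> Z i j > 0"
  shows "ennreal (\<Prod>i=1..m. Gamma (b i)) * hyp_mass m n a b Z =
    ennreal (Gamma (\<Sum>i=1..m. b i)) * (\<integral>\<^sup>+u. \<integral>\<^sup>+w. ennreal ((\<Prod>j=1..n. u j powr (a j - 1)) *
      (\<Prod>i=1..m. w i powr (b i - 1)) * (\<Sum>i=1..m. \<Sum>j=1..n. Z i j * w i * u j) powr (- (\<Sum>i=1..m. b i)))
      \<partial>simplex_measure m \<partial>simplex_measure n)"
proof -
  let ?K = "\<lambda>u w. ennreal ((\<Prod>j=1..n. u j powr (a j - 1)) *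
      (\<Prod>i=1..m. w i powr (b i - 1)) * (\<Sum>i=1..m. \<Sum>j=1..n. Z i j * w i * u j) powr (- (\<Sum>i=1..m. b i)))"
  let ?U = "\<lambda>u. \<Prod>j=1..n. u j powr (a j - 1)" and ?L = "\<lambda>i u. \<Sum>l=1..n. Z i l * u l"
  interpret finite_measure "simplex_measure m" by (rule finite_simplex_measure[OF assms(1)])
  have "ennreal (\<Prod>i=1..m. Gamma (b i)) * hyp_mass m n a b Z =
     (\<integral>\<^sup>+u. ennreal (\<Prod>i=1..m. Gamma (b i)) * ennreal (hyp_weight m n a b Z u) \<partial>simplex_measure n)"
    unfolding hyp_mass_def by (rule nn_integral_cmult[symmetric]) measurable
  also have "\<dots> = (\<integral>\<^sup>+u. ennreal (Gamma (\<Sum>i=1..m. b i)) * (\<integral>\<^sup>+w. ?K u w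
      \<partial>simplex_measure m) \<partial>simplex_measure n)"
  proof (rule nn_integral_cong)
    fix u assume "u \<in> space (simplex_measure n)"
    then have u: "u \<in> open_simplex n" by simp
    have c: "?L i u > 0" if "i \<in> {1..m}" for i
      using assms(2) that by (intro sum_pos) (use Z open_simplexD(1)[OF u] in auto)
    have "0 \<le> (\<Prod>i=1..m. Gamma (b i))"
      by (intro prod_nonneg) (use b in \<open>auto intro: less_imp_le Gamma_real_nonneg\<close>)
    then have "ennreal (\<Prod>i=1..m. Gamma (b i)) * ennreal (hyp_weight m n a b Z u) =
       ennreal (?U u) * ennreal (\<Prod>i=1..m. Gamma (b i) * ?L i u powr (- b i))"
      unfolding hyp_weight_def prod.distrib
      by (simp add: ennreal_mult[symmetric] prod_nonneg mult_ac)
    also have "\<dots> = ennreal (Gamma (\<Sum>i=1..m. b i)) * (ennreal (?U u) *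
      (\<integral>\<^sup>+w. ennreal ((\<Prod>i=1..m. w i powr (b i - 1)) * (\<Sum>i=1..m. ?L i u * w i) powr (- (\<Sum>i=1..m. b i)))
      \<partial>simplex_measure m))"
      by (subst feynman_parametrization[OF assms(1) b c]) (auto simp: mult_ac)
    also have "ennreal (?U u) *
      (\<integral>\<^sup>+w. ennreal ((\<Prod>i=1..m. w i powr (b i - 1)) * (\<Sum>i=1..m. ?L i u * w i) powr (- (\<Sum>i=1..m. b i)))
      \<partial>simplex_measure m) = (\<integral>\<^sup>+w. ennreal (?U u) *
         ennreal ((\<Prod>i=1..m. w i powr (b i - 1)) * (\<Sum>i=1..m. ?L i u * w i) powr (- (\<Sum>i=1..m. b i)))
      \<partial>simplex_measure m)"
      by (rule nn_integral_cmult[symmetric], rule measurable_simplexI) measurable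
    also have "\<dots> = (\<integral>\<^sup>+w. ?K u w
      \<partial>simplex_measure m)"
      by (intro nn_integral_cong) (simp add: ennreal_mult'[symmetric] prod_nonneg sum_distrib_left mult_ac)
    finally show "ennreal (\<Prod>i=1..m. Gamma (b i)) * ennreal (hyp_weight m n a b Z u) = ennreal (Gamma (\<Sum>i=1..m. b i)) * (\<integral>\<^sup>+w. ?K u w
      \<partial>simplex_measure m)" .
  qed
  also have "\<dots> = ennreal (Gamma (\<Sum>i=1..m. b i)) * (\<integral>\<^sup>+u. \<integral>\<^sup>+w. ?K u w
      \<partial>simplex_measure m \<partial>simplex_measure n)"
  proof (rule nn_integral_cmult, rule borel_measurable_nn_integral)
    show "(\<lambda>(u, w). ?K u w)
      \<in> borel_measurable (simplex_measure n \<Otimes>\<^sub>M simplex_measure m)"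
      using measurable_compose[OF measurable_pair_swap' double_kernel_measurable[where n = n and a = a and m = m and b = b and Z = Z and S = "- (\<Sum>i=1..m. b i)"]]
      by (simp add: case_prod_unfold)
  qed
  finally show ?thesis .
qed

text \<open>When the two families of exponents have the same sum, the double integral is symmetric under exchanging
\<open>(u, a)\<close> and \<open>(w, b)\<close> and transposing \<open>Z\<close>. The reversibility of closed words
rests on this symmetry.\<close>

lemma hyp_mass_duality:
  assumes "m \<ge> 1" "n \<ge> 1" and a: "\<And>j. j \<in> {1..n} \<Longrightarrow> a j > 0" and b: "\<And>i. i \<in> {1..m} \<Longrightarrow> b i > 0"
    and Z: "\<And>i j. i \<in> {1..m} \<Longrightarrow> j \<in> {1..n} \<Longrightarrow> Z i j > 0"
    and bal: "(\<Sum>j=1..n. a j) = (\<Sum>i=1..m. b i)"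
  shows "ennreal (\<Prod>i=1..m. Gamma (b i)) * hyp_mass m n a b Z =
    ennreal (\<Prod>j=1..n. Gamma (a j)) * hyp_mass n m b a (\<lambda>j i. Z i j)"
proof -
  interpret M: finite_measure "simplex_measure m" by (rule finite_simplex_measure[OF assms(1)])
  interpret N: finite_measure "simplex_measure n" by (rule finite_simplex_measure[OF assms(2)])
  interpret pair_sigma_finite "simplex_measure m" "simplex_measure n" ..
  show ?thesis
    apply (subst hyp_mass_eq_double_integral[OF assms(1,2) b Z], assumption+)
    apply (subst hyp_mass_eq_double_integral[OF assms(2,1) a Z], assumption+)
    unfolding bal
    apply (subst Fubini'[OF double_kernel_measurable])
    apply (intro arg_cong2[where f = "(*)"] refl nn_integral_cong)
    apply (subst sum.swap)
    apply (simp add: mult_ac)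
    done
qed

section \<open>Hypergeometric laws on the simplex\<close>

lemma dirichlet_mass:
  assumes "n \<ge> 1" and a: "\<forall>j\<in>{1..n}. a j > 0"
  shows "(\<integral>\<^sup>+u. ennreal (\<Prod>j=1..n. u j powr (a j - 1)) \<partial>simplex_measure n) < \<infinity>" (is "?I < _")
    and "(\<integral>\<^sup>+u. ennreal (\<Prod>j=1..n. u j powr (a j - 1)) \<partial>simplex_measure n) > 0"
proof -
  have S: "(\<Sum>j=1..n. a j) > 0" using assms(1) a by (intro sum_pos) auto
  have "ennreal (\<Prod>j=1..n. Gamma (a j)) = ennreal (Gamma (\<Sum>j=1..n. a j)) *
     (\<integral>\<^sup>+u. ennreal ((\<Prod>j=1..n. u j powr (a j - 1)) * (\<Sum>j=1..n. 1 * u j) powr (- (\<Sum>j=1..n. a j))) \<partial>simplex_measure n)"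
    using feynman_parametrization[of n a "\<lambda>_. 1"] assms by simp
  also have "(\<integral>\<^sup>+u. ennreal ((\<Prod>j=1..n. u j powr (a j - 1)) * (\<Sum>j=1..n. 1 * u j) powr (- (\<Sum>j=1..n. a j))) \<partial>simplex_measure n) = ?I"
    by (intro nn_integral_cong) (auto simp: open_simplexD)
  finally have eq: "ennreal (\<Prod>j=1..n. Gamma (a j)) = ennreal (Gamma (\<Sum>j=1..n. a j)) * ?I" .
  have g: "Gamma (\<Sum>j=1..n. a j) > 0" using S by (rule Gamma_real_pos)
  have p: "(\<Prod>j=1..n. Gamma (a j)) > 0" using a by (intro prod_pos) (auto intro: Gamma_real_pos)
  show "?I < \<infinity>"
  proof (rule ccontr)
    assume "\<not> ?I < \<infinity>"
    then have "?I = top" by (auto simp: less_top[symmetric])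
    then show False using eq g by (simp add: ennreal_mult_top)
  qed
  show "?I > 0"
  proof (rule ccontr)
    assume "\<not> ?I > 0"
    then have "ennreal (\<Prod>j=1..n. Gamma (a j)) = 0" using eq by simp
    then show False using p by (metis ennreal_eq_0_iff not_less)
  qed
qed

abbreviation positive_matrix :: "nat \<Rightarrow> nat \<Rightarrow> (nat \<Rightarrow> nat \<Rightarrow> real) \<Rightarrow> bool" where
  "positive_matrix m n Z \<equiv> \<forall>i\<in>{1..m}. \<forall>j\<in>{1..n}. Z i j > 0"

text \<open>On the simplex a linear form with positive coefficients is a weighted mean of its coefficients. Hence the
linear forms only change \<open>\<phi>\<close> by bounded factors, and integrability is decided by the Dirichlet factor.\<close>

lemma linear_form_log_bound:
  fixes Z :: "nat \<Rightarrow> nat \<Rightarrow> real"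
  assumes Z: "positive_matrix m n Z"
  shows "\<exists>K\<ge>0. \<forall>u\<in>open_simplex n. \<forall>i\<in>{1..m}.
    (\<Sum>l=1..n. Z i l * u l) > 0 \<and> \<bar>ln (\<Sum>l=1..n. Z i l * u l)\<bar> \<le> K"
proof -
  define K where "K = (\<Sum>i=1..m. \<Sum>l=1..n. \<bar>ln (Z i l)\<bar>)"
  have K0: "K \<ge> 0" by (auto simp: K_def intro!: sum_nonneg)
  have Kb: "\<bar>ln (Z i l)\<bar> \<le> K" if "i \<in> {1..m}" "l \<in> {1..n}" for i l
  proof -
    have "\<bar>ln (Z i l)\<bar> \<le> (\<Sum>l=1..n. \<bar>ln (Z i l)\<bar>)"
      using that by (intro member_le_sum) auto
    also have "\<dots> \<le> K" unfolding K_def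
      using that by (intro member_le_sum[where f = "\<lambda>i. \<Sum>l=1..n. \<bar>ln (Z i l)\<bar>"]) (auto intro!: sum_nonneg)
    finally show ?thesis .
  qed
  have "(\<Sum>l=1..n. Z i l * u l) > 0 \<and> \<bar>ln (\<Sum>l=1..n. Z i l * u l)\<bar> \<le> K"
    if u: "u \<in> open_simplex n" and i: "i \<in> {1..m}" for u i
  proof -
    have Zb: "exp (- K) \<le> Z i l \<and> Z i l \<le> exp K" if "l \<in> {1..n}" for l
    proof -
      have "Z i l = exp (ln (Z i l))" using bspec[OF bspec[OF Z i] that] by simp
      moreover have "- K \<le> ln (Z i l)" "ln (Z i l) \<le> K" using Kb[OF i that] by (auto simp: abs_le_iff)
      ultimately show ?thesis by (metis exp_le_cancel_iff)
    qed
    have lo: "exp (- K) \<le> (\<Sum>l=1..n. Z i l * u l)"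
    proof -
      have "exp (- K) = (\<Sum>l=1..n. exp (- K) * u l)"
        by (simp add: sum_distrib_left[symmetric] open_simplexD(3)[OF u])
      also have "\<dots> \<le> (\<Sum>l=1..n. Z i l * u l)"
        using Zb open_simplexD(1)[OF u] by (intro sum_mono mult_right_mono) (auto intro: less_imp_le)
      finally show ?thesis .
    qed
    have hi: "(\<Sum>l=1..n. Z i l * u l) \<le> exp K"
    proof -
      have "(\<Sum>l=1..n. Z i l * u l) \<le> (\<Sum>l=1..n. exp K * u l)"
        using Zb open_simplexD(1)[OF u] by (intro sum_mono mult_right_mono) (auto intro: less_imp_le)
      also have "\<dots> = exp K"
        by (simp add: sum_distrib_left[symmetric] open_simplexD(3)[OF u])
      finally show ?thesis .
    qed
    have pos: "(\<Sum>l=1..n. Z i l * u l) > 0" using lo by (rule less_le_trans[OF exp_gt_zero])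
    have "- K \<le> ln (\<Sum>l=1..n. Z i l * u l)" using lo pos by (simp add: ln_ge_iff)
    moreover have "ln (\<Sum>l=1..n. Z i l * u l) \<le> K" using hi pos by (metis exp_ln ln_exp ln_le_cancel_iff exp_gt_zero)
    ultimately show ?thesis using pos by (simp add: abs_le_iff)
  qed
  then show ?thesis using K0 by blast
qed

lemma powr_prod_log_bound:
  fixes f b :: "nat \<Rightarrow> real"
  assumes "\<And>i. i \<in> I \<Longrightarrow> f i > 0 \<and> \<bar>ln (f i)\<bar> \<le> K"
  shows "(\<Prod>i\<in>I. f i powr b i) \<le> exp (K * (\<Sum>i\<in>I. \<bar>b i\<bar>))"
    and "exp (- (K * (\<Sum>i\<in>I. \<bar>b i\<bar>))) \<le> (\<Prod>i\<in>I. f i powr b i)"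
proof -
  have eq: "f i powr b i = exp (b i * ln (f i))" if "i \<in> I" for i
    using assms[OF that] by (simp add: powr_def)
  have b: "\<bar>b i * ln (f i)\<bar> \<le> K * \<bar>b i\<bar>" if "i \<in> I" for i
    using mult_right_mono[of "\<bar>ln (f i)\<bar>" K "\<bar>b i\<bar>"] assms[OF that] by (simp add: abs_mult mult.commute)
  have "(\<Prod>i\<in>I. f i powr b i) \<le> (\<Prod>i\<in>I. exp (K * \<bar>b i\<bar>))"
    using b eq by (intro prod_mono) (auto simp: abs_le_iff)
  then show "(\<Prod>i\<in>I. f i powr b i) \<le> exp (K * (\<Sum>i\<in>I. \<bar>b i\<bar>))"
    by (cases "finite I") (simp_all add: exp_sum sum_distrib_left)
  have "(\<Prod>i\<in>I. exp (- (K * \<bar>b i\<bar>))) \<le> (\<Prod>i\<in>I. f i powr b i)"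
  proof (intro prod_mono conjI)
    fix i assume "i \<in> I"
    with b[OF this] eq[OF this] show "exp (- (K * \<bar>b i\<bar>)) \<le> f i powr b i"
      by (simp add: abs_le_iff)
  qed simp
  then show "exp (- (K * (\<Sum>i\<in>I. \<bar>b i\<bar>))) \<le> (\<Prod>i\<in>I. f i powr b i)"
    by (cases "finite I") (simp_all add: exp_sum sum_distrib_left sum_negf[symmetric])
qed

lemma hyp_weight_comparison:
  assumes Z: "positive_matrix m n Z"
  shows "\<exists>c>0. \<forall>u\<in>open_simplex n. hyp_weight m n a b Z u \<le> c * (\<Prod>j=1..n. u j powr (a j - 1))"
    and "\<exists>c>0. \<forall>u\<in>open_simplex n. c * (\<Prod>j=1..n. u j powr (a j - 1)) \<le> hyp_weight m n a b Z u"
proof -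
  from linear_form_log_bound[OF Z] obtain K where
    K: "\<And>u i. u \<in> open_simplex n \<Longrightarrow> i \<in> {1..m} \<Longrightarrow> (\<Sum>l=1..n. Z i l * u l) > 0 \<and> \<bar>ln (\<Sum>l=1..n. Z i l * u l)\<bar> \<le> K"
    by blast
  define c where "c = K * (\<Sum>i=1..m. \<bar>- b i\<bar>)"
  have "hyp_weight m n a b Z u \<le> exp c * (\<Prod>j=1..n. u j powr (a j - 1))" if "u \<in> open_simplex n" for u
    unfolding hyp_weight_def c_def mult.commute[of "exp _"]
    by (intro mult_left_mono powr_prod_log_bound(1) K that prod_nonneg) auto
  then show "\<exists>c>0. \<forall>u\<in>open_simplex n. hyp_weight m n a b Z u \<le> c * (\<Prod>j=1..n. u j powr (a j - 1))"
    by (intro exI[of _ "exp c"]) auto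
  have "exp (- c) * (\<Prod>j=1..n. u j powr (a j - 1)) \<le> hyp_weight m n a b Z u" if "u \<in> open_simplex n" for u
    unfolding hyp_weight_def c_def mult.commute[of "exp _"]
    by (intro mult_left_mono powr_prod_log_bound(2) K that prod_nonneg) auto
  then show "\<exists>c>0. \<forall>u\<in>open_simplex n. c * (\<Prod>j=1..n. u j powr (a j - 1)) \<le> hyp_weight m n a b Z u"
    by (intro exI[of _ "exp (- c)"]) auto
qed

lemma simplex_monomial_measurable [measurable]:
  "(\<lambda>u. \<Prod>j=1..n. u j powr c j) \<in> borel_measurable (simplex_measure n)"
  by (rule measurable_simplexI) measurable

lemma hyp_mass_finite_pos:
  assumes "n \<ge> 1" and a: "\<forall>j\<in>{1..n}. a j > 0"
    and Z: "positive_matrix m n Z"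
  shows "hyp_mass m n a b Z < \<infinity>" "hyp_mass m n a b Z > 0"
proof -
  let ?I = "\<integral>\<^sup>+u. ennreal (\<Prod>j=1..n. u j powr (a j - 1)) \<partial>simplex_measure n"
  from hyp_weight_comparison(1)[OF Z, where a = a and b = b] obtain c where c: "c > 0"
     "\<And>u. u \<in> open_simplex n \<Longrightarrow> hyp_weight m n a b Z u \<le> c * (\<Prod>j=1..n. u j powr (a j - 1))" by blast
  from hyp_weight_comparison(2)[OF Z, where a = a and b = b] obtain d where d: "d > 0"
     "\<And>u. u \<in> open_simplex n \<Longrightarrow> d * (\<Prod>j=1..n. u j powr (a j - 1)) \<le> hyp_weight m n a b Z u" by blast
  have "hyp_mass m n a b Z \<le> (\<integral>\<^sup>+u. ennreal c * ennreal (\<Prod>j=1..n. u j powr (a j - 1)) \<partial>simplex_measure n)"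
    unfolding hyp_mass_def by (intro nn_integral_mono) (use c in \<open>auto simp: ennreal_mult'[symmetric] intro!: ennreal_leI\<close>)
  also have "\<dots> = ennreal c * ?I" by (rule nn_integral_cmult) measurable
  also have "\<dots> < \<infinity>" using dirichlet_mass(1)[OF assms(1) a] by (simp add: ennreal_mult_less_top)
  finally show "hyp_mass m n a b Z < \<infinity>" .
  have "0 < ennreal d * ?I" using dirichlet_mass(2)[OF assms(1) a] d(1) by (simp add: ennreal_zero_less_mult_iff)
  also have "\<dots> = (\<integral>\<^sup>+u. ennreal d * ennreal (\<Prod>j=1..n. u j powr (a j - 1)) \<partial>simplex_measure n)"
    by (rule nn_integral_cmult[symmetric]) measurable
  also have "\<dots> \<le> hyp_mass m n a b Z"
    unfolding hyp_mass_def by (intro nn_integral_mono) (use d in \<open>auto simp: ennreal_mult'[symmetric] intro!: ennreal_leI\<close>)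
  finally show "hyp_mass m n a b Z > 0" .
qed

lemma ennreal_hyp_mass:
  assumes "n \<ge> 1" and a: "\<forall>j\<in>{1..n}. a j > 0"
    and Z: "positive_matrix m n Z"
  shows "ennreal (enn2real (hyp_mass m n a b Z)) = hyp_mass m n a b Z"
    and "enn2real (hyp_mass m n a b Z) > 0"
  using hyp_mass_finite_pos[OF assms] by (auto simp: enn2real_positive_iff)

lemma space_hyp_law [simp]: "space (hyp_law m n a b Z) = open_simplex n"
  and sets_hyp_law [measurable_cong]: "sets (hyp_law m n a b Z) = sets (simplex_measure n)"
  by (simp_all add: hyp_law_def)

lemma nn_integral_hyp_law:
  assumes "f \<in> borel_measurable (simplex_measure n)"
  shows "(\<integral>\<^sup>+u. f u \<partial>hyp_law m n a b Z) = (\<integral>\<^sup>+u. ennreal (hyp_weight m n a b Z u) * f u \<partial>simplex_measure n) / hyp_mass m n a b Z"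
proof -
  note assms[measurable]
  have "(\<integral>\<^sup>+u. f u \<partial>hyp_law m n a b Z) = (\<integral>\<^sup>+u. (ennreal (hyp_weight m n a b Z u) * f u) / hyp_mass m n a b Z \<partial>simplex_measure n)"
    unfolding hyp_law_def
    by (subst nn_integral_density) (measurable, auto intro!: nn_integral_cong simp: divide_ennreal_def mult_ac)
  also have "\<dots> = (\<integral>\<^sup>+u. ennreal (hyp_weight m n a b Z u) * f u \<partial>simplex_measure n) / hyp_mass m n a b Z"
    by (rule nn_integral_divide) measurable
  finally show ?thesis .
qed

lemma prob_space_hyp_law:
  assumes "n \<ge> 1" and a: "\<forall>j\<in>{1..n}. a j > 0"
    and Z: "positive_matrix m n Z"
  shows "prob_space (hyp_law m n a b Z)"
proof
  have "emeasure (hyp_law m n a b Z) (space (hyp_law m n a b Z)) = (\<integral>\<^sup>+u. 1 \<partial>hyp_law m n a b Z)" by simp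
  also have "\<dots> = hyp_mass m n a b Z / hyp_mass m n a b Z"
    by (subst nn_integral_hyp_law) (auto simp: hyp_mass_def)
  also have "\<dots> = 1"
    using hyp_mass_finite_pos[OF assms, where b = b] by (auto intro!: ennreal_divide_self)
  finally show "emeasure (hyp_law m n a b Z) (space (hyp_law m n a b Z)) = 1" .
qed

text \<open>Multiplying by \<open>\<Prod>j. u j powr (- \<beta> j)\<close> shifts the exponents to \<open>a - \<beta>\<close>, which still gives a finite mass.\<close>

lemma hyp_law_moment_finite:
  assumes "n \<ge> 1"
    and Z: "positive_matrix m n Z"
    and ab: "\<forall>j\<in>{1..n}. 0 < a j - \<beta> j"
    and a: "\<forall>j\<in>{1..n}. a j > 0"
    and f: "f \<in> borel_measurable (simplex_measure n)"
    and bound: "c \<ge> 0" "\<And>u. u \<in> open_simplex n \<Longrightarrow> f u \<le> c * (\<Prod>j=1..n. u j powr (- \<beta> j))"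
  shows "(\<integral>\<^sup>+u. ennreal (f u) \<partial>hyp_law m n a b Z) < \<infinity>"
proof -
  note f[measurable]
  have "(\<integral>\<^sup>+u. ennreal (hyp_weight m n a b Z u) * ennreal (f u) \<partial>simplex_measure n)
     \<le> (\<integral>\<^sup>+u. ennreal c * ennreal (hyp_weight m n (\<lambda>j. a j - \<beta> j) b Z u) \<partial>simplex_measure n)"
  proof (rule nn_integral_mono)
    fix u assume "u \<in> space (simplex_measure n)"
    then have u: "u \<in> open_simplex n" by simp
    have "(\<Prod>j=1..n. u j powr (a j - 1)) * (\<Prod>j=1..n. u j powr (- \<beta> j)) = (\<Prod>j=1..n. u j powr (a j - \<beta> j - 1))"
      unfolding prod.distrib[symmetric] by (intro prod.cong refl) (simp add: powr_add[symmetric] algebra_simps)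
    then have "hyp_weight m n a b Z u * (\<Prod>j=1..n. u j powr (- \<beta> j)) = hyp_weight m n (\<lambda>j. a j - \<beta> j) b Z u"
      unfolding hyp_weight_def by (simp add: mult_ac)
    moreover have "hyp_weight m n a b Z u * f u \<le> hyp_weight m n a b Z u * (c * (\<Prod>j=1..n. u j powr (- \<beta> j)))"
      by (intro mult_left_mono bound u) simp
    ultimately have "hyp_weight m n a b Z u * f u \<le> c * hyp_weight m n (\<lambda>j. a j - \<beta> j) b Z u"
      by (simp add: mult_ac)
    then show "ennreal (hyp_weight m n a b Z u) * ennreal (f u) \<le> ennreal c * ennreal (hyp_weight m n (\<lambda>j. a j - \<beta> j) b Z u)"
      using bound(1) by (simp add: ennreal_mult'[symmetric] ennreal_leI)
  qed
  also have "\<dots> = ennreal c * hyp_mass m n (\<lambda>j. a j - \<beta> j) b Z"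
    unfolding hyp_mass_def by (rule nn_integral_cmult) measurable
  also have "\<dots> < \<infinity>"
    using hyp_mass_finite_pos(1)[OF assms(1) ab Z, where b = b] by (simp add: ennreal_mult_less_top)
  finally show ?thesis
    unfolding nn_integral_hyp_law[OF measurable_compose[OF f measurable_ennreal]]
    using hyp_mass_finite_pos(2)[OF assms(1) a Z, where b = b]
    by (auto simp: ennreal_divide_eq_top_iff less_top[symmetric])
qed

section \<open>Moments of the one-site transition probabilities\<close>

definition site_prob :: "nat \<Rightarrow> (nat \<Rightarrow> nat \<Rightarrow> real) \<Rightarrow> (nat \<Rightarrow> real) \<Rightarrow> nat \<Rightarrow> nat \<Rightarrow> real" where
  "site_prob n Z u i j = Z i j * u j / (\<Sum>l=1..n. Z i l * u l)"

lemma site_prob_measurable [measurable]: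
  "j \<in> {1..n} \<Longrightarrow> (\<lambda>u. site_prob n Z u i j) \<in> borel_measurable (simplex_measure n)"
  unfolding site_prob_def by (rule measurable_simplexI) measurable

lemma linear_form_pos:
  assumes "n \<ge> 1" "\<forall>j\<in>{1..n}. Z i j > (0::real)" "u \<in> open_simplex n"
  shows "(\<Sum>l=1..n. Z i l * u l) > 0"
  using assms(1,2) open_simplexD(1)[OF assms(3)] by (intro sum_pos) auto

lemma site_prob_pos:
  assumes "n \<ge> 1" "\<forall>j\<in>{1..n}. Z i j > 0" "u \<in> open_simplex n" "j \<in> {1..n}"
  shows "site_prob n Z u i j > 0"
  using linear_form_pos[where Z = Z and i = i, OF assms(1-3)] assms(2,4) open_simplexD(1)[OF assms(3,4)]
  by (auto simp: site_prob_def)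

lemma site_prob_sum:
  assumes "n \<ge> 1" "\<forall>j\<in>{1..n}. Z i j > 0" "u \<in> open_simplex n"
  shows "(\<Sum>j=1..n. site_prob n Z u i j) = 1"
  using linear_form_pos[where Z = Z and i = i, OF assms] by (simp add: site_prob_def sum_divide_distrib[symmetric])

text \<open>A monomial in the transition probabilities shifts the exponents of \<open>\<phi>\<close> by the row and column sums of \<open>N\<close>.\<close>

lemma hyp_moment:
  fixes N :: "nat \<Rightarrow> nat \<Rightarrow> nat"
  assumes "n \<ge> 1" and a: "\<forall>j\<in>{1..n}. a j > 0"
    and Z: "positive_matrix m n Z"
  shows "(\<integral>\<^sup>+u. ennreal (\<Prod>i=1..m. \<Prod>j=1..n. site_prob n Z u i j ^ N i j) \<partial>hyp_law m n a b Z) =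
    ennreal ((\<Prod>i=1..m. \<Prod>j=1..n. Z i j ^ N i j) *
      enn2real (hyp_mass m n (\<lambda>j. a j + real (\<Sum>i=1..m. N i j)) (\<lambda>i. b i + real (\<Sum>j=1..n. N i j)) Z) / enn2real (hyp_mass m n a b Z))"
    (is "?L = ennreal (?z * ?p / ?q)")
proof -
  let ?S = "\<lambda>u. \<Prod>i=1..m. \<Prod>j=1..n. site_prob n Z u i j ^ N i j"
  let ?a = "\<lambda>j. a j + real (\<Sum>i=1..m. N i j)" and ?b = "\<lambda>i. b i + real (\<Sum>j=1..n. N i j)"
  have z: "?z \<ge> 0" using Z by (intro prod_nonneg ballI zero_le_power) (auto intro: less_imp_le)
  have a': "\<forall>j\<in>{1..n}. ?a j > 0" using a by (auto intro!: add_pos_nonneg sum_nonneg)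
  have "?L = (\<integral>\<^sup>+u. ennreal (hyp_weight m n a b Z u) * ennreal (?S u) \<partial>simplex_measure n) / hyp_mass m n a b Z"
    by (rule nn_integral_hyp_law) measurable
  also have "(\<integral>\<^sup>+u. ennreal (hyp_weight m n a b Z u) * ennreal (?S u) \<partial>simplex_measure n)
     = (\<integral>\<^sup>+u. ennreal ?z * ennreal (hyp_weight m n ?a ?b Z u) \<partial>simplex_measure n)"
  proof (rule nn_integral_cong)
    fix u assume "u \<in> space (simplex_measure n)"
    then have u: "u \<in> open_simplex n" by simp
    define L where "L i = (\<Sum>l=1..n. Z i l * u l)" for i
    have L: "L i > 0" if "i \<in> {1..m}" for i
      unfolding L_def using that Z by (intro linear_form_pos[OF assms(1) _ u]) auto
    note up = open_simplexD(1)[OF u]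
    have nz: "\<And>j. j \<in> {1..n} \<Longrightarrow> u j \<noteq> 0" "\<And>i. i \<in> {1..m} \<Longrightarrow> L i \<noteq> 0"
      using up L by force+
    have sp: "site_prob n Z u i j = Z i j * u j / L i" for i j by (simp add: site_prob_def L_def)
    have "?S u =
       (\<Prod>i=1..m. \<Prod>j=1..n. Z i j ^ N i j * (u j powr N i j) * (L i powr (- real (N i j))))"
      by (intro prod.cong refl) (use up L in \<open>simp add: sp powr_realpow powr_minus power_divide power_mult_distrib field_simps\<close>)
    also have "\<dots> = ?z * (\<Prod>i=1..m. \<Prod>j=1..n. u j powr N i j) * (\<Prod>i=1..m. \<Prod>j=1..n. L i powr (- real (N i j)))"
      by (simp add: prod.distrib)
    also have "(\<Prod>i=1..m. \<Prod>j=1..n. u j powr N i j) = (\<Prod>j=1..n. u j powr (\<Sum>i=1..m. real (N i j)))"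
      by (subst prod.swap, intro prod.cong refl) (simp add: powr_sum nz)
    also have "(\<Prod>i=1..m. \<Prod>j=1..n. L i powr (- real (N i j))) = (\<Prod>i=1..m. L i powr (- (\<Sum>j=1..n. real (N i j))))"
      by (intro prod.cong refl) (simp add: powr_sum nz sum_negf[symmetric])
    finally have "hyp_weight m n a b Z u * ?S u =
      ?z * ((\<Prod>j=1..n. u j powr (a j - 1)) * (\<Prod>j=1..n. u j powr (\<Sum>i=1..m. real (N i j)))) *
        ((\<Prod>i=1..m. L i powr (- b i)) * (\<Prod>i=1..m. L i powr (- (\<Sum>j=1..n. real (N i j)))))"
      by (simp add: hyp_weight_def L_def)
    also have "(\<Prod>j=1..n. u j powr (a j - 1)) * (\<Prod>j=1..n. u j powr (\<Sum>i=1..m. real (N i j))) = (\<Prod>j=1..n. u j powr (?a j - 1))"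
      unfolding prod.distrib[symmetric] by (intro prod.cong refl) (simp add: powr_add[symmetric] algebra_simps)
    also have "(\<Prod>i=1..m. L i powr (- b i)) * (\<Prod>i=1..m. L i powr (- (\<Sum>j=1..n. real (N i j)))) = (\<Prod>i=1..m. L i powr (- ?b i))"
      unfolding prod.distrib[symmetric] by (intro prod.cong refl) (simp add: powr_add[symmetric] algebra_simps)
    finally have "hyp_weight m n a b Z u * ?S u =
        ?z * hyp_weight m n ?a ?b Z u"
      by (simp only: hyp_weight_def L_def mult.assoc)
    then show "ennreal (hyp_weight m n a b Z u) * ennreal (?S u) =
       ennreal ?z * ennreal (hyp_weight m n ?a ?b Z u)"
      using z by (simp only: ennreal_mult'[symmetric] hyp_weight_nonneg)
  qed
  also have "\<dots> = ennreal ?z * hyp_mass m n ?a ?b Z"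
    unfolding hyp_mass_def by (rule nn_integral_cmult) measurable
  also have "\<dots> / hyp_mass m n a b Z = ennreal ?z * ennreal (enn2real (hyp_mass m n ?a ?b Z)) / ennreal (enn2real (hyp_mass m n a b Z))"
    by (simp only: ennreal_hyp_mass(1)[OF assms] ennreal_hyp_mass(1)[OF assms(1) a' Z])
  also have "\<dots> = ennreal (?z * ?p / ?q)"
    using z ennreal_hyp_mass(2)[OF assms, of b] by (simp add: ennreal_mult'[symmetric] divide_ennreal)
  finally show ?thesis .
qed

lemma real_hyp_mass_duality:
  assumes "m \<ge> 1" "n \<ge> 1" and a: "\<forall>j\<in>{1..n}. a j > 0" and b: "\<forall>i\<in>{1..m}. b i > 0"
    and Z: "positive_matrix m n Z"
    and bal: "(\<Sum>j=1..n. a j) = (\<Sum>i=1..m. b i)"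
  shows "(\<Prod>i=1..m. Gamma (b i)) * enn2real (hyp_mass m n a b Z) =
    (\<Prod>j=1..n. Gamma (a j)) * enn2real (hyp_mass n m b a (\<lambda>j i. Z i j))"
proof -
  have "(\<Prod>i=1..m. Gamma (b i)) \<ge> 0" "(\<Prod>j=1..n. Gamma (a j)) \<ge> 0"
    using a b by (auto intro!: prod_nonneg Gamma_real_nonneg intro: less_imp_le)
  moreover have "ennreal (\<Prod>i=1..m. Gamma (b i)) * hyp_mass m n a b Z =
    ennreal (\<Prod>j=1..n. Gamma (a j)) * hyp_mass n m b a (\<lambda>j i. Z i j)"
    using assms by (intro hyp_mass_duality) auto
  then have "enn2real (ennreal (\<Prod>i=1..m. Gamma (b i)) * hyp_mass m n a b Z) =
    enn2real (ennreal (\<Prod>j=1..n. Gamma (a j)) * hyp_mass n m b a (\<lambda>j i. Z i j))" by simp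
  ultimately show ?thesis by (simp add: enn2real_mult)
qed

text \<open>The forward probability of going from slot \<open>i\<close> to slot \<open>j\<close> is replaced by the backward probability of
going from \<open>j\<close> to \<open>i\<close>. By duality the two moments differ by a product of Gamma quotients, in which slot
\<open>j\<close> enters through \<open>\<Sum>i. N i j\<close> and slot \<open>i\<close> through \<open>\<Sum>j. N i j\<close>.\<close>

lemma hyp_moment_duality:
  fixes N :: "nat \<Rightarrow> nat \<Rightarrow> nat"
  assumes "m \<ge> 1" "n \<ge> 1" and a: "\<forall>j\<in>{1..n}. a j > 0" and b: "\<forall>i\<in>{1..m}. b i > 0"
    and Z: "positive_matrix m n Z"
    and bal: "(\<Sum>j=1..n. a j) = (\<Sum>i=1..m. b i)"
  shows "(\<integral>\<^sup>+u. ennreal (\<Prod>i=1..m. \<Prod>j=1..n. site_prob n Z u i j ^ N i j) \<partial>hyp_law m n a b Z) =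
    ennreal ((\<Prod>j=1..n. Gamma (a j + real (\<Sum>i=1..m. N i j)) / Gamma (a j)) /
      (\<Prod>i=1..m. Gamma (b i + real (\<Sum>j=1..n. N i j)) / Gamma (b i))) *
    (\<integral>\<^sup>+w. ennreal (\<Prod>i=1..m. \<Prod>j=1..n. site_prob m (\<lambda>j i. Z i j) w j i ^ N i j) \<partial>hyp_law n m b a (\<lambda>j i. Z i j))"
proof -
  let ?a = "\<lambda>j. a j + real (\<Sum>i=1..m. N i j)" and ?b = "\<lambda>i. b i + real (\<Sum>j=1..n. N i j)"
  let ?z = "\<Prod>i=1..m. \<Prod>j=1..n. Z i j ^ N i j"
  have a': "\<forall>j\<in>{1..n}. ?a j > 0" using a by (auto intro!: add_pos_nonneg sum_nonneg)
  have b': "\<forall>j\<in>{1..m}. ?b j > 0" using b by (auto intro!: add_pos_nonneg sum_nonneg)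
  have Z': "\<forall>j\<in>{1..n}. \<forall>i\<in>{1..m}. Z i j > 0" using Z by auto
  have bal': "(\<Sum>j=1..n. ?a j) = (\<Sum>i=1..m. ?b i)"
    using bal by (simp add: sum.distrib) (rule sum.swap)
  have G: "(\<Prod>j=1..n. Gamma (a j)) > 0" "(\<Prod>j=1..n. Gamma (?a j)) > 0"
    "(\<Prod>i=1..m. Gamma (b i)) > 0" "(\<Prod>i=1..m. Gamma (?b i)) > 0"
    using a b a' b' by (auto intro!: prod_pos Gamma_real_pos)
  have dual: "(\<integral>\<^sup>+w. ennreal (\<Prod>i=1..m. \<Prod>j=1..n. site_prob m (\<lambda>j i. Z i j) w j i ^ N i j) \<partial>hyp_law n m b a (\<lambda>j i. Z i j))
    = ennreal (?z * enn2real (hyp_mass n m ?b ?a (\<lambda>j i. Z i j)) / enn2real (hyp_mass n m b a (\<lambda>j i. Z i j)))"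
    using hyp_moment[OF assms(1) b Z', where N = "\<lambda>j i. N i j" and b = a]
    by (subst (1 2) prod.swap) simp
  define A A' B B' where defs: "A = (\<Prod>j=1..n. Gamma (a j))" "A' = (\<Prod>j=1..n. Gamma (?a j))"
    "B = (\<Prod>i=1..m. Gamma (b i))" "B' = (\<Prod>i=1..m. Gamma (?b i))"
  define p p' q q' where pq: "p = enn2real (hyp_mass m n a b Z)" "p' = enn2real (hyp_mass m n ?a ?b Z)"
    "q = enn2real (hyp_mass n m b a (\<lambda>j i. Z i j))" "q' = enn2real (hyp_mass n m ?b ?a (\<lambda>j i. Z i j))"
  have pos: "A > 0" "B > 0" "A' > 0" "B' > 0" "p > 0" "q > 0"
    using G ennreal_hyp_mass(2)[OF assms(2) a Z] ennreal_hyp_mass(2)[OF assms(1) b Z'] by (auto simp: defs pq)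
  have d1: "B * p = A * q" unfolding defs pq using assms by (intro real_hyp_mass_duality) auto
  have d2: "B' * p' = A' * q'" unfolding defs pq using assms(1,2) a' b' Z bal' by (intro real_hyp_mass_duality) auto
  have p: "p = A * q / B" using d1 pos by (simp add: field_simps)
  have p': "p' = A' * q' / B'" using d2 pos by (simp add: field_simps)
  have "?z * p' / p = ((A' / A) / (B' / B)) * (?z * q' / q)"
    unfolding p p' using pos by (simp add: field_simps)
  moreover have "(\<Prod>j=1..n. Gamma (?a j) / Gamma (a j)) = A' / A"
    "(\<Prod>i=1..m. Gamma (?b i) / Gamma (b i)) = B' / B"
    by (simp_all only: defs prod_dividef)
  moreover have "(A' / A) / (B' / B) \<ge> 0" using pos by simp
  ultimately show ?thesis
    unfolding hyp_moment[OF assms(2) a Z] dual pq[symmetric]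
    by (simp only: ennreal_mult'[symmetric])
qed

section \<open>Tilting the law of one site\<close>

text \<open>A second-order bound whose remainder involves \<open>exp y\<close> itself and not \<open>exp \<bar>y\<bar>\<close>: below, the positive part of
\<open>y\<close> is under control while the negative part is not.\<close>

lemma exp_le_quadratic:
  fixes y :: real
  shows "exp y \<le> 1 + y + y\<^sup>2 * max 1 (exp y)"
proof (cases "y \<le> 0")
  case True
  have "(1 - y) * exp y \<le> 1"
    using exp_ge_add_one_self[of "- y"] by (simp add: exp_minus field_simps)
  moreover have "(1 - y) * (1 + y + y\<^sup>2) \<ge> 1"
    using True by (simp add: algebra_simps power2_eq_square zero_le_mult_iff mult_nonneg_nonpos2)
  ultimately have "(1 - y) * exp y \<le> (1 - y) * (1 + y + y\<^sup>2)" by linarith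
  then have "exp y \<le> 1 + y + y\<^sup>2" using True by (simp add: mult_le_cancel_left)
  also have "\<dots> \<le> 1 + y + y\<^sup>2 * max 1 (exp y)"
    by (intro add_left_mono) (simp add: mult_le_cancel_left1)
  finally show ?thesis .
next
  case False
  have a: "exp y - 1 \<le> y * exp y"
    using exp_ge_add_one_self[of "- y"] by (simp add: exp_minus field_simps)
  have "exp y - 1 - y \<le> y * (exp y - 1)" using a by (simp add: algebra_simps)
  also have "\<dots> \<le> y * (y * exp y)" using False a by (intro mult_left_mono) auto
  also have "\<dots> = y\<^sup>2 * max 1 (exp y)" using False by (simp add: power2_eq_square max_def)
  finally show ?thesis by simp
qed

lemma square_diff_le:
  fixes x y W :: real
  assumes "x\<^sup>2 \<le> W" "y\<^sup>2 \<le> W"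
  shows "(x - y)\<^sup>2 \<le> 4 * W"
proof -
  have "(x - y)\<^sup>2 \<le> (x - y)\<^sup>2 + (x + y)\<^sup>2" by simp
  also have "\<dots> = 2 * x\<^sup>2 + 2 * y\<^sup>2" by (simp add: power2_eq_square algebra_simps)
  also have "\<dots> \<le> 4 * W" using assms by simp
  finally show ?thesis .
qed

lemma ln_square_le_powr:
  fixes x \<epsilon> :: real
  assumes "0 < x" "x \<le> 1" "\<epsilon> > 0"
  shows "(ln x)\<^sup>2 \<le> (4 / \<epsilon>\<^sup>2) * x powr (- \<epsilon>)"
proof -
  have "ln (1 / x) \<le> (1 / x) powr (\<epsilon> / 2) / (\<epsilon> / 2)"
    using assms by (intro ln_powr_bound) auto
  moreover have "0 \<le> ln (1 / x)" using assms by simp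
  ultimately have "(ln (1 / x))\<^sup>2 \<le> ((1 / x) powr (\<epsilon> / 2) / (\<epsilon> / 2))\<^sup>2"
    by (intro power_mono)
  also have "\<dots> = (4 / \<epsilon>\<^sup>2) * x powr (- \<epsilon>)"
    using assms by (simp add: power_divide power2_eq_square powr_add[symmetric] powr_divide powr_minus field_simps)
  finally show ?thesis using assms by (simp add: ln_div)
qed

text \<open>Changing the exponents by \<open>(s, t)\<close> amounts to the density \<^term>\<open>hyp_weight m n (\<lambda>j. s j + 1) t Z\<close>, up to
normalization. The \<open>+ 1\<close> cancels the \<open>- 1\<close> in the exponents of \<^const>\<open>hyp_weight\<close>.\<close>

lemma hyp_law_tilt:
  assumes "n \<ge> 1" and a: "\<forall>j\<in>{1..n}. a j > 0" and as: "\<forall>j\<in>{1..n}. a j + s j > 0"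
    and Z: "positive_matrix m n Z"
  shows "hyp_law m n (\<lambda>j. a j + s j) (\<lambda>i. b i + t i) Z =
    density (hyp_law m n a b Z) (\<lambda>u. ennreal (hyp_weight m n (\<lambda>j. s j + 1) t Z u *
      (enn2real (hyp_mass m n a b Z) / enn2real (hyp_mass m n (\<lambda>j. a j + s j) (\<lambda>i. b i + t i) Z))))"
proof -
  define p where "p = enn2real (hyp_mass m n a b Z)"
  define q where "q = enn2real (hyp_mass m n (\<lambda>j. a j + s j) (\<lambda>i. b i + t i) Z)"
  have p: "p > 0" "hyp_mass m n a b Z = ennreal p" using ennreal_hyp_mass[OF assms(1) a Z, of b] by (auto simp: p_def)
  have q: "q > 0" "hyp_mass m n (\<lambda>j. a j + s j) (\<lambda>i. b i + t i) Z = ennreal q"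
    using ennreal_hyp_mass[OF assms(1) as Z, of "\<lambda>i. b i + t i"] by (auto simp: q_def)
  have "density (hyp_law m n a b Z) (\<lambda>u. ennreal (hyp_weight m n (\<lambda>j. s j + 1) t Z u * (p / q))) =
     density (simplex_measure n) (\<lambda>u. ennreal (hyp_weight m n a b Z u) / ennreal p * ennreal (hyp_weight m n (\<lambda>j. s j + 1) t Z u * (p / q)))"
    unfolding hyp_law_def p(2) by (rule density_density_eq) measurable
  also have "\<dots> = density (simplex_measure n) (\<lambda>u. ennreal (hyp_weight m n (\<lambda>j. a j + s j) (\<lambda>i. b i + t i) Z u) / ennreal q)"
  proof (rule density_cong)
    show "AE u in simplex_measure n. ennreal (hyp_weight m n a b Z u) / ennreal p * ennreal (hyp_weight m n (\<lambda>j. s j + 1) t Z u * (p / q)) =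
       ennreal (hyp_weight m n (\<lambda>j. a j + s j) (\<lambda>i. b i + t i) Z u) / ennreal q"
    proof (rule AE_I2)
      fix u
      have "hyp_weight m n (\<lambda>j. a j + s j) (\<lambda>i. b i + t i) Z u = hyp_weight m n a b Z u * hyp_weight m n (\<lambda>j. s j + 1) t Z u"
      proof -
        have "(\<Prod>j=1..n. u j powr (a j + s j - 1)) = (\<Prod>j=1..n. u j powr (a j - 1)) * (\<Prod>j=1..n. u j powr (s j + 1 - 1))"
          unfolding prod.distrib[symmetric] by (intro prod.cong refl) (simp add: powr_add[symmetric] algebra_simps)
        moreover have "(\<Prod>i=1..m. (\<Sum>l=1..n. Z i l * u l) powr (- (b i + t i))) =
           (\<Prod>i=1..m. (\<Sum>l=1..n. Z i l * u l) powr (- b i)) * (\<Prod>i=1..m. (\<Sum>l=1..n. Z i l * u l) powr (- t i))"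
          unfolding prod.distrib[symmetric] by (intro prod.cong refl) (simp add: powr_add[symmetric] algebra_simps)
        ultimately show ?thesis unfolding hyp_weight_def by (simp only: mult_ac)
      qed
      then show "ennreal (hyp_weight m n a b Z u) / ennreal p * ennreal (hyp_weight m n (\<lambda>j. s j + 1) t Z u * (p / q)) =
       ennreal (hyp_weight m n (\<lambda>j. a j + s j) (\<lambda>i. b i + t i) Z u) / ennreal q"
        using p(1) q(1) by (simp add: divide_ennreal ennreal_mult'[symmetric] field_simps)
    qed
  qed measurable
  also have "\<dots> = hyp_law m n (\<lambda>j. a j + s j) (\<lambda>i. b i + t i) Z"
    unfolding hyp_law_def q(2) ..
  finally show ?thesis by (simp add: p_def q_def)
qed

text \<open>Let \<open>exp X\<close> be the unnormalized density of the law tilted by \<open>(s, t)\<close>, so that \<open>X\<close> is linear in \<open>(s, t)\<close>.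
The moment of order \<open>- \<tau>\<close> of the normalized density is \<open>E[exp X] powr \<tau> * E[exp (- \<tau> * X)]\<close>.
Up to second order the two factors are \<open>exp (\<tau> * E[X])\<close> and \<open>exp (- \<tau> * E[X])\<close>, which cancel.
What remains is quadratic in \<open>(s, t)\<close>, so that a square-summable field of tilts has a bounded effect. The condition
\<open>\<tau> * \<gamma> < \<alpha> j\<close> makes \<open>exp (- \<tau> * X)\<close> integrable, with room for the logarithms in the remainder.\<close>

lemma tilt_moment_bound:
  fixes \<alpha> \<beta> :: "nat \<Rightarrow> real"
  assumes "n \<ge> 1" and a: "\<forall>j\<in>{1..n}. \<alpha> j > 0"
    and Z: "positive_matrix m n Z"
    and \<tau>: "\<tau> > 0" "\<gamma> \<ge> 0" "\<forall>j\<in>{1..n}. \<tau> * \<gamma> < \<alpha> j"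
  shows "\<exists>C\<ge>0. \<forall>s t. (\<forall>j\<in>{1..n}. 0 \<le> s j \<and> s j \<le> \<gamma>) \<longrightarrow> (\<forall>i\<in>{1..m}. 0 \<le> t i \<and> t i \<le> \<gamma>) \<longrightarrow>
    (\<integral>\<^sup>+u. ennreal ((hyp_weight m n (\<lambda>j. s j + 1) t Z u *
       (enn2real (hyp_mass m n \<alpha> \<beta> Z) / enn2real (hyp_mass m n (\<lambda>j. \<alpha> j + s j) (\<lambda>i. \<beta> i + t i) Z))) powr (- \<tau>))
      \<partial>hyp_law m n \<alpha> \<beta> Z) \<le> ennreal (exp (C * ((\<Sum>j=1..n. (s j)\<^sup>2) + (\<Sum>i=1..m. (t i)\<^sup>2))))"
proof -
  let ?P = "hyp_law m n \<alpha> \<beta> Z"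
  interpret P: prob_space ?P by (rule prob_space_hyp_law[OF assms(1) a Z])
  define L where "L i u = (\<Sum>l=1..n. Z i l * u l)" for i u
  from linear_form_log_bound[OF Z] obtain K where K: "K \<ge> 0"
    "\<And>u i. u \<in> open_simplex n \<Longrightarrow> i \<in> {1..m} \<Longrightarrow> L i u > 0 \<and> \<bar>ln (L i u)\<bar> \<le> K"
    unfolding L_def by blast
  \<comment> \<open>\<open>X\<close> is at most \<open>M\<close>: its logarithms of coordinates are nonpositive, those of linear forms are at most \<open>K\<close> in absolute value.\<close>
  define M where "M = real m * (\<gamma> * K)"
  have M: "M \<ge> 0" using K(1) \<tau> by (simp add: M_def)
  \<comment> \<open>By the Cauchy-Schwarz inequality \<open>X\<^sup>2\<close> is at most \<open>4 * V\<close> times the squared length of \<open>(s, t)\<close>.\<close>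
  define V where "V u = (\<Sum>j=1..n. (ln (u j))\<^sup>2) + real m * K\<^sup>2" for u :: "nat \<Rightarrow> real"
  define G where "G u = (\<Prod>j=1..n. u j powr (- (\<tau> * \<gamma>)))" for u :: "nat \<Rightarrow> real"
  \<comment> \<open>A remainder, uniform over all tilts bounded by \<open>\<gamma>\<close>, for both \<open>exp X\<close> and \<open>exp (- \<tau> * X)\<close>.\<close>
  define H where "H u = V u * (exp (M + \<tau> * M) * G u)" for u
  have u0: "u j \<noteq> 0" if "u \<in> open_simplex n" "j \<in> {1..n}" for u j
    using open_simplexD(1)[OF that] by simp
  have L0: "L i u \<noteq> 0" if "u \<in> open_simplex n" "i \<in> {1..m}" for u i
    using K(2)[OF that] by simp
  have V0: "V u \<ge> 0" for u by (auto simp: V_def intro!: add_nonneg_nonneg sum_nonneg)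
  have G1: "G u \<ge> 1" if u: "u \<in> open_simplex n" for u
    unfolding G_def
  proof (rule prod_ge_1)
    fix j assume j: "j \<in> {1..n}"
    have "1 powr (- (\<tau> * \<gamma>)) \<le> u j powr (- (\<tau> * \<gamma>))"
      using open_simplexD(1,2)[OF u j] \<tau> by (intro powr_mono2') auto
    then show "1 \<le> u j powr (- (\<tau> * \<gamma>))" by simp
  qed
  have H0: "H u \<ge> 0" if "u \<in> open_simplex n" for u
    using V0 G1[OF that] by (auto simp: H_def intro!: mult_nonneg_nonneg)
  have [measurable]: "V \<in> borel_measurable (simplex_measure n)" "G \<in> borel_measurable (simplex_measure n)"
    unfolding V_def[abs_def] G_def[abs_def] by (rule measurable_simplexI, measurable)+
  have [measurable]: "H \<in> borel_measurable (simplex_measure n)"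
    unfolding H_def[abs_def] by measurable
  obtain \<epsilon> where \<epsilon>: "\<epsilon> > 0" "\<forall>j\<in>{1..n}. 0 < \<alpha> j - (\<tau> * \<gamma> + \<epsilon>)"
  proof -
    define \<epsilon> where "\<epsilon> = Min ((\<lambda>j. \<alpha> j - \<tau> * \<gamma>) ` {1..n}) / 2"
    have "Min ((\<lambda>j. \<alpha> j - \<tau> * \<gamma>) ` {1..n}) > 0" using \<tau>(3) assms(1) by (subst Min_gr_iff) auto
    moreover have "Min ((\<lambda>j. \<alpha> j - \<tau> * \<gamma>) ` {1..n}) \<le> \<alpha> j - \<tau> * \<gamma>" if "j \<in> {1..n}" for j
      using that by (intro Min_le) auto
    ultimately have "\<epsilon> > 0" "0 < \<alpha> j - (\<tau> * \<gamma> + \<epsilon>)" if "j \<in> {1..n}" for j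
      unfolding \<epsilon>_def using that by (smt (verit) field_sum_of_halves)+
    then show ?thesis using assms(1) by (intro that[of \<epsilon>]) auto
  qed
  have H_fin: "(\<integral>\<^sup>+u. ennreal (H u) \<partial>?P) < \<infinity>"
  proof (rule hyp_law_moment_finite[OF assms(1) Z \<epsilon>(2) a])
    define c where "c = (real n * (4 / \<epsilon>\<^sup>2) + real m * K\<^sup>2) * exp (M + \<tau> * M)"
    show "c \<ge> 0" by (auto simp: c_def)
    fix u assume u: "u \<in> open_simplex n"
    define E where "E = (\<Prod>j=1..n. u j powr (- \<epsilon>))"
    have ge1: "u j powr (- \<epsilon>) \<ge> 1" if "j \<in> {1..n}" for j
    proof -
      have "1 powr (- \<epsilon>) \<le> u j powr (- \<epsilon>)"
        using open_simplexD(1,2)[OF u that] \<epsilon>(1) by (intro powr_mono2') auto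
      then show ?thesis by simp
    qed
    have E1: "E \<ge> 1" unfolding E_def by (intro prod_ge_1 ge1)
    have lnE: "(ln (u j))\<^sup>2 \<le> (4 / \<epsilon>\<^sup>2) * E" if j: "j \<in> {1..n}" for j
    proof -
      have "(ln (u j))\<^sup>2 \<le> (4 / \<epsilon>\<^sup>2) * u j powr (- \<epsilon>)"
        using open_simplexD(1,2)[OF u j] \<epsilon>(1) by (intro ln_square_le_powr)
      also have "u j powr (- \<epsilon>) \<le> E"
      proof -
        have "1 * u j powr (- \<epsilon>) \<le> (\<Prod>j\<in>{1..n} - {j}. u j powr (- \<epsilon>)) * u j powr (- \<epsilon>)"
          by (intro mult_right_mono prod_ge_1 ge1) auto
        also have "\<dots> = E" unfolding E_def using j by (subst (2) prod.remove[of _ j]) (auto simp: mult_ac)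
        finally show ?thesis by simp
      qed
      finally show ?thesis using \<epsilon>(1) by (simp add: mult_left_mono divide_right_mono)
    qed
    have "V u \<le> (\<Sum>j=1..n. (4 / \<epsilon>\<^sup>2) * E) + real m * K\<^sup>2 * E"
      unfolding V_def using mult_left_mono[OF E1, of "real m * K\<^sup>2"] by (intro add_mono sum_mono lnE) auto
    then have VE: "V u \<le> (real n * (4 / \<epsilon>\<^sup>2) + real m * K\<^sup>2) * E" by (simp add: algebra_simps)
    have "H u \<le> ((real n * (4 / \<epsilon>\<^sup>2) + real m * K\<^sup>2) * E) * (exp (M + \<tau> * M) * G u)"
      unfolding H_def using G1[OF u] by (intro mult_right_mono VE) auto
    also have "\<dots> = c * (E * G u)" by (simp add: c_def mult_ac)
    also have "E * G u = (\<Prod>j=1..n. u j powr (- (\<tau> * \<gamma> + \<epsilon>)))"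
      unfolding E_def G_def prod.distrib[symmetric] by (simp add: powr_add[symmetric] algebra_simps)
    finally show "H u \<le> c * (\<Prod>j=1..n. u j powr (- (\<tau> * \<gamma> + \<epsilon>)))" .
  qed measurable
  have H_int: "integrable ?P H"
    using H_fin H0 by (intro integrableI_nonneg) (auto intro!: AE_I2)
  define C where "C = 4 * P.expectation H * (\<tau> + \<tau>\<^sup>2)"
  have EH: "P.expectation H \<ge> 0" using H0 by (intro integral_nonneg_AE AE_I2) auto
  have C: "C \<ge> 0" using EH \<tau> by (simp add: C_def)
  show ?thesis
  proof (intro exI[of _ C] conjI C allI impI)
    fix s t :: "nat \<Rightarrow> real"
    assume s: "\<forall>j\<in>{1..n}. 0 \<le> s j \<and> s j \<le> \<gamma>" and t: "\<forall>i\<in>{1..m}. 0 \<le> t i \<and> t i \<le> \<gamma>"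
    define Q where "Q = (\<Sum>j=1..n. (s j)\<^sup>2) + (\<Sum>i=1..m. (t i)\<^sup>2)"
    have Q: "Q \<ge> 0" by (auto simp: Q_def intro!: add_nonneg_nonneg sum_nonneg)
    define h where "h u = hyp_weight m n (\<lambda>j. s j + 1) t Z u" for u
    define X where "X u = (\<Sum>j=1..n. s j * ln (u j)) - (\<Sum>i=1..m. t i * ln (L i u))" for u
    have [measurable]: "X \<in> borel_measurable (simplex_measure n)"
      unfolding X_def[abs_def] L_def by (rule measurable_simplexI) measurable
    have hX: "h u = exp (X u)" if u: "u \<in> open_simplex n" for u
    proof -
      have "(\<Prod>j=1..n. u j powr s j) = exp (\<Sum>j=1..n. s j * ln (u j))"
        by (simp add: exp_sum powr_def u0[OF u])
      moreover have "(\<Prod>i=1..m. L i u powr (- t i)) = exp (- (\<Sum>i=1..m. t i * ln (L i u)))"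
        by (simp add: exp_sum powr_def sum_negf[symmetric] L0[OF u])
      ultimately show ?thesis by (simp add: h_def hyp_weight_def L_def[symmetric] X_def exp_diff exp_minus divide_inverse)
    qed
    have X2: "(X u)\<^sup>2 \<le> 4 * Q * V u" if u: "u \<in> open_simplex n" for u
    proof -
      let ?x = "\<Sum>j=1..n. s j * ln (u j)" and ?y = "\<Sum>i=1..m. t i * ln (L i u)"
      have lL: "(\<Sum>i=1..m. (ln (L i u))\<^sup>2) \<le> real m * K\<^sup>2"
        using sum_bounded_above[of "{1..m}" "\<lambda>i. (ln (L i u))\<^sup>2" "K\<^sup>2"] K(2)[OF u] K(1) by (auto simp: abs_le_square_iff[symmetric])
      have "?x\<^sup>2 \<le> (\<Sum>j=1..n. (s j)\<^sup>2) * (\<Sum>j=1..n. (ln (u j))\<^sup>2)" by (rule Cauchy_Schwarz_ineq_sum)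
      also have "\<dots> \<le> Q * V u" unfolding Q_def V_def by (intro mult_mono) (auto intro!: sum_nonneg add_nonneg_nonneg)
      finally have 1: "?x\<^sup>2 \<le> Q * V u" .
      have "?y\<^sup>2 \<le> (\<Sum>i=1..m. (t i)\<^sup>2) * (\<Sum>i=1..m. (ln (L i u))\<^sup>2)" by (rule Cauchy_Schwarz_ineq_sum)
      also have "\<dots> \<le> Q * V u" unfolding Q_def V_def
      proof (intro mult_mono)
        have "(\<Sum>j=1..n. (ln (u j))\<^sup>2) \<ge> 0" by (auto intro!: sum_nonneg)
        with lL show "(\<Sum>i=1..m. (ln (L i u))\<^sup>2) \<le> (\<Sum>j=1..n. (ln (u j))\<^sup>2) + real m * K\<^sup>2" by linarith
      qed (auto intro!: sum_nonneg add_nonneg_nonneg)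
      finally have 2: "?y\<^sup>2 \<le> Q * V u" .
      show ?thesis unfolding X_def using square_diff_le[OF 1 2] by (simp add: mult.assoc)
    qed
    have tl: "\<bar>\<Sum>i=1..m. t i * ln (L i u)\<bar> \<le> M" if u: "u \<in> open_simplex n" for u
    proof -
      have "\<bar>\<Sum>i=1..m. t i * ln (L i u)\<bar> \<le> (\<Sum>i=1..m. \<bar>t i * ln (L i u)\<bar>)" by (rule sum_abs)
      also have "\<dots> \<le> (\<Sum>i=1..m. \<gamma> * K)"
        using t K(2)[OF u] \<tau> by (intro sum_mono) (auto simp: abs_mult intro!: mult_mono)
      finally show ?thesis by (simp add: M_def)
    qed
    have X_up: "X u \<le> M" if u: "u \<in> open_simplex n" for u
    proof -
      have "(\<Sum>j=1..n. s j * ln (u j)) \<le> 0"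
        using s open_simplexD(1,2)[OF u] by (intro sum_nonpos mult_nonneg_nonpos) auto
      then show ?thesis using tl[OF u] by (simp add: X_def abs_le_iff)
    qed
    have X_lo: "exp (- \<tau> * X u) \<le> exp (\<tau> * M) * G u" if u: "u \<in> open_simplex n" for u
    proof -
      have "- \<tau> * X u \<le> \<tau> * M + (\<Sum>j=1..n. - (\<tau> * \<gamma>) * ln (u j))"
      proof -
        have "(\<Sum>j=1..n. \<gamma> * ln (u j)) \<le> (\<Sum>j=1..n. s j * ln (u j))"
          using s open_simplexD(1,2)[OF u] by (intro sum_mono mult_right_mono_neg) auto
        then have "- X u \<le> M - (\<Sum>j=1..n. \<gamma> * ln (u j))"
          using tl[OF u] by (simp add: X_def abs_le_iff)
        then have "\<tau> * (- X u) \<le> \<tau> * (M - (\<Sum>j=1..n. \<gamma> * ln (u j)))"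
          using \<tau> by (intro mult_left_mono) auto
        then show ?thesis by (simp add: algebra_simps sum_negf sum_distrib_left)
      qed
      then have "exp (- \<tau> * X u) \<le> exp (\<tau> * M + (\<Sum>j=1..n. - (\<tau> * \<gamma>) * ln (u j)))" by simp
      also have "\<dots> = exp (\<tau> * M) * G u"
        unfolding G_def exp_add by (simp add: exp_sum powr_def u0[OF u])
      finally show ?thesis .
    qed
    have VH: "V u \<le> H u" "V u * exp M \<le> H u" "V u * (exp (\<tau> * M) * G u) \<le> H u" if u: "u \<in> open_simplex n" for u
    proof -
      have "1 * 1 \<le> exp (M + \<tau> * M) * G u" "exp M * 1 \<le> exp (M + \<tau> * M) * G u"
        using G1[OF u] M \<tau> by (intro mult_mono; simp)+
      moreover have "exp (\<tau> * M) * G u \<le> exp (M + \<tau> * M) * G u"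
        using G1[OF u] M by (intro mult_right_mono) auto
      ultimately show "V u \<le> H u" "V u * exp M \<le> H u" "V u * (exp (\<tau> * M) * G u) \<le> H u"
        unfolding H_def using mult_left_mono[OF _ V0[of u]] by (force)+
    qed
    have e1: "exp (X u) \<le> 1 + X u + 4 * Q * H u" if u: "u \<in> open_simplex n" for u
    proof -
      have "(X u)\<^sup>2 * max 1 (exp (X u)) \<le> (4 * Q * V u) * exp M"
        using X_up[OF u] M X2[OF u] Q V0[of u] by (intro mult_mono) auto
      also have "\<dots> \<le> 4 * Q * H u" using mult_left_mono[OF VH(2)[OF u], of "4 * Q"] Q by (simp add: mult_ac)
      finally show ?thesis using exp_le_quadratic[of "X u"] by linarith
    qed
    have e2: "exp (- \<tau> * X u) \<le> 1 - \<tau> * X u + 4 * \<tau>\<^sup>2 * Q * H u" if u: "u \<in> open_simplex n" for u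
    proof -
      have "1 * 1 \<le> exp (\<tau> * M) * G u" using G1[OF u] M \<tau> by (intro mult_mono) auto
      then have "(- \<tau> * X u)\<^sup>2 * max 1 (exp (- \<tau> * X u)) \<le> (\<tau>\<^sup>2 * (4 * Q * V u)) * (exp (\<tau> * M) * G u)"
        using X_lo[OF u] X2[OF u] Q V0[of u]
        by (intro mult_mono) (auto simp: power_mult_distrib intro: mult_left_mono)
      also have "\<dots> \<le> 4 * \<tau>\<^sup>2 * Q * H u"
        using mult_left_mono[OF VH(3)[OF u], of "4 * \<tau>\<^sup>2 * Q"] Q by (simp add: mult_ac)
      finally show ?thesis using exp_le_quadratic[of "- \<tau> * X u"] by linarith
    qed
    have X_int: "integrable ?P X"
    proof (rule Bochner_Integration.integrable_bound)
      show "integrable ?P (\<lambda>u. 1 + 4 * Q * H u)" using H_int by auto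
      show "AE u in ?P. norm (X u) \<le> norm (1 + 4 * Q * H u)"
      proof (rule AE_I2)
        fix u assume "u \<in> space ?P"
        then have u: "u \<in> open_simplex n" by simp
        have "\<bar>X u\<bar> \<le> 1 + (X u)\<^sup>2"
          using zero_le_power2[of "\<bar>X u\<bar> - 1"] by (simp add: power2_eq_square algebra_simps)
        also have "\<dots> \<le> 1 + 4 * Q * V u" using X2[OF u] by simp
        also have "\<dots> \<le> 1 + 4 * Q * H u" using VH(1)[OF u] Q by (simp add: mult_left_mono)
        finally show "norm (X u) \<le> norm (1 + 4 * Q * H u)" by simp
      qed
    qed measurable
    define \<mu> where "\<mu> = P.expectation X"
    define EH where "EH = P.expectation H"
    have prob1: "P.prob (open_simplex n) = 1" using P.prob_space by simp
    have B1: "(\<integral>\<^sup>+u. ennreal (h u) \<partial>?P) \<le> ennreal (exp (\<mu> + 4 * Q * EH))"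
    proof -
      have "(\<integral>\<^sup>+u. ennreal (h u) \<partial>?P) \<le> (\<integral>\<^sup>+u. ennreal (1 + X u + 4 * Q * H u) \<partial>?P)"
        using e1 by (intro nn_integral_mono ennreal_leI) (auto simp: hX)
      also have "\<dots> = ennreal (P.expectation (\<lambda>u. 1 + X u + 4 * Q * H u))"
        using H_int X_int order_trans[OF exp_ge_zero e1] by (intro nn_integral_eq_integral AE_I2) auto
      also have "P.expectation (\<lambda>u. 1 + X u + 4 * Q * H u) = 1 + (\<mu> + 4 * Q * EH)"
        using H_int X_int by (simp add: \<mu>_def EH_def prob1)
      also have "ennreal \<dots> \<le> ennreal (exp (\<mu> + 4 * Q * EH))"
        by (intro ennreal_leI exp_ge_add_one_self)
      finally show ?thesis .
    qed
    have B2: "(\<integral>\<^sup>+u. ennreal (h u powr (- \<tau>)) \<partial>?P) \<le> ennreal (exp (- \<tau> * \<mu> + 4 * \<tau>\<^sup>2 * Q * EH))"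
    proof -
      have "(\<integral>\<^sup>+u. ennreal (h u powr (- \<tau>)) \<partial>?P) \<le> (\<integral>\<^sup>+u. ennreal (1 - \<tau> * X u + 4 * \<tau>\<^sup>2 * Q * H u) \<partial>?P)"
        using e2 by (intro nn_integral_mono ennreal_leI) (auto simp: hX powr_def mult_ac)
      also have "\<dots> = ennreal (P.expectation (\<lambda>u. 1 - \<tau> * X u + 4 * \<tau>\<^sup>2 * Q * H u))"
        using H_int X_int order_trans[OF exp_ge_zero e2] by (intro nn_integral_eq_integral AE_I2) auto
      also have "P.expectation (\<lambda>u. 1 - \<tau> * X u + 4 * \<tau>\<^sup>2 * Q * H u) = 1 + (- \<tau> * \<mu> + 4 * \<tau>\<^sup>2 * Q * EH)"
        using H_int X_int by (simp add: \<mu>_def EH_def prob1)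
      also have "ennreal \<dots> \<le> ennreal (exp (- \<tau> * \<mu> + 4 * \<tau>\<^sup>2 * Q * EH))"
        by (intro ennreal_leI exp_ge_add_one_self)
      finally show ?thesis .
    qed
    let ?p = "enn2real (hyp_mass m n \<alpha> \<beta> Z)" and ?q = "enn2real (hyp_mass m n (\<lambda>j. \<alpha> j + s j) (\<lambda>i. \<beta> i + t i) Z)"
    have as: "\<forall>j\<in>{1..n}. \<alpha> j + s j > 0" using a s by (auto intro!: add_pos_nonneg)
    have pos: "?p > 0" "?q > 0" using ennreal_hyp_mass(2)[OF assms(1) a Z] ennreal_hyp_mass(2)[OF assms(1) as Z] by auto
    have "(\<integral>\<^sup>+u. 1 \<partial>hyp_law m n (\<lambda>j. \<alpha> j + s j) (\<lambda>i. \<beta> i + t i) Z) = 1"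
      using prob_space.emeasure_space_1[OF prob_space_hyp_law[OF assms(1) as Z]] by simp
    also have "(\<integral>\<^sup>+u. 1 \<partial>hyp_law m n (\<lambda>j. \<alpha> j + s j) (\<lambda>i. \<beta> i + t i) Z) = (\<integral>\<^sup>+u. ennreal (?p / ?q) * ennreal (h u) \<partial>?P)"
      unfolding hyp_law_tilt[OF assms(1) a as Z]
      by (subst nn_integral_density) (measurable, auto simp: h_def ennreal_mult'[symmetric] mult_ac intro!: nn_integral_cong)
    also have "\<dots> = ennreal (?p / ?q) * (\<integral>\<^sup>+u. ennreal (h u) \<partial>?P)"
      unfolding h_def by (rule nn_integral_cmult) measurable
    finally have "1 \<le> ennreal (?p / ?q) * ennreal (exp (\<mu> + 4 * Q * EH))"
      using mult_left_mono[OF B1, of "ennreal (?p / ?q)"] by simp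
    moreover have "0 \<le> ?p / ?q" by simp
    ultimately have "ennreal 1 \<le> ennreal (?p / ?q * exp (\<mu> + 4 * Q * EH))"
      by (simp only: ennreal_mult' ennreal_1)
    then have "1 \<le> ?p / ?q * exp (\<mu> + 4 * Q * EH)"
      by (subst (asm) ennreal_le_iff) auto
    then have qp: "?q / ?p \<le> exp (\<mu> + 4 * Q * EH)" using pos by (simp add: field_simps)
    have "(\<integral>\<^sup>+u. ennreal ((hyp_weight m n (\<lambda>j. s j + 1) t Z u * (?p / ?q)) powr (- \<tau>)) \<partial>?P) =
       (\<integral>\<^sup>+u. ennreal ((?q / ?p) powr \<tau>) * ennreal (h u powr (- \<tau>)) \<partial>?P)"
      unfolding h_def[symmetric] using pos by (intro nn_integral_cong) (simp add: ennreal_mult'[symmetric] powr_mult powr_divide powr_minus field_simps)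
    also have "\<dots> = ennreal ((?q / ?p) powr \<tau>) * (\<integral>\<^sup>+u. ennreal (h u powr (- \<tau>)) \<partial>?P)"
      unfolding h_def by (rule nn_integral_cmult) measurable
    also have "\<dots> \<le> ennreal (exp (\<mu> + 4 * Q * EH) powr \<tau>) * ennreal (exp (- \<tau> * \<mu> + 4 * \<tau>\<^sup>2 * Q * EH))"
      using qp pos \<tau> by (intro mult_mono B2 ennreal_leI powr_mono2) auto
    also have "\<dots> = ennreal (exp (C * Q))"
      by (simp add: ennreal_mult'[symmetric] exp_powr_real exp_add[symmetric] C_def EH_def algebra_simps power2_eq_square)
    finally show "(\<integral>\<^sup>+u. ennreal ((hyp_weight m n (\<lambda>j. s j + 1) t Z u * (?p / ?q)) powr (- \<tau>)) \<partial>?P)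
      \<le> ennreal (exp (C * ((\<Sum>j=1..n. (s j)\<^sup>2) + (\<Sum>i=1..m. (t i)\<^sup>2))))"
      unfolding Q_def .
  qed
qed

section \<open>Excursions of a finite chain\<close>

fun path_weight :: "('s \<Rightarrow> 's \<Rightarrow> real) \<Rightarrow> 's list \<Rightarrow> real" where
  "path_weight K (a # b # l) = K a b * path_weight K (b # l)"
| "path_weight K l = 1"

definition words :: "'s set \<Rightarrow> nat \<Rightarrow> 's list set" where
  "words T n = {xs. set xs \<subseteq> T \<and> length xs = n}"

text \<open>Total weight of the paths from \<open>s\<close> to \<open>s0\<close> inside \<open>S\<close> that visit \<open>n\<close> intermediate states, all different from \<open>s0\<close>.\<close>

definition excursion_weight :: "('s \<Rightarrow> 's \<Rightarrow> real) \<Rightarrow> 's set \<Rightarrow> 's \<Rightarrow> nat \<Rightarrow> 's \<Rightarrow> real" where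
  "excursion_weight K S s0 n s = (\<Sum>xs\<in>words (S - {s0}) n. path_weight K (s # xs @ [s0]))"

fun visit_weight :: "('s \<Rightarrow> 's \<Rightarrow> real) \<Rightarrow> 's set \<Rightarrow> 's \<Rightarrow> nat \<Rightarrow> 's \<Rightarrow> real" where
  "visit_weight K S s0 0 s = of_bool (s = s0)"
| "visit_weight K S s0 (Suc n) s = (\<Sum>s'\<in>S. K s s' * visit_weight K S s0 n s')"

lemma words_0 [simp]: "words T 0 = {[]}"
  by (auto simp: words_def)

lemma finite_words: "finite T \<Longrightarrow> finite (words T n)"
  using finite_lists_length_eq[of T n] by (simp add: words_def)

lemma sum_words_Suc:
  assumes "finite T"
  shows "(\<Sum>xs\<in>words T (Suc n). g xs) = (\<Sum>a\<in>T. \<Sum>xs\<in>words T n. g (a # xs))"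
proof -
  have eq: "words T (Suc n) = (\<lambda>(a, xs). a # xs) ` (T \<times> words T n)"
    by (auto simp: words_def length_Suc_conv image_iff)
  have inj: "inj_on (\<lambda>(a, xs). a # xs) (T \<times> words T n)" by (auto simp: inj_on_def)
  show ?thesis
    unfolding eq by (subst sum.reindex[OF inj]) (simp add: sum.cartesian_product case_prod_unfold)
qed

lemma path_weight_nonneg:
  "(\<And>a b. K a b \<ge> 0) \<Longrightarrow> path_weight K l \<ge> 0"
  by (induction K l rule: path_weight.induct) auto

lemma excursion_weight_0: "excursion_weight K S s0 0 s = K s s0"
  by (simp add: excursion_weight_def)

lemma excursion_weight_Suc:
  assumes "finite S"
  shows "excursion_weight K S s0 (Suc n) s = (\<Sum>s'\<in>S - {s0}. K s s' * excursion_weight K S s0 n s')"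
  using assms by (simp add: excursion_weight_def sum_words_Suc sum_distrib_left)

lemma excursion_weight_nonneg:
  "(\<And>a b. K a b \<ge> 0) \<Longrightarrow> excursion_weight K S s0 n s \<ge> 0"
  unfolding excursion_weight_def by (intro sum_nonneg path_weight_nonneg)

lemma visit_weight_nonneg:
  "(\<And>a b. K a b \<ge> 0) \<Longrightarrow> visit_weight K S s0 n s \<ge> 0"
  by (induction n arbitrary: s) (auto intro!: sum_nonneg)

text \<open>Decomposition at the first visit to \<open>s0\<close> after time \<open>0\<close>.\<close>

lemma renewal_equation:
  assumes "finite S" "s0 \<in> S"
  shows "visit_weight K S s0 (Suc n) s = (\<Sum>k\<le>n. excursion_weight K S s0 k s * visit_weight K S s0 (n - k) s0)"
proof (induction n arbitrary: s)
  case 0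
  show ?case using assms by (simp add: excursion_weight_0 if_distrib of_bool_def cong: if_cong)
next
  case (Suc n)
  have "visit_weight K S s0 (Suc (Suc n)) s = K s s0 * visit_weight K S s0 (Suc n) s0 +
      (\<Sum>s'\<in>S - {s0}. K s s' * visit_weight K S s0 (Suc n) s')"
    by (subst visit_weight.simps(2)) (rule sum.remove[OF assms])
  also have "(\<Sum>s'\<in>S - {s0}. K s s' * visit_weight K S s0 (Suc n) s') =
      (\<Sum>s'\<in>S - {s0}. \<Sum>k\<le>n. K s s' * excursion_weight K S s0 k s' * visit_weight K S s0 (n - k) s0)"
    unfolding Suc.IH by (simp add: sum_distrib_left mult.assoc)
  also have "\<dots> = (\<Sum>k\<le>n. excursion_weight K S s0 (Suc k) s * visit_weight K S s0 (n - k) s0)"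
    by (subst sum.swap) (simp add: excursion_weight_Suc[OF assms(1)] sum_distrib_right)
  finally show ?case
    by (simp only: sum.atMost_Suc_shift excursion_weight_0 diff_Suc_Suc diff_zero)
qed

text \<open>Let \<open>T\<close> be the truncated Green function and \<open>R\<close> the truncated return weight. The renewal equation gives
\<open>T \<le> 1 + \<rho> * R * T\<close>. The discount \<open>\<rho> < 1\<close> serves to keep \<open>\<rho> * R\<close> away from \<open>1\<close>.\<close>

lemma discounted_visits_bound:
  assumes "finite S" "s0 \<in> S" and K: "\<And>a b. K a b \<ge> 0" and \<rho>: "0 \<le> \<rho>" "\<rho> \<le> 1"
    and R: "\<rho> * (\<Sum>k<N. excursion_weight K S s0 k s0) < 1"
  shows "(\<Sum>n\<le>N. \<rho> ^ n * visit_weight K S s0 n s0) \<le> 1 / (1 - \<rho> * (\<Sum>k<N. excursion_weight K S s0 k s0))"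
proof -
  define f where "f k = excursion_weight K S s0 k s0" for k
  define v where "v k = visit_weight K S s0 k s0" for k
  define T where "T = (\<Sum>n\<le>N. \<rho> ^ n * v n)"
  have f0: "f k \<ge> 0" and v0: "v k \<ge> 0" for k
    using K by (auto simp: f_def v_def intro!: excursion_weight_nonneg visit_weight_nonneg)
  have "T = v 0 + (\<Sum>n<N. \<rho> ^ Suc n * v (Suc n))"
    unfolding T_def by (cases N) (simp_all add: sum.atMost_Suc_shift lessThan_Suc_atMost del: sum.atMost_Suc)
  also have "\<dots> = 1 + (\<Sum>n<N. \<Sum>k\<le>n. \<rho> ^ Suc n * (f k * v (n - k)))"
    unfolding v_def f_def renewal_equation[OF assms(1,2)] by (simp add: sum_distrib_left)
  also have "(\<Sum>n<N. \<Sum>k\<le>n. \<rho> ^ Suc n * (f k * v (n - k))) \<le> (\<Sum>n<N. \<Sum>k\<le>n. \<rho> * f k * (\<rho> ^ (n - k) * v (n - k)))"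
  proof (intro sum_mono)
    fix n k :: nat assume "k \<in> {..n}"
    then have "\<rho> ^ Suc n = \<rho> ^ Suc k * \<rho> ^ (n - k)" by (simp add: power_add[symmetric])
    also have "\<dots> \<le> \<rho> * \<rho> ^ (n - k)"
      using \<rho> by (intro mult_right_mono) (auto simp: mult_left_le power_le_one)
    finally have "\<rho> ^ Suc n * (f k * v (n - k)) \<le> \<rho> * \<rho> ^ (n - k) * (f k * v (n - k))"
      using f0 v0 by (intro mult_right_mono) auto
    then show "\<rho> ^ Suc n * (f k * v (n - k)) \<le> \<rho> * f k * (\<rho> ^ (n - k) * v (n - k))" by (simp add: mult_ac)
  qed
  also have "\<dots> = (\<Sum>k<N. \<rho> * f k * (\<Sum>n\<in>{k..<N}. \<rho> ^ (n - k) * v (n - k)))"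
  proof -
    have "(\<Sum>n<N. \<Sum>k\<le>n. \<rho> * f k * (\<rho> ^ (n - k) * v (n - k))) =
        (\<Sum>n<N. \<Sum>k | k \<in> {..<N} \<and> k \<le> n. \<rho> * f k * (\<rho> ^ (n - k) * v (n - k)))"
      by (intro sum.cong refl) auto
    also have "\<dots> = (\<Sum>k<N. \<Sum>n | n \<in> {..<N} \<and> k \<le> n. \<rho> * f k * (\<rho> ^ (n - k) * v (n - k)))"
      by (rule sum.swap_restrict) auto
    also have "\<dots> = (\<Sum>k<N. \<Sum>n\<in>{k..<N}. \<rho> * f k * (\<rho> ^ (n - k) * v (n - k)))"
      by (intro sum.cong refl) auto
    finally show ?thesis by (simp add: sum_distrib_left)
  qed
  also have "\<dots> \<le> (\<Sum>k<N. \<rho> * f k * T)"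
  proof (intro sum_mono mult_left_mono)
    fix k
    have "(\<Sum>n\<in>{k..<N}. \<rho> ^ (n - k) * v (n - k)) = (\<Sum>n\<in>(\<lambda>n. n - k) ` {k..<N}. \<rho> ^ n * v n)"
      by (subst sum.reindex) (auto simp: inj_on_def)
    also have "\<dots> \<le> T" unfolding T_def
      using \<rho> v0 by (intro sum_mono2) auto
    finally show "(\<Sum>n\<in>{k..<N}. \<rho> ^ (n - k) * v (n - k)) \<le> T" .
    show "0 \<le> \<rho> * f k" using \<rho> f0 by simp
  qed
  also have "\<dots> = \<rho> * (\<Sum>k<N. f k) * T" by (simp add: sum_distrib_left sum_distrib_right)
  finally have "T * (1 - \<rho> * (\<Sum>k<N. f k)) \<le> 1" by (simp add: algebra_simps)
  then show ?thesis using R by (simp add: T_def v_def f_def field_simps)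
qed

text \<open>After the first step, the excursions are pairwise exclusive events of a substochastic chain. Only the first row
enters the bound, and it may have any sum; for the reversed chain this sum is strictly smaller than \<open>1\<close>.\<close>

lemma excursion_sum_le_row_sum:
  assumes "finite S" "s0 \<in> S" and K: "\<And>a b. K a b \<ge> 0" and row: "\<And>a. a \<in> S \<Longrightarrow> (\<Sum>b\<in>S. K a b) \<le> 1"
  shows "(\<Sum>n<N. excursion_weight K S s0 n s) \<le> (\<Sum>b\<in>S. K s b)"
proof (induction N arbitrary: s)
  case 0
  show ?case using K by (simp add: sum_nonneg)
next
  case (Suc N)
  have "(\<Sum>n<Suc N. excursion_weight K S s0 n s) =
      K s s0 + (\<Sum>n<N. \<Sum>s'\<in>S - {s0}. K s s' * excursion_weight K S s0 n s')"
    by (simp add: sum.lessThan_Suc_shift excursion_weight_0 excursion_weight_Suc[OF assms(1)] del: sum.lessThan_Suc)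
  also have "(\<Sum>n<N. \<Sum>s'\<in>S - {s0}. K s s' * excursion_weight K S s0 n s') =
      (\<Sum>s'\<in>S - {s0}. K s s' * (\<Sum>n<N. excursion_weight K S s0 n s'))"
    by (subst sum.swap) (simp add: sum_distrib_left)
  also have "\<dots> \<le> (\<Sum>s'\<in>S - {s0}. K s s' * 1)"
    by (intro sum_mono mult_left_mono order_trans[OF Suc.IH row] K) auto
  also have "K s s0 + (\<Sum>s'\<in>S - {s0}. K s s' * 1) = (\<Sum>b\<in>S. K s b)"
    using sum.remove[OF assms(1,2), of "K s"] by simp
  finally show ?case by simp
qed

lemma path_weight_append:
  "path_weight K (xs @ [a] @ ys) = path_weight K (xs @ [a]) * path_weight K (a # ys)"
proof (induction xs)
  case (Cons x xs)
  then show ?case by (cases xs) auto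
qed simp

lemma path_weight_rev: "path_weight K (rev l) = path_weight (\<lambda>a b. K b a) l"
proof (induction "\<lambda>a b. K b a" l rule: path_weight.induct)
  case (1 a b l)
  then show ?case using path_weight_append[of K "rev l" b "[a]"] by (simp add: mult.commute)
qed auto

lemma excursion_weight_rev:
  "excursion_weight (\<lambda>a b. K b a) S s0 n s0 = excursion_weight K S s0 n s0"
  unfolding excursion_weight_def
proof (rule sum.reindex_bij_witness[of _ rev rev])
  fix xs
  show "path_weight K (s0 # rev xs @ [s0]) = path_weight (\<lambda>a b. K b a) (s0 # xs @ [s0])"
    using path_weight_rev[of K "s0 # xs @ [s0]"] by simp
qed (auto simp: words_def)

text \<open>The steps of a path. The weight of a closed path depends on them only through their multiplicities.\<close>

definition pairs :: "'s list \<Rightarrow> ('s \<times> 's) list" where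
  "pairs l = zip l (tl l)"

lemma path_weight_pairs: "path_weight K l = (\<Prod>p\<leftarrow>pairs l. K (fst p) (snd p))"
  by (induction K l rule: path_weight.induct) (auto simp: pairs_def)

text \<open>A closed path leaves every state as often as it enters it.\<close>

lemma pairs_closed:
  "mset (map fst (pairs (s0 # xs @ [s0]))) = mset (map snd (pairs (s0 # xs @ [s0])))"
proof -
  have "map fst (pairs (s0 # xs @ [s0])) = s0 # xs"
    by (simp add: pairs_def map_fst_zip_take)
  moreover have "map snd (pairs (s0 # xs @ [s0])) = xs @ [s0]"
    by (simp add: pairs_def map_snd_zip_take)
  ultimately show ?thesis by simp
qed

lemma set_pairs:
  assumes "set l \<subseteq> S"
  shows "set (pairs l) \<subseteq> S \<times> S"
proof
  fix p assume "p \<in> set (pairs l)"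
  then have "fst p \<in> set l" "snd p \<in> set (tl l)"
    using set_zip_leftD[of "fst p" "snd p" l "tl l"] set_zip_rightD[of "fst p" "snd p" l "tl l"]
    by (auto simp: pairs_def)
  moreover have "set (tl l) \<subseteq> set l" by (cases l) auto
  ultimately show "p \<in> S \<times> S" using assms by (cases p) auto
qed

definition excursion_sum :: "('s \<Rightarrow> 's \<Rightarrow> real) \<Rightarrow> 's set \<Rightarrow> 's \<Rightarrow> nat \<Rightarrow> real" where
  "excursion_sum K S s0 N = (\<Sum>n<N. excursion_weight K S s0 n s0)"

definition excursion_words :: "'s set \<Rightarrow> 's \<Rightarrow> nat \<Rightarrow> 's list set" where
  "excursion_words S s0 N = (\<Union>n<N. words (S - {s0}) n)"

lemma finite_excursion_words: "finite S \<Longrightarrow> finite (excursion_words S s0 N)"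
  by (simp add: excursion_words_def finite_words)

text \<open>All steps of \<open>k\<close> successive excursions \<open>g 0, \<dots>, g (k - 1)\<close> from \<open>s0\<close> to \<open>s0\<close>.\<close>

definition excursion_pairs :: "'s \<Rightarrow> (nat \<Rightarrow> 's list) \<Rightarrow> nat \<Rightarrow> ('s \<times> 's) list" where
  "excursion_pairs s0 g k = concat (map (\<lambda>m. pairs (s0 # g m @ [s0])) [0..<k])"

text \<open>The powers of the return weight expand into closed words, to which reversal applies.\<close>

lemma excursion_sum_power:
  assumes "finite S"
  shows "excursion_sum K S s0 N ^ k =
    (\<Sum>g\<in>PiE {..<k} (\<lambda>_. excursion_words S s0 N). \<Prod>p\<leftarrow>excursion_pairs s0 g k. K (fst p) (snd p))"
proof -
  have "excursion_sum K S s0 N = (\<Sum>xs\<in>excursion_words S s0 N. path_weight K (s0 # xs @ [s0]))"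
    unfolding excursion_sum_def excursion_weight_def excursion_words_def
    using assms by (subst sum.UNION_disjoint) (simp_all add: finite_words, auto simp: words_def)
  then have "excursion_sum K S s0 N ^ k = (\<Prod>m<k. \<Sum>xs\<in>excursion_words S s0 N. path_weight K (s0 # xs @ [s0]))"
    by simp
  also have "\<dots> = (\<Sum>g\<in>PiE {..<k} (\<lambda>_. excursion_words S s0 N). \<Prod>m<k. path_weight K (s0 # g m @ [s0]))"
    using assms by (intro prod_sum_PiE) (auto simp: finite_excursion_words)
  also have "\<dots> = (\<Sum>g\<in>PiE {..<k} (\<lambda>_. excursion_words S s0 N). \<Prod>p\<leftarrow>excursion_pairs s0 g k. K (fst p) (snd p))"
  proof (intro sum.cong refl)
    fix g :: "nat \<Rightarrow> 'a list"
    show "(\<Prod>m<k. path_weight K (s0 # g m @ [s0])) = (\<Prod>p\<leftarrow>excursion_pairs s0 g k. K (fst p) (snd p))"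
      by (induction k) (simp_all add: excursion_pairs_def path_weight_pairs)
  qed
  finally show ?thesis .
qed

lemma excursion_pairs_closed:
  "mset (map fst (excursion_pairs s0 g k)) = mset (map snd (excursion_pairs s0 g k))"
proof (induction k)
  case (Suc k)
  then show ?case using pairs_closed[of s0 "g k"] by (simp add: excursion_pairs_def del: mset_map)
qed (simp add: excursion_pairs_def)

lemma set_excursion_pairs:
  assumes "s0 \<in> S" "g \<in> PiE {..<k} (\<lambda>_. excursion_words S s0 N)"
  shows "set (excursion_pairs s0 g k) \<subseteq> S \<times> S"
proof -
  have "set (pairs (s0 # g m @ [s0])) \<subseteq> S \<times> S" if "m < k" for m
    using assms that by (intro set_pairs) (auto simp: excursion_words_def words_def PiE_iff)
  then show ?thesis by (fastforce simp: excursion_pairs_def)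
qed

lemma prod_list_eq_prod_count:
  fixes f :: "'s \<Rightarrow> real"
  assumes "finite X" "set xs \<subseteq> X"
  shows "(\<Prod>x\<leftarrow>xs. f x) = (\<Prod>x\<in>X. f x ^ count_list xs x)"
  using assms(2)
proof (induction xs)
  case (Cons y ys)
  have "(\<Prod>x\<in>X. f x ^ count_list (y # ys) x) = (\<Prod>x\<in>X. (if x = y then f x else 1) * f x ^ count_list ys x)"
    by (intro prod.cong) (auto simp: power_add)
  also have "\<dots> = f y * (\<Prod>x\<in>X. f x ^ count_list ys x)"
    using Cons.prems assms(1) by (simp add: prod.distrib prod.delta)
  finally show ?case using Cons by simp
qed simp

lemma sum_count_list_snd:
  assumes "finite X" "\<And>b. (a, b) \<in> set P \<Longrightarrow> (\<exists>x\<in>X. b = h x)" "inj_on h X"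
  shows "(\<Sum>x\<in>X. count_list P (a, h x)) = count (mset (map fst P)) a"
  using assms(2)
proof (induction P)
  case (Cons p P)
  have "(\<Sum>x\<in>X. count_list (p # P) (a, h x)) = (\<Sum>x\<in>X. count_list P (a, h x)) + (\<Sum>x\<in>X. of_bool (p = (a, h x)))"
    unfolding sum.distrib[symmetric] by (intro sum.cong) auto
  also have "(\<Sum>x\<in>X. of_bool (p = (a, h x))) = (of_bool (fst p = a) :: nat)"
  proof (cases "fst p = a")
    case True
    with Cons.prems[of "snd p"] obtain x where x: "x \<in> X" "snd p = h x" by (cases p) auto
    then have "(\<Sum>x'\<in>X. of_bool (p = (a, h x'))) = (\<Sum>x'\<in>X. if x' = x then 1 else (0::nat))"
      using assms(3) True by (intro sum.cong) (auto simp: inj_on_def prod_eq_iff)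
    then show ?thesis using x True assms(1) by simp
  qed (auto simp: prod_eq_iff intro!: sum.neutral)
  finally show ?case using Cons by auto
qed simp

lemma sum_count_list_fst:
  assumes "finite X" "\<And>b. (b, a) \<in> set P \<Longrightarrow> (\<exists>x\<in>X. b = h x)" "inj_on h X"
  shows "(\<Sum>x\<in>X. count_list P (h x, a)) = count (mset (map snd P)) a"
proof -
  have c: "count_list P (b, a) = count_list (map prod.swap P) (a, b)" for b
    by (induction P) auto
  have "(\<Sum>x\<in>X. count_list (map prod.swap P) (a, h x)) = count (mset (map fst (map prod.swap P))) a"
    using assms by (intro sum_count_list_snd) auto
  then show ?thesis unfolding c by (simp add: comp_def)
qed

section \<open>Reversal of closed words\<close>

text \<open>A state \<open>(y, i)\<close> stands for the directed edge with head \<open>y\<close> and direction \<open>i\<close>. The next edge starts in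
\<open>y\<close>, so that the transition from \<open>(y, i)\<close> to \<open>(y + step j, j)\<close> is governed by the weights at \<open>y\<close>.
Transitions leaving the set \<open>S\<close> of states are killed.\<close>

definition step_kernel :: "(nat \<Rightarrow> site) \<Rightarrow> (site \<times> nat) set \<Rightarrow> (site \<Rightarrow> nat \<Rightarrow> nat \<Rightarrow> real) \<Rightarrow> site \<times> nat \<Rightarrow> site \<times> nat \<Rightarrow> real" where
  "step_kernel step S F s s' = (if s \<in> S \<and> s' \<in> S \<and> fst s' = fst s + step (snd s') then F (fst s) (snd s) (snd s') else 0)"

lemma step_kernel_nonneg:
  assumes "\<And>y i j. y \<in> B \<Longrightarrow> i \<in> I \<Longrightarrow> j \<in> I \<Longrightarrow> F y i j \<ge> 0"
  shows "step_kernel step (B \<times> I) F s s' \<ge> 0"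
  using assms by (auto simp: step_kernel_def)

lemma step_kernel_measurable:
  assumes "\<And>y i j. y \<in> B \<Longrightarrow> i \<in> I \<Longrightarrow> j \<in> I \<Longrightarrow> (\<lambda>u. F u y i j) \<in> borel_measurable M"
  shows "(\<lambda>u. step_kernel step (B \<times> I) (F u) s s') \<in> borel_measurable M"
proof (cases "s \<in> B \<times> I \<and> s' \<in> B \<times> I \<and> fst s' = fst s + step (snd s')")
  case True
  then have "fst s \<in> B" "snd s \<in> I" "snd s' \<in> I" by auto
  from assms[OF this] True show ?thesis by (simp add: step_kernel_def)
next
  case False
  then have "step_kernel step (B \<times> I) (F u) s s' = 0" for u by (auto simp: step_kernel_def)
  then show ?thesis by simp
qed

lemma site_prob_component_measurable:
  assumes "y \<in> I" "j \<in> {1..n}" and sets: "sets (M y) = sets (simplex_measure n)"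
  shows "(\<lambda>u. site_prob n Z (u y) i j) \<in> borel_measurable (PiM I M)"
proof -
  have "(\<lambda>v. site_prob n Z v i j) \<in> borel_measurable (M y)"
    using site_prob_measurable[OF assms(2)] by (simp add: measurable_cong_sets[OF sets refl])
  from measurable_compose[OF measurable_component_singleton[OF assms(1), of M] this] show ?thesis .
qed

abbreviation site_kernel :: "nat \<Rightarrow> (nat \<Rightarrow> site) \<Rightarrow> (nat \<Rightarrow> nat \<Rightarrow> real) \<Rightarrow> site set \<Rightarrow> (site \<Rightarrow> nat \<Rightarrow> real) \<Rightarrow> site \<times> nat \<Rightarrow> site \<times> nat \<Rightarrow> real" where
  "site_kernel n step Z B u \<equiv> step_kernel step (B \<times> {1..n}) (\<lambda>y. site_prob n Z (u y))"

lemma site_kernel_nonneg: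
  assumes "n \<ge> 1" and Z: "positive_matrix n n Z"
    and u: "\<And>y. y \<in> B \<Longrightarrow> u y \<in> open_simplex n"
  shows "site_kernel n step Z B u s s' \<ge> 0"
  using Z by (intro step_kernel_nonneg less_imp_le site_prob_pos assms(1) u) auto

lemma sum_le_sum_injection:
  fixes f :: "'a \<Rightarrow> real" and P :: "'b \<Rightarrow> real"
  assumes "finite T" "finite J" "inj_on h J" and f0: "\<And>t. f t \<ge> 0"
    and sub: "\<And>t. t \<in> T \<Longrightarrow> f t \<noteq> 0 \<Longrightarrow> \<exists>j\<in>J. t = h j" and le: "\<And>j. j \<in> J \<Longrightarrow> f (h j) \<le> P j"
  shows "(\<Sum>t\<in>T. f t) \<le> (\<Sum>j\<in>J. P j)"
proof -
  have "(\<Sum>t\<in>T. f t) = (\<Sum>t\<in>T \<inter> h ` J. f t)"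
    using assms(1) sub by (intro sum.mono_neutral_right) auto
  also have "\<dots> \<le> (\<Sum>t\<in>h ` J. f t)" using assms(2) f0 by (intro sum_mono2) auto
  also have "\<dots> = (\<Sum>j\<in>J. f (h j))" using assms(3) by (simp add: sum.reindex)
  also have "\<dots> \<le> (\<Sum>j\<in>J. P j)" by (intro sum_mono le)
  finally show ?thesis .
qed

lemma site_kernel_row_sum:
  assumes n: "n \<ge> 1" and Z: "positive_matrix n n Z"
    and u: "\<And>y. y \<in> B \<Longrightarrow> u y \<in> open_simplex n" and B: "finite B" and s: "s \<in> B \<times> {1..n}"
  shows "(\<Sum>s'\<in>B \<times> {1..n}. site_kernel n step Z B u s s') \<le> 1"
proof -
  obtain y i where s': "s = (y, i)" "y \<in> B" "i \<in> {1..n}" using s by auto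
  have Zi: "\<forall>j\<in>{1..n}. Z i j > 0" using Z s'(3) by auto
  have "(\<Sum>t\<in>B \<times> {1..n}. site_kernel n step Z B u s t) \<le> (\<Sum>j=1..n. site_prob n Z (u y) i j)"
  proof (rule sum_le_sum_injection[where h = "\<lambda>j. (y + step j, j)"])
    show "\<exists>j\<in>{1..n}. t = (y + step j, j)" if "t \<in> B \<times> {1..n}" "site_kernel n step Z B u s t \<noteq> 0" for t
      using that by (intro bexI[of _ "snd t"]) (auto simp: step_kernel_def s' split: if_splits)
    show "site_kernel n step Z B u s (y + step j, j) \<le> site_prob n Z (u y) i j" if "j \<in> {1..n}" for j
      using site_prob_pos[where Z = Z and i = i, OF n Zi u[OF s'(2)] that] by (auto simp: step_kernel_def s')
  qed (use B site_kernel_nonneg[OF n Z u] in \<open>auto simp: inj_on_def\<close>)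
  also have "\<dots> = 1" by (rule site_prob_sum[where Z = Z and i = i, OF n Zi u[OF s'(2)]])
  finally show ?thesis .
qed

text \<open>A finite box \<open>B\<close> in which every edge \<open>e\<close> carries one weight \<open>A e\<close>, used as exponent of a coordinate at
its tail and as exponent of a linear form at its head. The exponents balance at every site of the box, except that \<open>x0\<close> has
an additional incoming slot \<open>n + 1\<close> of weight \<open>\<gamma>\<close>, which no edge uses. In other words \<open>A\<close> is a
flow with a source of strength \<open>\<gamma>\<close> in \<open>x0\<close>.\<close>

locale tilted_box =
  fixes n :: nat and step :: "nat \<Rightarrow> site" and B :: "site set" and x0 :: site
    and A :: "site \<times> nat \<Rightarrow> real" and \<gamma> :: real and Z :: "nat \<Rightarrow> nat \<Rightarrow> real"
  assumes n: "n \<ge> 1" and finite_B: "finite B" and A: "A e > 0" and \<gamma>: "\<gamma> > 0"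
    and Z: "positive_matrix (n+1) n Z"
    and balance: "y \<in> B \<Longrightarrow> (\<Sum>j=1..n. A (y + step j, j)) = (\<Sum>i=1..n. A (y, i)) + (if y = x0 then \<gamma> else 0)"
begin

definition in_dim :: "site \<Rightarrow> nat" where
  "in_dim y = (if y = x0 then n + 1 else n)"

definition out_weight :: "site \<Rightarrow> nat \<Rightarrow> real" where
  "out_weight y j = A (y + step j, j)"

definition in_weight :: "site \<Rightarrow> nat \<Rightarrow> real" where
  "in_weight y i = (if i \<in> {1..n} then A (y, i) else \<gamma>)"

definition forward_law :: "site \<Rightarrow> (nat \<Rightarrow> real) measure" where
  "forward_law y = hyp_law (in_dim y) n (out_weight y) (in_weight y) Z"

definition backward_law :: "site \<Rightarrow> (nat \<Rightarrow> real) measure" where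
  "backward_law y = hyp_law n (in_dim y) (in_weight y) (out_weight y) (\<lambda>j i. Z i j)"

definition states :: "(site \<times> nat) set" where
  "states = B \<times> {1..n}"

abbreviation lift :: "(site \<Rightarrow> nat \<Rightarrow> nat \<Rightarrow> real) \<Rightarrow> site \<times> nat \<Rightarrow> site \<times> nat \<Rightarrow> real" where
  "lift \<equiv> step_kernel step states"

definition forward_kernel :: "(site \<Rightarrow> nat \<Rightarrow> real) \<Rightarrow> site \<times> nat \<Rightarrow> site \<times> nat \<Rightarrow> real" where
  "forward_kernel u = lift (\<lambda>y i j. site_prob n Z (u y) i j)"

definition backward_kernel :: "(site \<Rightarrow> nat \<Rightarrow> real) \<Rightarrow> site \<times> nat \<Rightarrow> site \<times> nat \<Rightarrow> real" where
  "backward_kernel w = lift (\<lambda>y i j. site_prob (in_dim y) (\<lambda>j i. Z i j) (w y) j i)"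

lemma in_dim: "in_dim y \<ge> 1" "{1..n} \<subseteq> {1..in_dim y}" "{1..in_dim y} \<subseteq> {1..n+1}"
  using n by (auto simp: in_dim_def)

lemma finite_states: "finite states"
  using finite_B by (simp add: states_def)

lemma Z_in: "positive_matrix (in_dim y) n Z" "\<forall>j\<in>{1..n}. \<forall>i\<in>{1..in_dim y}. Z i j > 0"
  using Z in_dim(3)[of y] by blast+

lemma weights_pos: "\<forall>j\<in>J. out_weight y j > 0" "\<forall>i\<in>J. in_weight y i > 0"
  using A \<gamma> by (auto simp: out_weight_def in_weight_def)

lemma weights_balance:
  assumes "y \<in> B"
  shows "(\<Sum>j=1..n. out_weight y j) = (\<Sum>i=1..in_dim y. in_weight y i)"
proof -
  have "{1..n + 1} = insert (n + 1) {1..n}" by auto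
  then have "(\<Sum>i=1..in_dim y. in_weight y i) = (\<Sum>i=1..n. in_weight y i) + (if y = x0 then in_weight y (n + 1) else 0)"
    by (simp add: in_dim_def)
  then show ?thesis using balance[OF assms] by (simp add: out_weight_def in_weight_def)
qed

lemma space_laws [simp]: "space (forward_law y) = open_simplex n" "space (backward_law y) = open_simplex (in_dim y)"
  by (simp_all add: forward_law_def backward_law_def)

lemma prob_space_forward: "prob_space (forward_law y)"
  unfolding forward_law_def by (intro prob_space_hyp_law n weights_pos Z_in)

lemma prob_space_backward: "prob_space (backward_law y)"
  unfolding backward_law_def by (intro prob_space_hyp_law in_dim weights_pos Z_in)

lemma measurable_forward: "measurable (forward_law y) = measurable (simplex_measure n)"
  by (intro ext measurable_cong_sets) (auto simp: forward_law_def hyp_law_def)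

lemma measurable_backward: "measurable (backward_law y) = measurable (simplex_measure (in_dim y))"
  by (intro ext measurable_cong_sets) (auto simp: backward_law_def hyp_law_def)

text \<open>The weight of a word, sorted by sites and pairs of slots. The entrance slot of \<open>x0\<close> contributes empty powers.\<close>

lemma lift_word_product:
  assumes P: "set P \<subseteq> states \<times> states" and good: "\<And>p. p \<in> set P \<Longrightarrow> fst (snd p) = fst (fst p) + step (snd (snd p))"
  shows "(\<Prod>p\<leftarrow>P. lift F (fst p) (snd p)) =
    (\<Prod>y\<in>B. \<Prod>i=1..in_dim y. \<Prod>j=1..n. F y i j ^ count_list P ((y, i), (y + step j, j)))"
proof -
  define h where "h = (\<lambda>(y, i :: nat, j). ((y, i), (y + step j, j)))"
  have inj: "inj_on h (B \<times> {1..n} \<times> {1..n})" by (auto simp: h_def inj_on_def)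
  have sub: "set P \<subseteq> h ` (B \<times> {1..n} \<times> {1..n})"
  proof
    fix p assume p: "p \<in> set P"
    obtain y i y' j where eq: "p = ((y, i), (y', j))" by (metis surj_pair)
    have "y' = y + step j" using good[OF p] by (simp add: eq)
    moreover have "y \<in> B" "i \<in> {1..n}" "j \<in> {1..n}" using P p by (auto simp: eq states_def)
    ultimately show "p \<in> h ` (B \<times> {1..n} \<times> {1..n})"
      unfolding eq by (intro image_eqI[of _ _ "(y, i, j)"]) (auto simp: h_def)
  qed
  have "(\<Prod>p\<leftarrow>P. lift F (fst p) (snd p)) =
      (\<Prod>p\<in>h ` (B \<times> {1..n} \<times> {1..n}). lift F (fst p) (snd p) ^ count_list P p)"
    using finite_B by (intro prod_list_eq_prod_count sub) auto
  also have "\<dots> = (\<Prod>(y, i, j)\<in>B \<times> {1..n} \<times> {1..n}. lift F (y, i) (y + step j, j) ^ count_list P ((y, i), (y + step j, j)))"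
    by (subst prod.reindex[OF inj]) (auto simp: h_def case_prod_unfold intro!: prod.cong)
  also have "\<dots> = (\<Prod>(y, i, j)\<in>B \<times> {1..n} \<times> {1..n}. F y i j ^ count_list P ((y, i), (y + step j, j)))"
  proof (intro prod.cong refl, clarify)
    fix y i j
    show "lift F (y, i) (y + step j, j) ^ count_list P ((y, i), (y + step j, j)) = F y i j ^ count_list P ((y, i), (y + step j, j))"
    proof (cases "((y, i), (y + step j, j)) \<in> set P")
      case True
      then show ?thesis using P by (auto simp: step_kernel_def)
    next
      case False
      then show ?thesis by (simp add: count_list_0_iff[THEN iffD2])
    qed
  qed
  also have "\<dots> = (\<Prod>y\<in>B. \<Prod>i=1..n. \<Prod>j=1..n. F y i j ^ count_list P ((y, i), (y + step j, j)))"
    by (simp add: prod.cartesian_product)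
  also have "\<dots> = (\<Prod>y\<in>B. \<Prod>i=1..in_dim y. \<Prod>j=1..n. F y i j ^ count_list P ((y, i), (y + step j, j)))"
  proof (rule prod.cong[OF refl], rule prod.mono_neutral_left)
    fix y
    show "\<forall>i\<in>{1..in_dim y} - {1..n}. (\<Prod>j=1..n. F y i j ^ count_list P ((y, i), (y + step j, j))) = 1"
    proof
      fix i assume "i \<in> {1..in_dim y} - {1..n}"
      then have "((y, i), (y + step j, j)) \<notin> set P" for j using P by (auto simp: states_def)
      then show "(\<Prod>j=1..n. F y i j ^ count_list P ((y, i), (y + step j, j))) = 1"
        by (simp add: count_list_0_iff[THEN iffD2])
    qed
  qed (use in_dim in auto)
  finally show ?thesis .
qed

lemma lift_word_product_bad:
  assumes "p \<in> set P" "fst (snd p) \<noteq> fst (fst p) + step (snd (snd p))"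
  shows "(\<Prod>p\<leftarrow>P. lift F (fst p) (snd p)) = 0"
proof -
  have "lift F (fst p) (snd p) = 0" using assms(2) by (auto simp: step_kernel_def)
  then show ?thesis using assms(1) by (force simp: prod_list_zero_iff)
qed

text \<open>Every site contributes the Gamma quotients of its moment duality. In a closed word an edge is left as often as it is
entered, and its two exponents are the same number \<open>A e\<close>. Hence the quotient \<open>\<psi> e\<close> occurs in the numerator at the tail of
\<open>e\<close> and in the denominator at the head of \<open>e\<close>, and everything cancels.\<close>

lemma closed_word_duality:
  assumes P: "set P \<subseteq> states \<times> states" and closed: "mset (map fst P) = mset (map snd P)"
  shows "(\<integral>\<^sup>+u. ennreal (\<Prod>p\<leftarrow>P. forward_kernel u (fst p) (snd p)) \<partial>PiM B forward_law) =
    (\<integral>\<^sup>+w. ennreal (\<Prod>p\<leftarrow>P. backward_kernel w (fst p) (snd p)) \<partial>PiM B backward_law)"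
proof (cases "\<forall>p\<in>set P. fst (snd p) = fst (fst p) + step (snd (snd p))")
  case False
  then obtain p where "p \<in> set P" "fst (snd p) \<noteq> fst (fst p) + step (snd (snd p))" by blast
  from lift_word_product_bad[OF this] show ?thesis by (simp add: forward_kernel_def backward_kernel_def)
next
  case True
  then have good: "\<And>p. p \<in> set P \<Longrightarrow> fst (snd p) = fst (fst p) + step (snd (snd p))" by blast
  interpret F: product_prob_space forward_law B
    by (intro product_prob_spaceI prob_space_forward)
  interpret Bk: product_prob_space backward_law B
    by (intro product_prob_spaceI prob_space_backward)
  define N where "N y i j = count_list P ((y, i), (y + step j, j))" for y i j
  let ?F = "\<lambda>y v. \<Prod>i=1..in_dim y. \<Prod>j=1..n. site_prob n Z v i j ^ N y i j" and ?G = "\<lambda>y w. \<Prod>i=1..in_dim y. \<Prod>j=1..n. site_prob (in_dim y) (\<lambda>j i. Z i j) w j i ^ N y i j"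
  \<comment> \<open>The number of visits to a state, counted through departures or, equivalently, through arrivals.\<close>
  define \<nu> where "\<nu> s = count (mset (map fst P)) s" for s
  have N_out: "(\<Sum>i=1..in_dim y. N y i j) = \<nu> (y + step j, j)" for y j
    unfolding N_def \<nu>_def closed
  proof (rule sum_count_list_fst)
    fix b assume b: "(b, (y + step j, j)) \<in> set P"
    then have "fst b = y" using good[OF b] by simp
    moreover have "snd b \<in> {1..n}" using P b by (cases b) (auto simp: states_def)
    ultimately show "\<exists>i\<in>{1..in_dim y}. b = (y, i)" using in_dim(2)[of y] by (cases b) auto
  qed (auto simp: inj_on_def)
  have N_in: "(\<Sum>j=1..n. N y i j) = \<nu> (y, i)" for y i
    unfolding N_def \<nu>_def
  proof (rule sum_count_list_snd)
    fix b assume b: "((y, i), b) \<in> set P"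
    then have "fst b = y + step (snd b)" using good[OF b] by simp
    moreover have "snd b \<in> {1..n}" using P b by (cases b) (auto simp: states_def)
    ultimately show "\<exists>j\<in>{1..n}. b = (y + step j, j)" by (intro bexI[of _ "snd b"]) (auto simp: prod_eq_iff)
  qed (auto simp: inj_on_def)
  define \<psi> where "\<psi> s = Gamma (A s + real (\<nu> s)) / Gamma (A s)" for s
  have \<psi>_pos: "\<psi> s > 0" for s
    unfolding \<psi>_def using A[of s] by (intro divide_pos_pos Gamma_real_pos) auto
  have \<psi>_triv: "\<psi> s = 1" if "\<nu> s = 0" for s
    using that Gamma_real_pos[OF A[of s]] by (simp add: \<psi>_def)
  define c where "c y = (\<Prod>j=1..n. \<psi> (y + step j, j)) / (\<Prod>i=1..n. \<psi> (y, i))" for y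
  have c_pos: "c y > 0" for y unfolding c_def by (intro divide_pos_pos prod_pos \<psi>_pos)
  have site: "(\<integral>\<^sup>+v. ennreal (?F y v) \<partial>forward_law y) =
      ennreal (c y) * (\<integral>\<^sup>+w. ennreal (?G y w) \<partial>backward_law y)"
    if y: "y \<in> B" for y
  proof -
    have "(\<Prod>i=1..in_dim y. Gamma (in_weight y i + real (\<nu> (y, i))) / Gamma (in_weight y i)) =
       (\<Prod>i=1..n. \<psi> (y, i))"
    proof (rule prod.mono_neutral_cong_right)
      show "\<forall>i\<in>{1..in_dim y} - {1..n}. Gamma (in_weight y i + real (\<nu> (y, i))) / Gamma (in_weight y i) = 1"
      proof
        fix i assume i: "i \<in> {1..in_dim y} - {1..n}"
        have "\<nu> (y, i) = 0" using P i by (auto simp: \<nu>_def states_def count_eq_zero_iff)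
        then show "Gamma (in_weight y i + real (\<nu> (y, i))) / Gamma (in_weight y i) = 1"
          using Gamma_real_pos[OF bspec[OF weights_pos(2)[of UNIV y] UNIV_I[of i]]] by simp
      qed
    qed (use in_dim in \<open>auto simp: \<psi>_def in_weight_def\<close>)
    then have "c y = (\<Prod>j=1..n. Gamma (out_weight y j + real (\<Sum>i=1..in_dim y. N y i j)) / Gamma (out_weight y j)) /
       (\<Prod>i=1..in_dim y. Gamma (in_weight y i + real (\<Sum>j=1..n. N y i j)) / Gamma (in_weight y i))"
      unfolding N_out N_in by (simp add: c_def \<psi>_def out_weight_def)
    then show ?thesis unfolding forward_law_def backward_law_def
      by (simp only:) (intro hyp_moment_duality in_dim n weights_pos Z_in weights_balance y)
  qed
  have c_prod: "(\<Prod>y\<in>B. c y) = 1"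
  proof -
    \<comment> \<open>Edges crossing the boundary of the box are not visited, so both products reduce to the visited edges.\<close>
    define T where "T = {s \<in> states. \<nu> s \<noteq> 0}"
    have T: "finite T" using finite_states by (simp add: T_def)
    have "(\<Prod>y\<in>B. \<Prod>j=1..n. \<psi> (y + step j, j)) = (\<Prod>(y, j)\<in>B \<times> {1..n}. \<psi> (y + step j, j))"
      by (simp add: prod.cartesian_product)
    also have "\<dots> = (\<Prod>s\<in>(\<lambda>(y, j). (y + step j, j)) ` (B \<times> {1..n}). \<psi> s)"
      by (subst prod.reindex) (auto simp: inj_on_def case_prod_unfold intro!: prod.cong)
    also have "\<dots> = (\<Prod>s\<in>T. \<psi> s)"
    proof (rule prod.mono_neutral_right)
      show "T \<subseteq> (\<lambda>(y, j). (y + step j, j)) ` (B \<times> {1..n})"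
      proof
        fix s assume s: "s \<in> T"
        then have "s \<in># mset (map snd P)" unfolding closed[symmetric] by (auto simp: T_def \<nu>_def count_eq_zero_iff)
        then obtain p where p: "p \<in> set P" "s = snd p" by auto
        then have "fst s = fst (fst p) + step (snd s)" using good by blast
        moreover have "fst (fst p) \<in> B" "snd s \<in> {1..n}" using P p by (auto simp: states_def)
        ultimately show "s \<in> (\<lambda>(y, j). (y + step j, j)) ` (B \<times> {1..n})"
          by (intro image_eqI[of _ _ "(fst (fst p), snd s)"]) (auto simp: prod_eq_iff)
      qed
      show "\<forall>s\<in>(\<lambda>(y, j). (y + step j, j)) ` (B \<times> {1..n}) - T. \<psi> s = 1"
      proof
        fix s assume s: "s \<in> (\<lambda>(y, j). (y + step j, j)) ` (B \<times> {1..n}) - T"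
        have "\<nu> s = 0"
        proof (cases "s \<in> states")
          case False
          then show ?thesis using P by (auto simp: \<nu>_def count_eq_zero_iff)
        qed (use s in \<open>auto simp: T_def\<close>)
        then show "\<psi> s = 1" by (rule \<psi>_triv)
      qed
    qed (use finite_B in auto)
    finally have 1: "(\<Prod>y\<in>B. \<Prod>j=1..n. \<psi> (y + step j, j)) = (\<Prod>s\<in>T. \<psi> s)" .
    have "(\<Prod>y\<in>B. \<Prod>i=1..n. \<psi> (y, i)) = (\<Prod>s\<in>states. \<psi> s)"
      by (simp add: prod.cartesian_product states_def case_prod_unfold)
    also have "\<dots> = (\<Prod>s\<in>T. \<psi> s)"
      by (rule prod.mono_neutral_right) (auto simp: T_def finite_states \<psi>_triv)
    finally have 2: "(\<Prod>y\<in>B. \<Prod>i=1..n. \<psi> (y, i)) = (\<Prod>s\<in>T. \<psi> s)" .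
    have "(\<Prod>s\<in>T. \<psi> s) > 0" by (intro prod_pos \<psi>_pos)
    then show ?thesis by (simp add: c_def prod_dividef 1 2)
  qed
  have "(\<integral>\<^sup>+u. ennreal (\<Prod>p\<leftarrow>P. forward_kernel u (fst p) (snd p)) \<partial>PiM B forward_law) =
    (\<integral>\<^sup>+u. (\<Prod>y\<in>B. ennreal (?F y (u y))) \<partial>PiM B forward_law)"
  proof (rule nn_integral_cong)
    fix u assume "u \<in> space (PiM B forward_law)"
    then have u: "u y \<in> open_simplex n" if "y \<in> B" for y using that by (auto simp: space_PiM PiE_iff)
    have "0 \<le> ?F y (u y)" if y: "y \<in> B" for y
    proof (intro prod_nonneg ballI zero_le_power)
      fix i j assume "i \<in> {1..in_dim y}" "j \<in> {1..n}"
      then show "0 \<le> site_prob n Z (u y) i j"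
        using Z_in(1)[of y] by (intro less_imp_le site_prob_pos n u y) auto
    qed
    moreover have "(\<Prod>p\<leftarrow>P. forward_kernel u (fst p) (snd p)) = (\<Prod>y\<in>B. ?F y (u y))"
      unfolding forward_kernel_def N_def by (rule lift_word_product[OF P]) (rule good)
    ultimately show "ennreal (\<Prod>p\<leftarrow>P. forward_kernel u (fst p) (snd p)) =
      (\<Prod>y\<in>B. ennreal (?F y (u y)))"
      by (simp add: prod_ennreal)
  qed
  also have "\<dots> = (\<Prod>y\<in>B. \<integral>\<^sup>+v. ennreal (?F y v) \<partial>forward_law y)"
    by (rule F.product_nn_integral_prod[OF finite_B]) (unfold measurable_forward, measurable)
  also have "\<dots> = (\<Prod>y\<in>B. ennreal (c y) * (\<integral>\<^sup>+w. ennreal (?G y w) \<partial>backward_law y))"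
    by (intro prod.cong refl site)
  also have "\<dots> = ennreal (\<Prod>y\<in>B. c y) * (\<Prod>y\<in>B. (\<integral>\<^sup>+w. ennreal (?G y w) \<partial>backward_law y))"
    using c_pos by (simp add: prod.distrib prod_ennreal less_imp_le)
  also have "\<dots> = (\<integral>\<^sup>+w. (\<Prod>y\<in>B. ennreal (?G y (w y))) \<partial>PiM B backward_law)"
    unfolding c_prod ennreal_1 mult_1
    by (rule Bk.product_nn_integral_prod[OF finite_B, symmetric]) (unfold measurable_backward, measurable)
  also have "\<dots> = (\<integral>\<^sup>+w. ennreal (\<Prod>p\<leftarrow>P. backward_kernel w (fst p) (snd p)) \<partial>PiM B backward_law)"
  proof (rule nn_integral_cong)
    fix w assume "w \<in> space (PiM B backward_law)"
    then have w: "w y \<in> open_simplex (in_dim y)" if "y \<in> B" for y using that by (auto simp: space_PiM PiE_iff)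
    have "0 \<le> ?G y (w y)" if y: "y \<in> B" for y
    proof (intro prod_nonneg ballI zero_le_power)
      fix i j assume "i \<in> {1..in_dim y}" "j \<in> {1..n}"
      then show "0 \<le> site_prob (in_dim y) (\<lambda>j i. Z i j) (w y) j i"
        using Z_in(2)[of y] by (intro less_imp_le site_prob_pos in_dim w y) auto
    qed
    moreover have "(\<Prod>p\<leftarrow>P. backward_kernel w (fst p) (snd p)) = (\<Prod>y\<in>B. ?G y (w y))"
      unfolding backward_kernel_def N_def by (rule lift_word_product[OF P]) (rule good)
    ultimately show "(\<Prod>y\<in>B. ennreal (?G y (w y))) =
       ennreal (\<Prod>p\<leftarrow>P. backward_kernel w (fst p) (snd p))"
      by (simp add: prod_ennreal)
  qed
  finally show ?thesis .
qed

end

section \<open>The power series of the return weight\<close>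

lemma negative_binomial_sums:
  fixes x r :: real
  assumes "0 \<le> x" "x < 1"
  shows "(\<lambda>k. pochhammer r k / fact k * x ^ k) sums ((1 - x) powr (- r))"
proof -
  have "(\<lambda>k. (- r gchoose k) * (- x) ^ k) sums (1 + (- x)) powr (- r)"
    using assms by (intro gen_binomial_real) auto
  moreover have "(- r gchoose k) * (- x) ^ k = pochhammer r k / fact k * x ^ k" for k
  proof -
    have "(- r gchoose k) * (- x) ^ k = ((- 1) ^ k * (- 1) ^ k) * (pochhammer r k / fact k * x ^ k)"
      unfolding power_minus[of x k] gbinomial_pochhammer by (simp only: minus_minus times_divide_eq_left times_divide_eq_right mult_ac)
    also have "(- 1 :: real) ^ k * (- 1) ^ k = 1" by (simp flip: power_mult_distrib)
    finally show ?thesis by simp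
  qed
  ultimately show ?thesis by simp
qed

text \<open>All coefficients are nonnegative. Negative moments of \<open>1 - \<rho> * R\<close> can therefore be compared through the integer
moments of \<open>R\<close>.\<close>

lemma nn_integral_negative_binomial:
  assumes R: "R \<in> borel_measurable M" and R01: "\<And>u. u \<in> space M \<Longrightarrow> 0 \<le> R u \<and> R u \<le> (1::real)"
    and \<rho>: "0 \<le> \<rho>" "\<rho> < 1" and r: "r > 0"
  shows "(\<integral>\<^sup>+u. ennreal ((1 - \<rho> * R u) powr (- r)) \<partial>M) =
    (\<Sum>k. ennreal (pochhammer r k / fact k * \<rho> ^ k) * (\<integral>\<^sup>+u. ennreal (R u ^ k) \<partial>M))"
proof -
  have mk: "(\<lambda>u. ennreal (R u ^ k)) \<in> borel_measurable M" for k
    by (intro measurable_compose[OF _ measurable_ennreal] borel_measurable_power R)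
  have c0: "pochhammer r k / fact k * \<rho> ^ k \<ge> 0" for k
    using pochhammer_nonneg[OF r] \<rho> by simp
  have "(\<integral>\<^sup>+u. ennreal ((1 - \<rho> * R u) powr (- r)) \<partial>M) =
     (\<integral>\<^sup>+u. (\<Sum>k. ennreal (pochhammer r k / fact k * \<rho> ^ k) * ennreal (R u ^ k)) \<partial>M)"
  proof (rule nn_integral_cong)
    fix u assume u: "u \<in> space M"
    have x: "0 \<le> \<rho> * R u" "\<rho> * R u < 1"
      using R01[OF u] \<rho> by (auto simp: mult_left_le le_less_trans[OF mult_left_le])
    have S: "(\<lambda>k. pochhammer r k / fact k * \<rho> ^ k * R u ^ k) sums ((1 - \<rho> * R u) powr (- r))"
      using negative_binomial_sums[OF x, of r] by (simp add: power_mult_distrib mult_ac)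
    have nn: "0 \<le> pochhammer r k / fact k * \<rho> ^ k * R u ^ k" for k
      using R01[OF u] by (intro mult_nonneg_nonneg c0) auto
    have "ennreal ((1 - \<rho> * R u) powr (- r)) = (\<Sum>k. ennreal (pochhammer r k / fact k * \<rho> ^ k * R u ^ k))"
      unfolding suminf_ennreal2[OF nn sums_summable[OF S]] sums_unique[OF S] ..
    also have "\<dots> = (\<Sum>k. ennreal (pochhammer r k / fact k * \<rho> ^ k) * ennreal (R u ^ k))"
      by (intro suminf_cong ennreal_mult' c0)
    finally show "ennreal ((1 - \<rho> * R u) powr (- r)) = (\<Sum>k. ennreal (pochhammer r k / fact k * \<rho> ^ k) * ennreal (R u ^ k))" .
  qed
  also have "\<dots> = (\<Sum>k. \<integral>\<^sup>+u. ennreal (pochhammer r k / fact k * \<rho> ^ k) * ennreal (R u ^ k) \<partial>M)"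
    by (rule nn_integral_suminf) (intro borel_measurable_times_ennreal borel_measurable_const mk)
  also have "\<dots> = (\<Sum>k. ennreal (pochhammer r k / fact k * \<rho> ^ k) * (\<integral>\<^sup>+u. ennreal (R u ^ k) \<partial>M))"
    by (rule suminf_cong, rule nn_integral_cmult, rule mk)
  finally show ?thesis .
qed

lemma path_weight_measurable:
  assumes "\<And>s s'. (\<lambda>u. K u s s') \<in> borel_measurable M"
  shows "(\<lambda>u. path_weight (K u) l) \<in> borel_measurable M"
proof (induction l rule: induct_list012)
  case (3 a b l)
  then show ?case using assms by simp
qed auto

lemma excursion_sum_measurable:
  assumes "\<And>s s'. (\<lambda>u. K u s s') \<in> borel_measurable M"
  shows "(\<lambda>u. excursion_sum (K u) S s0 N) \<in> borel_measurable M"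
  unfolding excursion_sum_def excursion_weight_def
  by (intro borel_measurable_sum path_weight_measurable assms)

context tilted_box
begin

abbreviation "forward_env \<equiv> PiM B forward_law"
abbreviation "backward_env \<equiv> PiM B backward_law"
abbreviation "forward_return s0 N u \<equiv> excursion_sum (forward_kernel u) states s0 N"
abbreviation "backward_return s0 N w \<equiv> excursion_sum (backward_kernel w) states s0 N"

lemma forward_env_space: "u \<in> space forward_env \<Longrightarrow> y \<in> B \<Longrightarrow> u y \<in> open_simplex n"
  by (auto simp: space_PiM PiE_iff)

lemma backward_env_space: "w \<in> space backward_env \<Longrightarrow> y \<in> B \<Longrightarrow> w y \<in> open_simplex (in_dim y)"
  by (auto simp: space_PiM PiE_iff)

lemma forward_kernel_eq: "forward_kernel u = site_kernel n step Z B u"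
  by (simp add: forward_kernel_def states_def)

lemma Z_square: "positive_matrix n n Z"
  using Z by auto

lemma forward_kernel_nonneg:
  assumes "u \<in> space forward_env"
  shows "forward_kernel u s s' \<ge> 0"
  unfolding forward_kernel_eq by (intro site_kernel_nonneg n Z_square forward_env_space[OF assms])

lemma backward_kernel_nonneg:
  assumes "w \<in> space backward_env"
  shows "backward_kernel w s s' \<ge> 0"
  unfolding backward_kernel_def states_def using Z_in(2) in_dim(2)
  by (intro step_kernel_nonneg less_imp_le site_prob_pos in_dim backward_env_space[OF assms]) blast+

lemma kernel_measurable:
  "(\<lambda>u. forward_kernel u s s') \<in> borel_measurable forward_env"
  "(\<lambda>w. backward_kernel w s s') \<in> borel_measurable backward_env"
  unfolding forward_kernel_def backward_kernel_def states_def using in_dim(2)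
  by (intro step_kernel_measurable site_prob_component_measurable;
      auto simp: forward_law_def backward_law_def sets_hyp_law intro: order_trans)+

text \<open>Although the two environments are not related pointwise, all integer moments of their return weights agree.\<close>

lemma nn_integral_excursion_sum_power:
  assumes "s0 \<in> states"
  shows "(\<integral>\<^sup>+u. ennreal (forward_return s0 N u ^ k) \<partial>forward_env) =
    (\<integral>\<^sup>+w. ennreal (backward_return s0 N w ^ k) \<partial>backward_env)"
proof -
  let ?G = "PiE {..<k} (\<lambda>_. excursion_words states s0 N)"
  have pl: "(\<Prod>p\<leftarrow>P. K (fst p) (snd p)) \<ge> (0::real)" if "\<And>a b. K a b \<ge> 0" for K and P :: "('s \<times> 's) list"
    using that by (induction P) auto
  have plm: "(\<lambda>u. (\<Prod>p\<leftarrow>P. K u (fst p) (snd p))) \<in> borel_measurable M"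
    if "\<And>s s'. (\<lambda>u. K u s s') \<in> borel_measurable M" for K :: "_ \<Rightarrow> 's \<Rightarrow> 's \<Rightarrow> real" and P :: "('s \<times> 's) list" and M
    using that by (induction P) auto
  have "(\<integral>\<^sup>+u. ennreal (forward_return s0 N u ^ k) \<partial>forward_env) =
     (\<integral>\<^sup>+u. (\<Sum>g\<in>?G. ennreal (\<Prod>p\<leftarrow>excursion_pairs s0 g k. forward_kernel u (fst p) (snd p))) \<partial>forward_env)"
    by (intro nn_integral_cong) (simp add: excursion_sum_power finite_states sum_ennreal pl forward_kernel_nonneg)
  also have "\<dots> = (\<Sum>g\<in>?G. \<integral>\<^sup>+u. ennreal (\<Prod>p\<leftarrow>excursion_pairs s0 g k. forward_kernel u (fst p) (snd p)) \<partial>forward_env)"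
    by (intro nn_integral_sum measurable_compose[OF _ measurable_ennreal] plm kernel_measurable)
  also have "\<dots> = (\<Sum>g\<in>?G. \<integral>\<^sup>+w. ennreal (\<Prod>p\<leftarrow>excursion_pairs s0 g k. backward_kernel w (fst p) (snd p)) \<partial>backward_env)"
    using assms by (intro sum.cong refl closed_word_duality set_excursion_pairs excursion_pairs_closed)
  also have "\<dots> = (\<integral>\<^sup>+w. (\<Sum>g\<in>?G. ennreal (\<Prod>p\<leftarrow>excursion_pairs s0 g k. backward_kernel w (fst p) (snd p))) \<partial>backward_env)"
    by (intro nn_integral_sum[symmetric] measurable_compose[OF _ measurable_ennreal] plm kernel_measurable)
  also have "\<dots> = (\<integral>\<^sup>+w. ennreal (backward_return s0 N w ^ k) \<partial>backward_env)"
    by (intro nn_integral_cong) (simp add: excursion_sum_power finite_states sum_ennreal pl backward_kernel_nonneg)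
  finally show ?thesis .
qed

lemma forward_kernel_row_sum:
  assumes "u \<in> space forward_env" "s \<in> states"
  shows "(\<Sum>s'\<in>states. forward_kernel u s s') \<le> 1"
  using assms unfolding forward_kernel_eq states_def
  by (intro site_kernel_row_sum n Z_square forward_env_space[OF assms(1)] finite_B)

text \<open>Probability that the reversed walk, at an edge with tail \<open>x0\<close> and direction \<open>j\<close>, leaves through the entrance slot.
No word uses this slot, so the reversed walk is lost when it chooses it.\<close>

definition escape :: "nat \<Rightarrow> (site \<Rightarrow> nat \<Rightarrow> real) \<Rightarrow> real" where
  "escape j w = site_prob (n + 1) (\<lambda>j i. Z i j) (w x0) j (n + 1)"

lemma backward_kernel_column_sum:
  assumes w: "w \<in> space backward_env" and t: "t \<in> states"
  shows "(\<Sum>s\<in>states. backward_kernel w s t) \<le> 1"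
    and "fst t = x0 + step (snd t) \<Longrightarrow> x0 \<in> B \<Longrightarrow> (\<Sum>s\<in>states. backward_kernel w s t) \<le> 1 - escape (snd t) w"
proof -
  define j where "j = snd t"
  define y where "y = fst t - step j"
  have ty: "fst t = z + step (snd t) \<longleftrightarrow> z = y" for z by (auto simp: y_def j_def)
  have j: "j \<in> {1..n}" using t by (auto simp: j_def states_def)
  have Zj: "\<forall>i\<in>{1..in_dim y}. Z i j > 0" using Z_in(2)[of y] j by auto
  let ?P = "\<lambda>i. site_prob (in_dim y) (\<lambda>j i. Z i j) (w y) j i"
  have "(\<Sum>s\<in>states. backward_kernel w s t) \<le> 0" if "y \<notin> B"
    using that by (intro sum_nonpos) (auto simp: backward_kernel_def step_kernel_def states_def ty)
  moreover have pos: "?P i > 0" if "y \<in> B" "i \<in> {1..in_dim y}" for i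
    using site_prob_pos[where Z = "\<lambda>j i. Z i j" and i = j, OF in_dim(1) Zj backward_env_space[OF w that(1)] that(2)] .
  have tot: "(\<Sum>i=1..in_dim y. ?P i) = 1" if "y \<in> B"
    using site_prob_sum[where Z = "\<lambda>j i. Z i j" and i = j, OF in_dim(1) Zj backward_env_space[OF w that(1)]] .
  have le: "(\<Sum>s\<in>states. backward_kernel w s t) \<le> (\<Sum>i=1..n. ?P i)" if y: "y \<in> B"
  proof (rule sum_le_sum_injection[where h = "\<lambda>i. (y, i)"])
    show "\<exists>i\<in>{1..n}. s = (y, i)" if "s \<in> states" "backward_kernel w s t \<noteq> 0" for s
      using that by (intro bexI[of _ "snd s"]) (auto simp: backward_kernel_def step_kernel_def states_def ty prod_eq_iff split: if_splits)
    show "backward_kernel w (y, i) t \<le> ?P i" if "i \<in> {1..n}" for i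
    proof -
      have "i \<in> {1..in_dim y}" using that in_dim(2) by blast
      from pos[OF y this] show ?thesis by (auto simp: backward_kernel_def step_kernel_def j_def)
    qed
  qed (auto simp: finite_states backward_kernel_nonneg[OF w] inj_on_def)
  moreover have "(\<Sum>i=1..n. ?P i) \<le> (\<Sum>i=1..in_dim y. ?P i)" if y: "y \<in> B"
    using in_dim(2) pos[OF y] by (intro sum_mono2) (auto intro: less_imp_le)
  ultimately show "(\<Sum>s\<in>states. backward_kernel w s t) \<le> 1"
    using tot by (cases "y \<in> B") force+
  assume "fst t = x0 + step (snd t)" and x0: "x0 \<in> B"
  then have y: "y = x0" by (simp add: ty)
  have "{1..n + 1} = insert (n + 1) {1..n}" by auto
  then have "(\<Sum>i=1..n. ?P i) = 1 - escape (snd t) w"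
    using tot x0 by (simp add: y in_dim_def escape_def j_def)
  then show "(\<Sum>s\<in>states. backward_kernel w s t) \<le> 1 - escape (snd t) w"
    using le x0 y by simp
qed

lemma escape_pos:
  assumes w: "w \<in> space backward_env" and "x0 \<in> B" "j \<in> {1..n}"
  shows "escape j w > 0"
proof -
  have "w x0 \<in> open_simplex (n + 1)" using backward_env_space[OF assms(1,2)] by (simp add: in_dim_def)
  moreover have "\<forall>i\<in>{1..n + 1}. Z i j > 0" using Z assms(3) by auto
  ultimately show ?thesis unfolding escape_def by (intro site_prob_pos) auto
qed

lemma excursion_sum_bounds:
  assumes s0: "s0 \<in> states" "fst s0 = x0 + step (snd s0)" and x0: "x0 \<in> B"
  shows "u \<in> space forward_env \<Longrightarrow> 0 \<le> forward_return s0 N u \<and> forward_return s0 N u \<le> 1"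
    and "w \<in> space backward_env \<Longrightarrow> 0 \<le> backward_return s0 N w \<and> backward_return s0 N w \<le> 1 - escape (snd s0) w"
proof -
  show "0 \<le> forward_return s0 N u \<and> forward_return s0 N u \<le> 1"
    if u: "u \<in> space forward_env"
  proof
    show "0 \<le> forward_return s0 N u"
      unfolding excursion_sum_def by (intro sum_nonneg excursion_weight_nonneg forward_kernel_nonneg u)
    have "forward_return s0 N u \<le> (\<Sum>s'\<in>states. forward_kernel u s0 s')"
      unfolding excursion_sum_def
      by (intro excursion_sum_le_row_sum finite_states s0 forward_kernel_nonneg forward_kernel_row_sum u)
    also have "\<dots> \<le> 1" by (intro forward_kernel_row_sum u s0)
    finally show "forward_return s0 N u \<le> 1" .
  qed
  show "0 \<le> backward_return s0 N w \<and> backward_return s0 N w \<le> 1 - escape (snd s0) w"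
    if w: "w \<in> space backward_env"
  proof
    show "0 \<le> backward_return s0 N w"
      unfolding excursion_sum_def by (intro sum_nonneg excursion_weight_nonneg backward_kernel_nonneg w)
    have "backward_return s0 N w = (\<Sum>n<N. excursion_weight (\<lambda>a b. backward_kernel w b a) states s0 n s0)"
      unfolding excursion_sum_def by (subst excursion_weight_rev) simp
    also have "\<dots> \<le> (\<Sum>s\<in>states. backward_kernel w s s0)"
      by (intro excursion_sum_le_row_sum finite_states s0 backward_kernel_nonneg backward_kernel_column_sum w)
    also have "\<dots> \<le> 1 - escape (snd s0) w"
      by (intro backward_kernel_column_sum w s0 x0)
    finally show "backward_return s0 N w \<le> 1 - escape (snd s0) w" .
  qed
qed

text \<open>The return weight of the reversed walk is at most \<open>1 - Y\<close>, where \<open>Y\<close> is its probability to leave through the entrance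
slot in the very first step. The bound depends on the site \<open>x0\<close> only, not on the box.\<close>

lemma nn_integral_discounted_return:
  assumes s0: "s0 \<in> states" "fst s0 = x0 + step (snd s0)" and x0: "x0 \<in> B"
    and \<rho>: "0 \<le> \<rho>" "\<rho> < 1" and r: "r > 0"
  shows "(\<integral>\<^sup>+u. ennreal ((1 - \<rho> * forward_return s0 N u) powr (- r)) \<partial>forward_env) \<le>
    (\<integral>\<^sup>+w. ennreal (site_prob (n + 1) (\<lambda>j i. Z i j) w (snd s0) (n + 1) powr (- r)) \<partial>backward_law x0)"
proof -
  interpret Bk: product_prob_space backward_law B
    by (intro product_prob_spaceI prob_space_backward)
  have j: "snd s0 \<in> {1..n}" using s0 by (auto simp: states_def)
  have b1: "0 \<le> backward_return s0 N w \<and> backward_return s0 N w \<le> 1"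
    if "w \<in> space backward_env" for w
    using excursion_sum_bounds(2)[OF s0 x0 that, of N] escape_pos[OF that x0 j] by linarith
  have "(\<integral>\<^sup>+u. ennreal ((1 - \<rho> * forward_return s0 N u) powr (- r)) \<partial>forward_env) =
     (\<Sum>k. ennreal (pochhammer r k / fact k * \<rho> ^ k) * (\<integral>\<^sup>+u. ennreal (forward_return s0 N u ^ k) \<partial>forward_env))"
    by (intro nn_integral_negative_binomial excursion_sum_measurable kernel_measurable \<rho> r excursion_sum_bounds(1) s0 x0)
  also have "\<dots> = (\<Sum>k. ennreal (pochhammer r k / fact k * \<rho> ^ k) * (\<integral>\<^sup>+w. ennreal (backward_return s0 N w ^ k) \<partial>backward_env))"
    by (simp only: nn_integral_excursion_sum_power[OF s0(1)])
  also have "\<dots> = (\<integral>\<^sup>+w. ennreal ((1 - \<rho> * backward_return s0 N w) powr (- r)) \<partial>backward_env)"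
    by (intro nn_integral_negative_binomial[symmetric] excursion_sum_measurable kernel_measurable \<rho> r b1)
  also have "\<dots> \<le> (\<integral>\<^sup>+w. ennreal (escape (snd s0) w powr (- r)) \<partial>backward_env)"
  proof (intro nn_integral_mono ennreal_leI powr_mono2')
    fix w assume w: "w \<in> space backward_env"
    show "escape (snd s0) w > 0" by (rule escape_pos[OF w x0 j])
    have "\<rho> * backward_return s0 N w \<le> backward_return s0 N w"
      using b1[OF w] \<rho> by (intro mult_left_le_one_le) auto
    then show "escape (snd s0) w \<le> 1 - \<rho> * backward_return s0 N w"
      using excursion_sum_bounds(2)[OF s0 x0 w, of N] by linarith
  qed (use r in auto)
  also have "\<dots> = (\<integral>\<^sup>+w. ennreal (site_prob (n + 1) (\<lambda>j i. Z i j) w (snd s0) (n + 1) powr (- r)) \<partial>backward_law x0)"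
  proof -
    have d: "distr backward_env (backward_law x0) (\<lambda>w. w x0) = backward_law x0"
      by (rule Bk.PiM_component[OF x0])
    have "n + 1 \<in> {1..n+1}" by simp
    then have [measurable]: "(\<lambda>w. site_prob (n + 1) (\<lambda>j i. Z i j) w (snd s0) (n + 1)) \<in> borel_measurable (backward_law x0)"
      unfolding measurable_backward by (simp add: in_dim_def site_prob_measurable)
    let ?g = "\<lambda>w. ennreal (site_prob (n + 1) (\<lambda>j i. Z i j) w (snd s0) (n + 1) powr (- r))"
    have "(\<integral>\<^sup>+w. ?g w \<partial>distr backward_env (backward_law x0) (\<lambda>w. w x0)) = (\<integral>\<^sup>+w. ?g (w x0) \<partial>backward_env)"
      by (rule nn_integral_distr) (use x0 in measurable)
    then show ?thesis by (simp add: d escape_def)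
  qed
  finally show ?thesis .
qed

end

section \<open>A square-summable flow on the lattice\<close>

text \<open>The flow is that of Polya's urn with three colours. Starting with one ball of each colour, the urn after \<open>n\<close> draws is uniformly
distributed on the \<open>(n + 1) * (n + 2) / 2\<close> possible compositions, so that the flow through a site at level \<open>n\<close> is
\<open>2 / ((n + 1) * (n + 2))\<close>. Three dimensions are needed for its squares to be summable.\<close>

definition octant :: "site set" where
  "octant = {z. z 1 \<ge> 0 \<and> z 2 \<ge> 0 \<and> z 3 \<ge> 0 \<and> (\<forall>k. k \<notin> {1, 2, 3} \<longrightarrow> z k = 0)}"

definition level :: "site \<Rightarrow> real" where
  "level z = of_int (z 1 + z 2 + z 3)"

definition urn_mass :: "site \<Rightarrow> real" where
  "urn_mass z = (if z \<in> octant then 2 / ((level z + 1) * (level z + 2)) else 0)"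

definition urn_flow :: "site \<Rightarrow> nat \<Rightarrow> real" where
  "urn_flow z j = (if j \<in> {1, 2, 3} then urn_mass z * (of_int (z j) + 1) / (level z + 3) else 0)"

lemma level_nonneg: "z \<in> octant \<Longrightarrow> level z \<ge> 0"
  by (auto simp: octant_def level_def)

lemma urn_mass_nonneg: "urn_mass z \<ge> 0" and urn_mass_le_1: "urn_mass z \<le> 1"
proof -
  show "urn_mass z \<ge> 0" using level_nonneg[of z] by (auto simp: urn_mass_def)
  have "2 \<le> (level z + 1) * (level z + 2)" if "z \<in> octant"
    using mult_mono[of 1 "level z + 1" 2 "level z + 2"] level_nonneg[OF that] by simp
  then show "urn_mass z \<le> 1" by (auto simp: urn_mass_def divide_le_eq_1)
qed

lemma urn_flow_nonneg: "urn_flow z j \<ge> 0"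
proof (cases "z \<in> octant")
  case True
  then have "j \<in> {1, 2, 3} \<Longrightarrow> z j \<ge> 0" by (auto simp: octant_def)
  then show ?thesis using level_nonneg[OF True] urn_mass_nonneg[of z] by (auto simp: urn_flow_def intro!: divide_nonneg_nonneg mult_nonneg_nonneg)
qed (simp add: urn_flow_def urn_mass_def)

lemma sum_directions:
  fixes d :: nat
  assumes "d \<ge> 3" "\<And>j. j \<notin> {1, 2, 3} \<Longrightarrow> f j = (0::real)"
  shows "(\<Sum>j=1..2*d. f j) = f 1 + f 2 + f 3"
proof -
  have "(\<Sum>j=1..2*d. f j) = (\<Sum>j\<in>{1, 2, 3}. f j)"
    using assms by (intro sum.mono_neutral_right) auto
  then show ?thesis by simp
qed

lemma urn_flow_out:
  assumes "d \<ge> 3"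
  shows "(\<Sum>j=1..2*d. urn_flow z j) = urn_mass z"
proof (cases "z \<in> octant")
  case True
  have "(\<Sum>j=1..2*d. urn_flow z j) = urn_flow z 1 + urn_flow z 2 + urn_flow z 3"
    using assms by (intro sum_directions) (auto simp: urn_flow_def)
  also have "\<dots> = urn_mass z * (level z + 3) / (level z + 3)"
    by (simp add: urn_flow_def add_divide_distrib[symmetric] level_def algebra_simps)
  finally show ?thesis using level_nonneg[OF True] by simp
next
  case False
  then have "urn_mass z = 0" by (simp add: urn_mass_def)
  then show ?thesis by (simp add: urn_flow_def cong: if_cong)
qed

lemma urn_flow_le_1: "urn_flow z j \<le> 1"
proof (cases "j \<in> {1, 2, 3}")
  case True
  then have "urn_flow z j \<le> (\<Sum>j=1..2*3. urn_flow z j)"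
    by (intro member_le_sum) (auto simp: urn_flow_nonneg)
  also have "\<dots> \<le> 1" using urn_flow_out[of 3 z] urn_mass_le_1[of z] by simp
  finally show ?thesis .
qed (simp add: urn_flow_def)

text \<open>Conservation of mass: at level \<open>n \<ge> 1\<close> the three incoming flows are proportional to the coordinates of \<open>z\<close>, which
sum to \<open>n\<close>. The origin is the only source.\<close>

lemma urn_flow_in:
  assumes "d \<ge> 3"
  shows "(\<Sum>i=1..2*d. urn_flow (z - unit_step d i) i) = urn_mass z - of_bool (z = 0)"
proof -
  have us: "unit_step d i = (\<lambda>k. of_bool (k = i))" if "i \<in> {1, 2, 3}" for i
    using assms that by (auto simp: unit_step_def)
  have flow_at: "urn_flow (z - unit_step d i) i =
      (if z \<in> octant \<and> z i \<ge> 1 then 2 / (level z * (level z + 1)) * of_int (z i) / (level z + 2) else 0)"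
    if i: "i \<in> {1, 2, 3}" for i
  proof -
    have oct: "z - unit_step d i \<in> octant \<longleftrightarrow> z \<in> octant \<and> z i \<ge> 1"
      using i unfolding us[OF i] octant_def by auto
    have lev: "level (z - unit_step d i) = level z - 1"
      using i unfolding us[OF i] level_def by auto
    show ?thesis
      using i unfolding urn_flow_def urn_mass_def oct lev by (auto simp: us[OF i] add.commute)
  qed
  have "(\<Sum>i=1..2*d. urn_flow (z - unit_step d i) i) =
     urn_flow (z - unit_step d 1) 1 + urn_flow (z - unit_step d 2) 2 + urn_flow (z - unit_step d 3) 3"
    using assms by (intro sum_directions) (auto simp: urn_flow_def)
  also have "\<dots> = urn_mass z - of_bool (z = 0)"
  proof (cases "z \<in> octant")
    case True
    then have zpos: "z 1 \<ge> 0" "z 2 \<ge> 0" "z 3 \<ge> 0" by (auto simp: octant_def)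
    define c where "c = 2 / (level z * (level z + 1)) / (level z + 2)"
    have t: "urn_flow (z - unit_step d i) i = c * of_int (z i)" if "i \<in> {1, 2, 3}" for i
    proof -
      have "z i = 0" if "\<not> z i \<ge> 1" using that \<open>i \<in> {1, 2, 3}\<close> zpos by auto
      then show ?thesis using True by (auto simp: flow_at[OF \<open>i \<in> {1, 2, 3}\<close>] c_def)
    qed
    have "urn_flow (z - unit_step d 1) 1 + urn_flow (z - unit_step d 2) 2 + urn_flow (z - unit_step d 3) 3 = c * level z"
      by (simp add: t level_def algebra_simps)
    also have "\<dots> = urn_mass z - of_bool (z = 0)"
    proof (cases "z = 0")
      case True
      then show ?thesis by (simp add: urn_mass_def octant_def level_def)
    next
      case False
      then have "z 1 \<noteq> 0 \<or> z 2 \<noteq> 0 \<or> z 3 \<noteq> 0"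
        using \<open>z \<in> octant\<close> by (auto simp: octant_def fun_eq_iff) metis
      then have "level z > 0" using zpos by (auto simp: level_def)
      then have "c * level z = 2 / ((level z + 1) * (level z + 2))" unfolding c_def by simp
      then show ?thesis using False True by (simp add: urn_mass_def)
    qed
    finally show ?thesis .
  next
    case False
    moreover have "z \<noteq> 0" using False by (auto simp: octant_def)
    ultimately show ?thesis by (simp add: flow_at urn_mass_def)
  qed
  finally show ?thesis .
qed

text \<open>With \<open>L = a + b + c + 1\<close>, the square of the mass in \<open>(a, b, c)\<close> is at most \<open>4 / L ^ 4\<close>. Distributing the exponent as
\<open>4 = 4/3 + 4/3 + 4/3\<close> bounds the sum by the cube of a convergent series.\<close>

lemma urn_mass_square_summable: "\<exists>C\<ge>0. \<forall>B. finite B \<longrightarrow> (\<Sum>z\<in>B. (urn_mass z)\<^sup>2) \<le> C"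
proof -
  define g where "g a = (real a + 1) powr (- 4 / 3)" for a :: nat
  have "summable (\<lambda>a. real a powr (- 4 / 3))" by (simp add: summable_real_powr_iff)
  then have "summable (\<lambda>a. real (a + 1) powr (- 4 / 3))" by (subst summable_iff_shift[where k = 1])
  then have sg: "summable g" by (simp add: g_def[abs_def] add.commute)
  have g0: "g a \<ge> 0" for a by (simp add: g_def)
  define S where "S = suminf g"
  have S: "S \<ge> 0" unfolding S_def by (intro suminf_nonneg sg g0)
  have "(\<Sum>z\<in>B. (urn_mass z)\<^sup>2) \<le> 4 * S ^ 3" if "finite B" for B
  proof -
    define B' where "B' = B \<inter> octant"
    define h where "h z = (nat (z 1), nat (z 2), nat (z 3))" for z :: site
    have inj: "inj_on h B'"
    proof (rule inj_onI)
      fix x y assume xy: "x \<in> B'" "y \<in> B'" "h x = h y"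
      show "x = y"
      proof
        fix k
        show "x k = y k"
          using xy by (cases "k \<in> {1, 2, 3}") (auto simp: B'_def octant_def h_def)
      qed
    qed
    have bound: "(urn_mass z)\<^sup>2 \<le> 4 * (case h z of (a, b, c) \<Rightarrow> g a * g b * g c)" if z: "z \<in> B'" for z
    proof -
      define L where "L = level z + 1"
      have oct: "z \<in> octant" using z by (simp add: B'_def)
      have L1: "L \<ge> 1" using level_nonneg[OF oct] by (simp add: L_def)
      have gL: "L powr (- 4 / 3) \<le> g (nat (z k))" if "k \<in> {1, 2, 3}" for k
        unfolding g_def using that oct by (intro powr_mono2') (auto simp: octant_def L_def level_def)
      have "(urn_mass z)\<^sup>2 = 4 * (1 / (L * (L + 1)))\<^sup>2"
        using oct by (simp add: urn_mass_def L_def power_divide add.assoc)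
      also have "\<dots> \<le> 4 * (1 / (L * L))\<^sup>2"
        using L1 by (intro mult_left_mono power_mono divide_left_mono mult_left_mono) auto
      also have "(1 / (L * L))\<^sup>2 = L powr (- 4)"
        using L1 by (simp add: powr_minus powr_numeral power_divide power2_eq_square power4_eq_xxxx field_simps)
      also have "L powr (- 4) = L powr (- 4 / 3) * L powr (- 4 / 3) * L powr (- 4 / 3)"
        by (simp add: powr_add[symmetric])
      also have "\<dots> \<le> g (nat (z 1)) * g (nat (z 2)) * g (nat (z 3))"
        by (intro mult_mono gL mult_nonneg_nonneg g0) auto
      finally show ?thesis by (simp add: h_def)
    qed
    define M where "M = Max (insert 0 ((\<lambda>(a, b, c). a + b + c) ` h ` B'))"
    have fin: "finite B'" using that by (simp add: B'_def)
    have sub: "h ` B' \<subseteq> {..M} \<times> {..M} \<times> {..M}"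
    proof
      fix p assume p: "p \<in> h ` B'"
      obtain a b c where abc: "p = (a, b, c)" by (cases p)
      have "a + b + c \<le> M" unfolding M_def
        using fin imageI[OF p, of "\<lambda>(a, b, c). a + b + c"] by (intro Max_ge) (auto simp: abc)
      then show "p \<in> {..M} \<times> {..M} \<times> {..M}" by (simp add: abc)
    qed
    have "(\<Sum>z\<in>B. (urn_mass z)\<^sup>2) = (\<Sum>z\<in>B'. (urn_mass z)\<^sup>2)"
      using that by (intro sum.mono_neutral_right) (auto simp: B'_def urn_mass_def)
    also have "\<dots> \<le> (\<Sum>z\<in>B'. 4 * (case h z of (a, b, c) \<Rightarrow> g a * g b * g c))"
      by (intro sum_mono bound)
    also have "\<dots> = (\<Sum>p\<in>h ` B'. 4 * (case p of (a, b, c) \<Rightarrow> g a * g b * g c))"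
      by (simp add: sum.reindex[OF inj])
    also have "\<dots> \<le> (\<Sum>p\<in>{..M} \<times> {..M} \<times> {..M}. 4 * (case p of (a, b, c) \<Rightarrow> g a * g b * g c))"
      by (intro sum_mono2 sub) (auto intro!: mult_nonneg_nonneg g0)
    also have "\<dots> = 4 * ((\<Sum>a\<le>M. g a) * ((\<Sum>b\<le>M. g b) * (\<Sum>c\<le>M. g c)))"
      by (simp add: sum.cartesian_product' sum_distrib_left[symmetric] sum_distrib_right[symmetric] mult.assoc)
    also have "\<dots> \<le> 4 * (S * (S * S))"
      unfolding S_def using sg g0 S by (intro mult_left_mono mult_mono sum_le_suminf) (auto intro!: sum_nonneg mult_nonneg_nonneg simp: S_def)
    finally show ?thesis by (simp add: power3_eq_cube mult.assoc)
  qed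
  then show ?thesis using S by (intro exI[of _ "4 * S ^ 3"]) auto
qed

section \<open>A moment bound uniform in the box\<close>

lemma hyp_law_cong:
  assumes "\<And>u. u \<in> open_simplex n \<Longrightarrow> hyp_weight m n a b Z u = hyp_weight m' n a' b' Z' u"
  shows "hyp_law m n a b Z = hyp_law m' n a' b' Z'"
proof -
  have mass: "hyp_mass m n a b Z = hyp_mass m' n a' b' Z'"
    unfolding hyp_mass_def by (intro nn_integral_cong) (simp add: assms)
  show ?thesis
    unfolding hyp_law_def mass by (intro density_cong AE_I2) (simp_all add: assms, measurable)
qed

text \<open>A row of ones gives the linear form \<open>\<Sum>l. u l = 1\<close>. So an incoming slot with this row can be added at any site, with
any exponent, without changing the law of the weights.\<close>

lemma hyp_weight_unit_row:
  assumes u: "u \<in> open_simplex n" and Z: "\<forall>j\<in>{1..n}. Z (m + 1) j = 1"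
  shows "hyp_weight (m + 1) n a b Z u = hyp_weight m n a b Z u"
proof -
  have "{1..m + 1} = insert (m + 1) {1..m}" by auto
  moreover have "(\<Sum>l=1..n. Z (m + 1) l * u l) = 1" using open_simplexD(3)[OF u] Z by simp
  ultimately show ?thesis by (simp add: hyp_weight_def)
qed

text \<open>The escape probability is at least a constant times the coordinate \<open>w (n + 1)\<close>, whose exponent under the backward law is \<open>\<gamma>\<close>.\<close>

lemma (in tilted_box) escape_moment_finite:
  assumes j: "j \<in> {1..n}" and r: "0 < r" "r < \<gamma>"
  shows "(\<integral>\<^sup>+w. ennreal (site_prob (n + 1) (\<lambda>j i. Z i j) w j (n + 1) powr (- r)) \<partial>backward_law x0) < \<infinity>"
proof -
  define z where "z = (\<Sum>l=1..n+1. Z l j)"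
  define \<zeta> where "\<zeta> = Z (n + 1) j"
  have \<zeta>: "\<zeta> > 0" using Z j by (auto simp: \<zeta>_def)
  have Zj: "\<forall>l\<in>{1..n+1}. Z l j > 0" using Z j by auto
  have z: "z \<ge> 0" unfolding z_def using Zj by (intro sum_nonneg) (auto intro: less_imp_le)
  define \<beta> where "\<beta> i = (if i = n + 1 then r else 0)" for i
  have "(\<integral>\<^sup>+w. ennreal (site_prob (n + 1) (\<lambda>j i. Z i j) w j (n + 1) powr (- r))
      \<partial>hyp_law n (n + 1) (in_weight x0) (out_weight x0) (\<lambda>j i. Z i j)) < \<infinity>"
  proof (rule hyp_law_moment_finite[where \<beta> = \<beta> and c = "(\<zeta> / z) powr (- r)"])
    show "\<forall>j\<in>{1..n}. \<forall>i\<in>{1..n + 1}. 0 < Z i j" using Z by auto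
    show "\<forall>i\<in>{1..n + 1}. 0 < in_weight x0 i - \<beta> i"
      using r A by (auto simp: \<beta>_def in_weight_def)
    show "\<forall>i\<in>{1..n + 1}. 0 < in_weight x0 i" by (rule weights_pos)
    have "n + 1 \<in> {1..n+1}" by simp
    from site_prob_measurable[OF this]
    show "(\<lambda>w. site_prob (n + 1) (\<lambda>j i. Z i j) w j (n + 1) powr (- r)) \<in> borel_measurable (simplex_measure (n + 1))"
      by measurable
    fix w assume w: "w \<in> open_simplex (n + 1)"
    have lp: "(\<Sum>l=1..n+1. Z l j * w l) > 0"
      using linear_form_pos[where Z = "\<lambda>j i. Z i j" and i = j, OF _ Zj w] by simp
    have lz: "(\<Sum>l=1..n+1. Z l j * w l) \<le> z"
      unfolding z_def using Zj open_simplexD(1,2)[OF w] by (intro sum_mono) (auto simp: mult_left_le less_imp_le)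
    have wn: "w (n + 1) > 0" using open_simplexD(1)[OF w] by simp
    have "(\<zeta> / z) * w (n + 1) \<le> site_prob (n + 1) (\<lambda>j i. Z i j) w j (n + 1)"
      unfolding site_prob_def using lp lz \<zeta> wn by (auto simp: \<zeta>_def[symmetric] intro!: divide_left_mono mult_pos_pos)
    moreover have "(\<zeta> / z) * w (n + 1) > 0" using \<zeta> wn lp lz by (intro mult_pos_pos divide_pos_pos) auto
    ultimately have "site_prob (n + 1) (\<lambda>j i. Z i j) w j (n + 1) powr (- r) \<le> ((\<zeta> / z) * w (n + 1)) powr (- r)"
      using r by (intro powr_mono2') auto
    also have "\<dots> = (\<zeta> / z) powr (- r) * w (n + 1) powr (- r)"
      by (rule powr_mult)
    also have "w (n + 1) powr (- r) = (\<Prod>i=1..n + 1. w i powr (- \<beta> i))"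
    proof -
      have "(\<Prod>i=1..n + 1. w i powr (- \<beta> i)) = (\<Prod>i=1..n + 1. if i = n + 1 then w i powr (- r) else 1)"
        using open_simplexD(1)[OF w] by (intro prod.cong) (force simp: \<beta>_def)+
      then show ?thesis by (simp add: prod.delta)
    qed
    finally show "site_prob (n + 1) (\<lambda>j i. Z i j) w j (n + 1) powr (- r) \<le> (\<zeta> / z) powr (- r) * (\<Prod>i=1..n + 1. w i powr (- \<beta> i))" .
  qed auto
  then show ?thesis by (simp add: backward_law_def in_dim_def)
qed

lemma PiM_density:
  fixes M :: "'i \<Rightarrow> 'a measure"
  assumes "finite I" "\<And>i. prob_space (M i)" and f: "\<And>i. f i \<in> borel_measurable (M i)"
    and "\<And>i. prob_space (density (M i) (f i))"
  shows "PiM I (\<lambda>i. density (M i) (f i)) = density (PiM I M) (\<lambda>x. \<Prod>i\<in>I. f i (x i))"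
proof -
  interpret P: product_prob_space M by (intro product_prob_spaceI assms)
  interpret D: product_prob_space "\<lambda>i. density (M i) (f i)" by (intro product_prob_spaceI assms)
  have fm: "(\<lambda>x. \<Prod>i\<in>I. f i (x i)) \<in> borel_measurable (PiM I M)"
  proof (rule borel_measurable_prod_ennreal)
    fix i assume "i \<in> I"
    from measurable_compose[OF measurable_component_singleton[OF this, of M] f[of i]]
    show "(\<lambda>x. f i (x i)) \<in> borel_measurable (PiM I M)" .
  qed
  show ?thesis
  proof (rule D.PiM_eqI[symmetric, OF assms(1)])
    show "sets (density (PiM I M) (\<lambda>x. \<Prod>i\<in>I. f i (x i))) = sets (PiM I (\<lambda>i. density (M i) (f i)))"
      unfolding sets_density by (intro sets_PiM_cong) auto
    fix A assume A: "\<And>i. i \<in> I \<Longrightarrow> A i \<in> sets (density (M i) (f i))"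
    have "emeasure (density (PiM I M) (\<lambda>x. \<Prod>i\<in>I. f i (x i))) (Pi\<^sub>E I A) =
        (\<integral>\<^sup>+x. (\<Prod>i\<in>I. f i (x i)) * indicator (Pi\<^sub>E I A) x \<partial>PiM I M)"
      using A assms(1) by (intro emeasure_density fm sets_PiM_I_finite) auto
    also have "\<dots> = (\<integral>\<^sup>+x. (\<Prod>i\<in>I. f i (x i) * indicator (A i) (x i)) \<partial>PiM I M)"
    proof (rule nn_integral_cong)
      fix x assume x: "x \<in> space (PiM I M)"
      have "indicator (Pi\<^sub>E I A) x = (\<Prod>i\<in>I. indicator (A i) (x i) :: ennreal)"
        using x assms(1) by (auto simp: indicator_def space_PiM PiE_iff prod_zero_iff)
      then show "(\<Prod>i\<in>I. f i (x i)) * indicator (Pi\<^sub>E I A) x = (\<Prod>i\<in>I. f i (x i) * indicator (A i) (x i))"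
        by (simp add: prod.distrib)
    qed
    also have "\<dots> = (\<Prod>i\<in>I. \<integral>\<^sup>+x. f i x * indicator (A i) x \<partial>M i)"
      using A by (intro P.product_nn_integral_prod assms(1)) (auto intro!: borel_measurable_times_ennreal f)
    also have "\<dots> = (\<Prod>i\<in>I. emeasure (density (M i) (f i)) (A i))"
      using A by (intro prod.cong refl emeasure_density[symmetric] f) auto
    finally show "emeasure (density (PiM I M) (\<lambda>x. \<Prod>i\<in>I. f i (x i))) (Pi\<^sub>E I A) =
      (\<Prod>i\<in>I. emeasure (density (M i) (f i)) (A i))" .
  qed
qed

text \<open>Young's inequality applied to the factors \<open>F * D powr (1 / q)\<close> and \<open>D powr (- (1 / q))\<close>. With \<open>D\<close> a density, the
moment of \<open>F\<close> under the original law is bounded by a higher moment under the tilted law and a negative moment of \<open>D\<close>.\<close>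

lemma young_tilt:
  fixes F D p q :: real
  assumes "F \<ge> 0" "D > 0" "p > 1" "q > 1" "1 / p + 1 / q = 1"
  shows "F \<le> F powr q * D / q + D powr (- (p - 1)) / p"
proof -
  have pq: "p / q = p - 1" using assms(3-5) by (simp add: field_simps)
  have "(F * D powr (1 / q)) * D powr (- (1 / q)) \<le>
      (F * D powr (1 / q)) powr q / q + (D powr (- (1 / q))) powr p / p"
    using assms by (intro Youngs_inequality) auto
  moreover have "(F * D powr (1 / q)) * D powr (- (1 / q)) = F"
    using assms(2) by (simp add: mult.assoc powr_add[symmetric])
  moreover have "(F * D powr (1 / q)) powr q = F powr q * D"
    using assms by (simp add: powr_mult powr_powr)
  moreover have "(D powr (- (1 / q))) powr p = D powr (- (p - 1))"
    by (simp add: powr_powr pq)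
  ultimately show ?thesis by simp
qed

lemma ennreal_combination:
  fixes a b c k e :: real
  assumes "0 \<le> a" "0 \<le> b" "0 \<le> c" "0 \<le> k" "0 \<le> e"
  shows "ennreal (a * (b * c) + k * e) = ennreal a * (ennreal b * ennreal c) + ennreal k * ennreal e"
  using assms by (simp add: ennreal_mult' ennreal_plus)

lemma hyp_weight_pos:
  assumes "n \<ge> 1" and Z: "positive_matrix m n Z" and u: "u \<in> open_simplex n"
  shows "hyp_weight m n a b Z u > 0"
proof -
  have "(\<Sum>l=1..n. Z i l * u l) > 0" if "i \<in> {1..m}" for i
    using Z that by (intro linear_form_pos[OF assms(1) _ u]) auto
  moreover have "u j \<noteq> 0" if "j \<in> {1..n}" for j using open_simplexD(1)[OF u that] by simp
  ultimately show ?thesis unfolding hyp_weight_def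
    by (intro mult_pos_pos prod_pos) (force simp: powr_gt_zero)+
qed

abbreviation box_kernel :: "nat \<Rightarrow> (nat \<Rightarrow> nat \<Rightarrow> real) \<Rightarrow> site set \<Rightarrow> (site \<Rightarrow> nat \<Rightarrow> real) \<Rightarrow> site \<times> nat \<Rightarrow> site \<times> nat \<Rightarrow> real" where
  "box_kernel d Z B u \<equiv> site_kernel (2*d) (unit_step d) Z B u"

text \<open>The exponents \<open>\<alpha>\<close> balance at every site, since in-edges and out-edges carry the same exponents. Adding
\<open>\<gamma>\<close> times the urn flow started in \<open>x0\<close>, the tail of the starting edge, produces a \<^locale>\<open>tilted_box\<close>. Its return
weight has a finite moment of every order below \<open>\<gamma>\<close>. The cost of going back to the original law is
controlled site by site by the squares of the flow.\<close>

lemma discounted_return_moment: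
  fixes d :: nat and \<alpha> :: "nat \<Rightarrow> real" and Z :: "nat \<Rightarrow> nat \<Rightarrow> real"
  assumes d: "d \<ge> 3" and \<alpha>: "\<forall>i\<in>{1..2*d}. \<alpha> i > 0"
    and Z: "positive_matrix (2*d) (2*d) Z"
    and s: "0 < s" "s < Min (\<alpha> ` {1..2*d})" and j0: "j0 \<in> {1..2*d}"
  shows "\<exists>C::real. \<forall>B \<rho> N. finite B \<longrightarrow> x0 \<in> B \<longrightarrow> x0 + unit_step d j0 \<in> B \<longrightarrow> 0 \<le> \<rho> \<longrightarrow> \<rho> < 1 \<longrightarrow>
    (\<integral>\<^sup>+u. ennreal ((1 - \<rho> * excursion_sum (box_kernel d Z B u) (B \<times> {1..2*d}) (x0 + unit_step d j0, j0) N) powr (- s))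
       \<partial>PiM B (\<lambda>_. hyp_law (2*d) (2*d) \<alpha> \<alpha> Z)) \<le> ennreal C"
proof -
  define n where "n = 2 * d"
  have n: "n \<ge> 1" using d by (simp add: n_def)
  note \<alpha>' = \<alpha>[folded n_def] and Z' = Z[folded n_def] and j0' = j0[folded n_def]
  define \<kappa> where "\<kappa> = Min (\<alpha> ` {1..n})"
  have \<kappa>: "s < \<kappa>" "\<And>j. j \<in> {1..n} \<Longrightarrow> \<kappa> \<le> \<alpha> j" using s(2) by (auto simp: \<kappa>_def n_def)
  \<comment> \<open>With \<open>\<tau> = p - 1\<close> and \<open>q\<close> conjugate to \<open>p\<close>, two conditions have to hold: \<open>s * q < \<gamma>\<close> for the tilted moment, and \<open>\<tau> * \<gamma> < \<kappa>\<close> for the tilt itself. For \<open>\<gamma> = s' * q\<close> they read \<open>s < s'\<close> and \<open>s' * p < \<kappa>\<close>, so that every \<open>s < \<kappa>\<close> can be reached with \<open>p\<close> close to \<open>1\<close>.\<close>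
  define s' where "s' = (s + \<kappa>) / 2"
  have s': "s < s'" "s' < \<kappa>" "s' > 0" using s(1) \<kappa>(1) by (auto simp: s'_def)
  define p where "p = (1 + \<kappa> / s') / 2"
  have p1: "p > 1" using s' by (simp add: p_def)
  have sp: "s' * p < \<kappa>" using s' by (simp add: p_def field_simps)
  define \<tau> where "\<tau> = p - 1"
  define q where "q = p / \<tau>"
  have \<tau>: "\<tau> > 0" using p1 by (simp add: \<tau>_def)
  have q1: "q > 1" using p1 by (simp add: q_def \<tau>_def)
  have pq: "1 / p + 1 / q = 1" using p1 \<tau> by (simp add: q_def \<tau>_def field_simps)
  define \<gamma> where "\<gamma> = s' * q"
  have \<gamma>: "\<gamma> > 0" using s' q1 by (simp add: \<gamma>_def)
  have \<tau>\<gamma>: "\<tau> * \<gamma> = s' * p" using \<tau> by (simp add: \<gamma>_def q_def)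
  define r where "r = s * q"
  have r: "0 < r" "r < \<gamma>" using s s' q1 by (auto simp: r_def \<gamma>_def)
  define st where "st y j = \<gamma> * urn_flow (y - x0) j" for y :: site and j
  define tt where "tt y i = \<gamma> * urn_flow (y - x0 - unit_step d i) i" for y :: site and i
  have st: "0 \<le> st y j" "st y j \<le> \<gamma>" and tt: "0 \<le> tt y j" "tt y j \<le> \<gamma>" for y j
    using \<gamma> urn_flow_nonneg urn_flow_le_1 by (auto simp: st_def tt_def mult_left_le)
  \<comment> \<open>The value \<open>1\<close> outside the range of directions only keeps all weights positive.\<close>
  define A :: "site \<times> nat \<Rightarrow> real" where "A e = (if snd e \<in> {1..n} then \<alpha> (snd e) + tt (fst e) (snd e) else 1)" for e
  define Zx where "Zx i j = (if i = n + 1 then 1 else Z i j)" for i j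
  have Zx: "Zx i j = Z i j" if "i \<in> {1..n}" for i j using that by (simp add: Zx_def)
  have A_pos: "A e > 0" for e using \<alpha>' tt by (auto simp: A_def intro!: add_pos_nonneg)
  have Zx_pos: "positive_matrix (n + 1) n Zx" using Z' by (auto simp: Zx_def)
  have A_out: "A (y + unit_step d j, j) = \<alpha> j + st y j" if "j \<in> {1..n}" for y j
    using that by (simp add: A_def st_def tt_def algebra_simps)
  have A_in: "A (y, i) = \<alpha> i + tt y i" if "i \<in> {1..n}" for y i
    using that by (simp add: A_def)
  have sum_st: "(\<Sum>j=1..n. st y j) = \<gamma> * urn_mass (y - x0)" for y
    using urn_flow_out[OF d, of "y - x0"] by (simp add: st_def n_def sum_distrib_left[symmetric])
  have sum_tt: "(\<Sum>i=1..n. tt y i) = \<gamma> * (urn_mass (y - x0) - of_bool (y = x0))" for y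
    using urn_flow_in[OF d, of "y - x0"] by (simp add: tt_def n_def sum_distrib_left[symmetric])
  have box: "tilted_box n (unit_step d) B x0 A \<gamma> Zx" if "finite B" for B
  proof
    fix y assume "y \<in> B"
    have "(\<Sum>j=1..n. A (y + unit_step d j, j)) = (\<Sum>j=1..n. \<alpha> j) + \<gamma> * urn_mass (y - x0)"
      by (simp add: A_out sum.distrib sum_st)
    moreover have "(\<Sum>i=1..n. A (y, i)) = (\<Sum>j=1..n. \<alpha> j) + \<gamma> * (urn_mass (y - x0) - of_bool (y = x0))"
      by (simp add: A_in sum.distrib sum_tt)
    ultimately show "(\<Sum>j=1..n. A (y + unit_step d j, j)) = (\<Sum>i=1..n. A (y, i)) + (if y = x0 then \<gamma> else 0)"
      by (cases "y = x0") (simp_all add: algebra_simps)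
  qed (use that n A_pos \<gamma> Zx_pos in auto)
  \<comment> \<open>The laws at the sites do not depend on the box, so the empty box serves to introduce them once.\<close>
  interpret T0: tilted_box n "unit_step d" "{}" x0 A \<gamma> Zx by (rule box) simp
  define K where "K = (\<integral>\<^sup>+w. ennreal (site_prob (n + 1) (\<lambda>j i. Zx i j) w j0 (n + 1) powr (- r)) \<partial>T0.backward_law x0)"
  have K: "K < \<infinity>" unfolding K_def by (rule T0.escape_moment_finite[OF j0' r])
  let ?P = "hyp_law n n \<alpha> \<alpha> Z"
  define D where "D y u = hyp_weight n n (\<lambda>j. st y j + 1) (tt y) Z u *
    (enn2real (hyp_mass n n \<alpha> \<alpha> Z) / enn2real (hyp_mass n n (\<lambda>j. \<alpha> j + st y j) (\<lambda>i. \<alpha> i + tt y i) Z))" for y u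
  have as: "\<forall>j\<in>{1..n}. \<alpha> j + st y j > 0" for y using \<alpha>' st by (auto intro!: add_pos_nonneg)
  have D_law: "T0.forward_law y = density ?P (\<lambda>u. ennreal (D y u))" for y
  proof -
    have "T0.forward_law y = hyp_law n n (\<lambda>j. \<alpha> j + st y j) (\<lambda>i. \<alpha> i + tt y i) Z"
      unfolding T0.forward_law_def
    proof (rule hyp_law_cong)
      fix u assume u: "u \<in> open_simplex n"
      have "hyp_weight (T0.in_dim y) n (T0.out_weight y) (T0.in_weight y) Zx u = hyp_weight n n (T0.out_weight y) (T0.in_weight y) Zx u"
        using hyp_weight_unit_row[OF u, of Zx n] by (auto simp: T0.in_dim_def Zx_def)
      also have "\<dots> = hyp_weight n n (\<lambda>j. \<alpha> j + st y j) (\<lambda>i. \<alpha> i + tt y i) Z u"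
      proof -
        have "T0.out_weight y j = \<alpha> j + st y j" "T0.in_weight y j = \<alpha> j + tt y j" if "j \<in> {1..n}" for j
          using A_out[OF that] A_in[OF that] that by (auto simp: T0.out_weight_def T0.in_weight_def)
        then show ?thesis by (simp add: hyp_weight_def Zx)
      qed
      finally show "hyp_weight (T0.in_dim y) n (T0.out_weight y) (T0.in_weight y) Zx u = hyp_weight n n (\<lambda>j. \<alpha> j + st y j) (\<lambda>i. \<alpha> i + tt y i) Z u" .
    qed
    then show ?thesis unfolding D_def by (simp only: hyp_law_tilt[OF n \<alpha>' as Z'])
  qed
  have P: "prob_space ?P" by (rule prob_space_hyp_law[OF n \<alpha>' Z'])
  have D_pos: "D y u > 0" if "u \<in> open_simplex n" for y u
    unfolding D_def using ennreal_hyp_mass(2)[OF n \<alpha>' Z'] ennreal_hyp_mass(2)[OF n as Z']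
    by (intro mult_pos_pos divide_pos_pos hyp_weight_pos n Z' that)
  have D_meas: "D y \<in> borel_measurable ?P" for y
    unfolding D_def[abs_def] by measurable
  obtain C where C: "C \<ge> 0" "\<And>y. (\<integral>\<^sup>+u. ennreal (D y u powr (- \<tau>)) \<partial>?P) \<le>
      ennreal (exp (C * ((\<Sum>j=1..n. (st y j)\<^sup>2) + (\<Sum>i=1..n. (tt y i)\<^sup>2))))"
  proof -
    have "\<forall>j\<in>{1..n}. \<tau> * \<gamma> < \<alpha> j" using sp \<kappa>(2) by (force simp: \<tau>\<gamma>)
    from tilt_moment_bound[OF n \<alpha>' Z' \<tau> less_imp_le[OF \<gamma>] this, of \<alpha>] obtain C where
      "C \<ge> 0" and C: "\<forall>s t. (\<forall>j\<in>{1..n}. 0 \<le> s j \<and> s j \<le> \<gamma>) \<longrightarrow> (\<forall>i\<in>{1..n}. 0 \<le> t i \<and> t i \<le> \<gamma>) \<longrightarrow>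
        (\<integral>\<^sup>+u. ennreal ((hyp_weight n n (\<lambda>j. s j + 1) t Z u *
          (enn2real (hyp_mass n n \<alpha> \<alpha> Z) / enn2real (hyp_mass n n (\<lambda>j. \<alpha> j + s j) (\<lambda>i. \<alpha> i + t i) Z))) powr (- \<tau>)) \<partial>?P)
        \<le> ennreal (exp (C * ((\<Sum>j=1..n. (s j)\<^sup>2) + (\<Sum>i=1..n. (t i)\<^sup>2))))"
      by (elim exE conjE) (rule that)
    show ?thesis
    proof (rule that[OF \<open>C \<ge> 0\<close>])
      fix y
      show "(\<integral>\<^sup>+u. ennreal (D y u powr (- \<tau>)) \<partial>?P) \<le>
        ennreal (exp (C * ((\<Sum>j=1..n. (st y j)\<^sup>2) + (\<Sum>i=1..n. (tt y i)\<^sup>2))))"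
        unfolding D_def by (rule C[rule_format]) (use st tt in auto)
    qed
  qed
  obtain C0 where C0: "C0 \<ge> 0" "\<And>B. finite B \<Longrightarrow> (\<Sum>z\<in>B. (urn_mass z)\<^sup>2) \<le> C0"
    using urn_mass_square_summable by blast
  define E where "E = exp (C * (2 * \<gamma>\<^sup>2 * C0))"
  have sq: "(\<Sum>j=1..n. (st y j)\<^sup>2) + (\<Sum>i=1..n. (tt y i)\<^sup>2) \<le> 2 * \<gamma>\<^sup>2 * (urn_mass (y - x0))\<^sup>2" for y
  proof -
    have sum_sq: "(\<Sum>j=1..n. (f j)\<^sup>2) \<le> (\<gamma> * urn_mass (y - x0))\<^sup>2"
      if f: "\<And>j. f j \<ge> 0" and le: "(\<Sum>j=1..n. f j) \<le> \<gamma> * urn_mass (y - x0)" for f :: "nat \<Rightarrow> real"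
    proof -
      have "(\<Sum>j=1..n. (f j)\<^sup>2) \<le> (\<Sum>j=1..n. f j * (\<Sum>i=1..n. f i))"
        using f by (intro sum_mono) (auto simp: power2_eq_square intro!: mult_left_mono member_le_sum)
      also have "\<dots> = (\<Sum>j=1..n. f j)\<^sup>2" by (simp add: power2_eq_square sum_distrib_right)
      also have "\<dots> \<le> (\<gamma> * urn_mass (y - x0))\<^sup>2" using le f by (intro power_mono sum_nonneg) auto
      finally show ?thesis .
    qed
    have "(\<Sum>i=1..n. tt y i) \<le> \<gamma> * urn_mass (y - x0)"
      unfolding sum_tt using \<gamma> by (intro mult_left_mono) auto
    with sum_sq[of "st y"] sum_sq[of "tt y"] st tt sum_st show ?thesis by (simp add: power_mult_distrib)
  qed
  have "(\<integral>\<^sup>+u. ennreal ((1 - \<rho> * excursion_sum (box_kernel d Z B u) (B \<times> {1..n}) (x0 + unit_step d j0, j0) N) powr (- s))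
       \<partial>PiM B (\<lambda>_. ?P)) \<le> ennreal (enn2real K / q + E / p)"
    if B: "finite B" "x0 \<in> B" "x0 + unit_step d j0 \<in> B" and \<rho>: "0 \<le> \<rho>" "\<rho> < 1" for B \<rho> N
  proof -
    interpret T: tilted_box n "unit_step d" B x0 A \<gamma> Zx by (rule box[OF B(1)])
    interpret PP: product_prob_space "\<lambda>_::site. ?P" B by (intro product_prob_spaceI P)
    let ?M = "PiM B (\<lambda>_. ?P)"
    define s0 where "s0 = (x0 + unit_step d j0, j0)"
    have s0: "s0 \<in> T.states" "fst s0 = x0 + unit_step d (snd s0)" using B j0' by (auto simp: s0_def T.states_def)
    define R where "R u = excursion_sum (T.forward_kernel u) T.states s0 N" for u
    have kernel: "box_kernel d Z B u = T.forward_kernel u" for u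
      unfolding T.forward_kernel_def T.states_def n_def[symmetric]
      by (auto simp: fun_eq_iff step_kernel_def site_prob_def Zx)
    have F_law: "PiM B T.forward_law = density ?M (\<lambda>u. \<Prod>y\<in>B. ennreal (D y (u y)))"
      unfolding D_law
      by (rule PiM_density[OF B(1)]) (use P D_meas T0.prob_space_forward[unfolded D_law] in auto)
    have space_eq: "space ?M = space (PiM B T.forward_law)"
      by (simp add: space_PiM)
    have sets_eq: "sets ?M = sets (PiM B T.forward_law)" by (simp add: F_law)
    have R_meas: "R \<in> borel_measurable ?M"
      unfolding measurable_cong_sets[OF sets_eq refl] R_def
      by (intro excursion_sum_measurable T.kernel_measurable)
    define DD where "DD u = (\<Prod>y\<in>B. D y (u y))" for u
    have D_comp: "(\<lambda>u. D y (u y)) \<in> borel_measurable ?M" if "y \<in> B" for y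
      using measurable_compose[OF measurable_component_singleton[OF that, of "\<lambda>_. ?P"] D_meas[of y]] .
    have DD_meas: "DD \<in> borel_measurable ?M" unfolding DD_def[abs_def]
      by (intro borel_measurable_prod D_comp)
    have DD_pos: "DD u > 0" if "u \<in> space ?M" for u
      unfolding DD_def using that by (intro prod_pos D_pos) (auto simp: space_PiM PiE_iff)
    have R_bd: "1 - \<rho> * R u > 0" if "u \<in> space ?M" for u
    proof -
      have "0 \<le> R u \<and> R u \<le> 1" unfolding R_def by (rule T.excursion_sum_bounds(1)[OF s0 B(2) that[unfolded space_eq]])
      then have "\<rho> * R u \<le> \<rho>" using \<rho> by (simp add: mult_left_le)
      then show ?thesis using \<rho> by linarith
    qed
    have "(\<integral>\<^sup>+u. ennreal ((1 - \<rho> * R u) powr (- s)) \<partial>?M) \<le>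
      (\<integral>\<^sup>+u. ennreal (1 / q) * (ennreal (DD u) * ennreal ((1 - \<rho> * R u) powr (- r))) + ennreal (1 / p) * ennreal (DD u powr (- \<tau>)) \<partial>?M)"
    proof (rule nn_integral_mono)
      fix u assume u: "u \<in> space ?M"
      have "(1 - \<rho> * R u) powr (- s) \<le> ((1 - \<rho> * R u) powr (- s)) powr q * DD u / q + DD u powr (- (p - 1)) / p"
        by (rule young_tilt) (use DD_pos[OF u] p1 q1 pq in auto)
      also have "((1 - \<rho> * R u) powr (- s)) powr q = (1 - \<rho> * R u) powr (- r)"
        by (simp add: powr_powr r_def)
      finally have "(1 - \<rho> * R u) powr (- s) \<le> 1 / q * (DD u * (1 - \<rho> * R u) powr (- r)) + 1 / p * DD u powr (- \<tau>)"
        by (simp add: \<tau>_def mult_ac)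
      then have "ennreal ((1 - \<rho> * R u) powr (- s)) \<le> ennreal (1 / q * (DD u * (1 - \<rho> * R u) powr (- r)) + 1 / p * DD u powr (- \<tau>))"
        by (rule ennreal_leI)
      also have "\<dots> = ennreal (1 / q) * (ennreal (DD u) * ennreal ((1 - \<rho> * R u) powr (- r))) + ennreal (1 / p) * ennreal (DD u powr (- \<tau>))"
        using p1 q1 DD_pos[OF u] by (intro ennreal_combination) auto
      finally show "ennreal ((1 - \<rho> * R u) powr (- s)) \<le> \<dots>" .
    qed
    also have "\<dots> = ennreal (1 / q) * (\<integral>\<^sup>+u. ennreal (DD u) * ennreal ((1 - \<rho> * R u) powr (- r)) \<partial>?M) +
        ennreal (1 / p) * (\<integral>\<^sup>+u. ennreal (DD u powr (- \<tau>)) \<partial>?M)"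
      using R_meas DD_meas by (subst nn_integral_add) (auto simp: nn_integral_cmult)
    finally have split: "(\<integral>\<^sup>+u. ennreal ((1 - \<rho> * R u) powr (- s)) \<partial>?M) \<le>
        ennreal (1 / q) * (\<integral>\<^sup>+u. ennreal (DD u) * ennreal ((1 - \<rho> * R u) powr (- r)) \<partial>?M) +
        ennreal (1 / p) * (\<integral>\<^sup>+u. ennreal (DD u powr (- \<tau>)) \<partial>?M)" .
    have I1: "(\<integral>\<^sup>+u. ennreal (DD u) * ennreal ((1 - \<rho> * R u) powr (- r)) \<partial>?M) \<le> K"
    proof -
      have dm: "(\<lambda>u. \<Prod>y\<in>B. ennreal (D y (u y))) \<in> borel_measurable ?M"
        by (intro borel_measurable_prod_ennreal measurable_compose[OF D_comp measurable_ennreal])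
      have "(\<integral>\<^sup>+u. ennreal (DD u) * ennreal ((1 - \<rho> * R u) powr (- r)) \<partial>?M) =
         (\<integral>\<^sup>+u. (\<Prod>y\<in>B. ennreal (D y (u y))) * ennreal ((1 - \<rho> * R u) powr (- r)) \<partial>?M)"
        by (intro nn_integral_cong arg_cong2[where f = "(*)"] refl)
          (auto simp: DD_def space_PiM PiE_iff prod_ennreal less_imp_le[OF D_pos])
      also have "\<dots> = (\<integral>\<^sup>+u. ennreal ((1 - \<rho> * R u) powr (- r)) \<partial>PiM B T.forward_law)"
        unfolding F_law using R_meas by (subst nn_integral_density[OF dm]) auto
      also have "\<dots> \<le> (\<integral>\<^sup>+w. ennreal (site_prob (n + 1) (\<lambda>j i. Zx i j) w (snd s0) (n + 1) powr (- r)) \<partial>T.backward_law x0)"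
        unfolding R_def by (rule T.nn_integral_discounted_return[OF s0 B(2) \<rho> r(1)])
      finally show ?thesis by (simp add: K_def s0_def)
    qed
    have I2: "(\<integral>\<^sup>+u. ennreal (DD u powr (- \<tau>)) \<partial>?M) \<le> ennreal E"
    proof -
      have "(\<integral>\<^sup>+u. ennreal (DD u powr (- \<tau>)) \<partial>?M) = (\<integral>\<^sup>+u. (\<Prod>y\<in>B. ennreal (D y (u y) powr (- \<tau>))) \<partial>?M)"
        by (intro nn_integral_cong) (simp add: DD_def prod_ennreal prod_powr_distrib)
      also have "\<dots> = (\<Prod>y\<in>B. \<integral>\<^sup>+u. ennreal (D y u powr (- \<tau>)) \<partial>?P)"
        using D_meas by (intro PP.product_nn_integral_prod B(1)) auto
      also have "\<dots> \<le> (\<Prod>y\<in>B. ennreal (exp (C * (2 * \<gamma>\<^sup>2 * (urn_mass (y - x0))\<^sup>2))))"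
        using sq C(1) by (intro prod_mono_ennreal order_trans[OF C(2)] ennreal_leI) (auto intro: mult_left_mono)
      also have "\<dots> = ennreal (exp (C * (2 * \<gamma>\<^sup>2 * (\<Sum>y\<in>B. (urn_mass (y - x0))\<^sup>2))))"
        using B(1) by (simp add: prod_ennreal exp_sum[symmetric] sum_distrib_left)
      also have "\<dots> \<le> ennreal E"
      proof -
        have "(\<Sum>y\<in>B. (urn_mass (y - x0))\<^sup>2) = (\<Sum>z\<in>(\<lambda>y. y - x0) ` B. (urn_mass z)\<^sup>2)"
          by (subst sum.reindex) (auto simp: inj_on_def)
        also have "\<dots> \<le> C0" using B(1) by (intro C0) auto
        finally show ?thesis unfolding E_def
          by (intro ennreal_leI exp_le_cancel_iff[THEN iffD2] mult_left_mono C(1)) simp_all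
      qed
      finally show ?thesis .
    qed
    have "(\<integral>\<^sup>+u. ennreal ((1 - \<rho> * R u) powr (- s)) \<partial>?M) \<le> ennreal (1 / q) * K + ennreal (1 / p) * ennreal E"
      by (rule order_trans[OF split]) (intro add_mono mult_left_mono I1 I2, simp_all)
    also have "\<dots> = ennreal (1 / q) * (ennreal 1 * ennreal (enn2real K)) + ennreal (1 / p) * ennreal E"
      using K by simp
    also have "\<dots> = ennreal (1 / q * (1 * enn2real K) + 1 / p * E)"
      using p1 q1 by (intro ennreal_combination[symmetric]) (auto simp: E_def)
    finally show ?thesis by (simp add: R_def kernel s0_def T.states_def)
  qed
  then show ?thesis unfolding n_def by (intro exI[of _ "enn2real K / q + E / p"]) blast
qed

section \<open>The quenched chain\<close>

definition next_edge :: "nat \<Rightarrow> edge \<Rightarrow> nat \<Rightarrow> edge" where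
  "next_edge d e j = (snd e, snd e + unit_step d j)"

definition transition_op :: "nat \<Rightarrow> (edge \<times> edge \<Rightarrow> real) \<Rightarrow> (edge \<Rightarrow> ennreal) \<Rightarrow> edge \<Rightarrow> ennreal" where
  "transition_op d \<omega> f e = (\<Sum>j=1..2*d. ennreal (\<omega> (e, next_edge d e j)) * f (next_edge d e j))"

lemma unit_step_inj:
  assumes "i \<in> {1..2*d}" "j \<in> {1..2*d}" "unit_step d i = unit_step d j"
  shows "i = j"
proof -
  have eq: "unit_step d i k = unit_step d j k" for k using assms(3) by simp
  show ?thesis
  proof (cases "i \<le> d"; cases "j \<le> d")
    assume "i \<le> d" "j \<le> d"
    then show ?thesis using eq[of i] by (auto simp: unit_step_def of_bool_def split: if_splits)
  next
    assume "i \<le> d" "\<not> j \<le> d"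
    then show ?thesis using eq[of i] by (auto simp: unit_step_def of_bool_def split: if_splits)
  next
    assume "\<not> i \<le> d" "j \<le> d"
    then show ?thesis using eq[of j] by (auto simp: unit_step_def of_bool_def split: if_splits)
  next
    assume "\<not> i \<le> d" "\<not> j \<le> d"
    then show ?thesis using eq[of "i - d"] by (auto simp: unit_step_def of_bool_def split: if_splits)
  qed
qed

lemma unit_step_sites: "i \<in> {1..2*d} \<Longrightarrow> unit_step d i \<in> sites d"
  by (auto simp: unit_step_def sites_def)

lemma sites_add: "x \<in> sites d \<Longrightarrow> y \<in> sites d \<Longrightarrow> x + y \<in> sites d"
  and sites_diff: "x \<in> sites d \<Longrightarrow> y \<in> sites d \<Longrightarrow> x - y \<in> sites d"
  by (auto simp: sites_def)

lemma edges_head: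
  "e \<in> edges d \<longleftrightarrow> (\<exists>y\<in>sites d. \<exists>i\<in>{1..2*d}. e = (y - unit_step d i, y))"
proof
  assume "e \<in> edges d"
  then obtain x i where x: "x \<in> sites d" "i \<in> {1..2*d}" "e = (x, x + unit_step d i)" by (auto simp: edges_def)
  then show "\<exists>y\<in>sites d. \<exists>i\<in>{1..2*d}. e = (y - unit_step d i, y)"
    by (intro bexI[of _ "x + unit_step d i"] bexI[of _ i] sites_add unit_step_sites) auto
next
  assume "\<exists>y\<in>sites d. \<exists>i\<in>{1..2*d}. e = (y - unit_step d i, y)"
  then obtain y i where "y \<in> sites d" "i \<in> {1..2*d}" "e = (y - unit_step d i, y)" by blast
  then show "e \<in> edges d"
    unfolding edges_def by (auto intro!: exI[of _ "y - unit_step d i"] exI[of _ i] sites_diff unit_step_sites)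
qed

lemma snd_edge_sites: "e \<in> edges d \<Longrightarrow> snd e \<in> sites d"
  by (auto simp: edges_head)

lemma next_edge_edges: "e \<in> edges d \<Longrightarrow> j \<in> {1..2*d} \<Longrightarrow> next_edge d e j \<in> edges d"
  using snd_edge_sites[of e d] by (auto simp: next_edge_def edges_def)

lemma next_edge_inj: "inj_on (next_edge d e) {1..2*d}"
  by (auto simp: inj_on_def next_edge_def intro: unit_step_inj)

lemma edge_pairs_iff:
  "(e, e') \<in> edge_pairs d \<longleftrightarrow> e \<in> edges d \<and> (\<exists>j\<in>{1..2*d}. e' = next_edge d e j)"
proof
  assume "(e, e') \<in> edge_pairs d"
  then show "e \<in> edges d \<and> (\<exists>j\<in>{1..2*d}. e' = next_edge d e j)"
    by (force simp: edge_pairs_def edges_head next_edge_def)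
next
  assume "e \<in> edges d \<and> (\<exists>j\<in>{1..2*d}. e' = next_edge d e j)"
  then show "(e, e') \<in> edge_pairs d"
    by (auto simp: edge_pairs_def edges_head next_edge_def) blast
qed

lemma successors_eq: "e \<in> edges d \<Longrightarrow> {e'. (e, e') \<in> edge_pairs d} = next_edge d e ` {1..2*d}"
  by (auto simp: edge_pairs_iff)

lemma environment_pos:
  assumes "\<omega> \<in> environments d" "(e, e') \<in> edge_pairs d"
  shows "\<omega> (e, e') > 0"
  using assms by (auto simp: environments_def PiE_iff)

lemma environment_sum:
  assumes "\<omega> \<in> environments d" "e \<in> edges d"
  shows "(\<Sum>j=1..2*d. \<omega> (e, next_edge d e j)) = 1"
proof -
  have "(\<Sum>e' | (e, e') \<in> edge_pairs d. \<omega> (e, e')) = 1" using assms by (auto simp: environments_def)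
  then show ?thesis unfolding successors_eq[OF assms(2)] by (simp add: sum.reindex[OF next_edge_inj])
qed

lemma nn_integral_transition:
  assumes "e \<in> edges d"
  shows "(\<integral>\<^sup>+e'. f e' \<partial>transition d \<omega> e) = transition_op d \<omega> f e"
proof -
  let ?w = "\<lambda>e'. if (e, e') \<in> edge_pairs d then ennreal (\<omega> (e, e')) else 0"
  let ?T = "next_edge d e ` {1..2*d}"
  have "{a \<in> edges d. 0 < ?w a \<and> 0 < f a} \<subseteq> ?T" by (auto simp: edge_pairs_iff split: if_splits)
  then have fin: "finite {a \<in> edges d. 0 < ?w a \<and> 0 < f a}" by (rule finite_subset) auto
  have "(\<integral>\<^sup>+e'. f e' \<partial>transition d \<omega> e) = (\<Sum>a | a \<in> edges d \<and> 0 < ?w a \<and> 0 < f a. ?w a * f a)"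
    unfolding transition_def by (rule nn_integral_point_measure[OF fin])
  also have "\<dots> = (\<Sum>a\<in>?T. ?w a * f a)"
    using next_edge_edges[OF assms] assms
    by (intro sum.mono_neutral_left) (auto simp: edge_pairs_iff zero_less_iff_neq_zero split: if_splits)
  also have "\<dots> = (\<Sum>j=1..2*d. ?w (next_edge d e j) * f (next_edge d e j))"
    by (simp add: sum.reindex[OF next_edge_inj])
  also have "\<dots> = transition_op d \<omega> f e"
    unfolding transition_op_def using assms by (intro sum.cong refl) (auto simp: edge_pairs_iff)
  finally show ?thesis .
qed

lemma sets_transition [simp]: "sets (transition d \<omega> e) = Pow (edges d)" "space (transition d \<omega> e) = edges d"
  by (simp_all add: transition_def sets_point_measure space_point_measure)

lemma prob_space_transition:
  assumes "\<omega> \<in> environments d" "e \<in> edges d"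
  shows "prob_space (transition d \<omega> e)"
proof
  have "emeasure (transition d \<omega> e) (space (transition d \<omega> e)) = (\<integral>\<^sup>+e'. 1 \<partial>transition d \<omega> e)" by simp
  also have "\<dots> = (\<Sum>j=1..2*d. ennreal (\<omega> (e, next_edge d e j)))"
    unfolding nn_integral_transition[OF assms(2)] by (simp add: transition_op_def)
  also have "\<dots> = ennreal (\<Sum>j=1..2*d. \<omega> (e, next_edge d e j))"
  proof (rule sum_ennreal)
    fix j assume "j \<in> {1..2*d}"
    then have "(e, next_edge d e j) \<in> edge_pairs d" using assms(2) by (auto simp: edge_pairs_iff)
    from environment_pos[OF assms(1) this] show "0 \<le> \<omega> (e, next_edge d e j)" by simp
  qed
  also have "\<dots> = 1" using environment_sum[OF assms] by simp
  finally show "emeasure (transition d \<omega> e) (space (transition d \<omega> e)) = 1" .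
qed

lemma Ionescu_Tulcea_chain:
  assumes \<omega>: "\<omega> \<in> environments d" and e: "e \<in> edges d"
  shows "Ionescu_Tulcea (chain_kernel d \<omega> e) (\<lambda>_. count_space (edges d))"
proof (rule Ionescu_Tulcea.intro)
  fix n :: nat
  show "chain_kernel d \<omega> e n \<in> measurable (PiM {0..<n} (\<lambda>_. count_space (edges d))) (subprob_algebra (count_space (edges d)))"
  proof (cases "n = 0")
    case True
    have "return (count_space (edges d)) e \<in> space (subprob_algebra (count_space (edges d)))"
      using e by (auto simp: space_subprob_algebra intro!: prob_space_imp_subprob_space prob_space_return)
    then show ?thesis using True by (simp add: chain_kernel_def[abs_def])
  next
    case False
    have t: "transition d \<omega> \<in> measurable (count_space (edges d)) (subprob_algebra (count_space (edges d)))"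
      using prob_space_transition[OF \<omega>] by (auto simp: space_subprob_algebra intro!: prob_space_imp_subprob_space)
    have "(\<lambda>X. X (n - 1)) \<in> measurable (PiM {0..<n} (\<lambda>_. count_space (edges d))) (count_space (edges d))"
      using False by (intro measurable_component_singleton) auto
    from measurable_compose[OF this t] False show ?thesis by (simp add: chain_kernel_def[abs_def])
  qed
next
  fix n :: nat and X assume X: "X \<in> space (PiM {0..<n} (\<lambda>_. count_space (edges d)))"
  show "prob_space (chain_kernel d \<omega> e n X)"
  proof (cases "n = 0")
    case True
    then show ?thesis using e by (auto simp: chain_kernel_def intro!: prob_space_return)
  next
    case False
    then have "X (n - 1) \<in> edges d" using X by (auto simp: space_PiM PiE_iff)
    then show ?thesis using False prob_space_transition[OF \<omega>] by (simp add: chain_kernel_def)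
  qed
qed

lemma restrict_singleton_eq: "restrict x {n} = (\<lambda>_\<in>{n}. c) \<longleftrightarrow> x n = c"
proof
  assume "restrict x {n} = (\<lambda>_\<in>{n}. c)"
  from fun_cong[OF this, of n] show "x n = c" by simp
qed (auto simp: fun_eq_iff)

text \<open>The \<open>n\<close>-step distribution is computed from the Ionescu-Tulcea construction: integrating out the last coordinate of a function of
\<open>X n\<close> applies the transition operator and leaves a function of \<open>X (n - 1)\<close>.\<close>

lemma quenched_marginal:
  assumes \<omega>: "\<omega> \<in> environments d" and e: "e \<in> edges d" and e': "e' \<in> edges d"
  shows "emeasure (quenched_law d \<omega> e) {X \<in> space (quenched_law d \<omega> e). X n = e'} =
    (transition_op d \<omega> ^^ n) (indicator {e'}) e"
    and "{X \<in> space (quenched_law d \<omega> e). X n = e'} \<in> sets (quenched_law d \<omega> e)"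
    and "prob_space (quenched_law d \<omega> e)"
proof -
  let ?A = "{X \<in> space (quenched_law d \<omega> e). X n = e'}"
  let ?M = "\<lambda>_::nat. count_space (edges d)"
  interpret IT: Ionescu_Tulcea "chain_kernel d \<omega> e" ?M by (rule Ionescu_Tulcea_chain[OF \<omega> e])
  let ?C = "\<lambda>n. IT.C 0 n (\<lambda>_. undefined)"
  have u: "(\<lambda>_. undefined) \<in> space (PiM {0..<0} ?M)" by (simp add: space_PiM)
  have coord: "(\<lambda>x. f (x n)) \<in> borel_measurable (PiM {0..<Suc n} ?M)" for f :: "edge \<Rightarrow> ennreal" and n
    by (rule measurable_compose[OF measurable_component_singleton]) auto
  have step: "(\<integral>\<^sup>+x. f (x n) \<partial>?C (Suc n)) = (\<integral>\<^sup>+x. \<integral>\<^sup>+z. f z \<partial>chain_kernel d \<omega> e n x \<partial>?C n)" for f :: "edge \<Rightarrow> ennreal" and n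
  proof -
    have sC: "sets (?C n) = sets (PiM {0..<n} ?M)" using IT.sets_C[OF u, of n] by simp
    have "(\<integral>\<^sup>+x. f (x n) \<partial>?C (Suc n)) = (\<integral>\<^sup>+x. \<integral>\<^sup>+y. f (y n) \<partial>IT.eP n x \<partial>?C n)"
      unfolding IT.C.simps
      using IT.measurable_eP[of n]
      by (subst nn_integral_bind[OF coord]) (simp_all add: measurable_cong_sets[OF sC refl])
    also have "\<dots> = (\<integral>\<^sup>+x. \<integral>\<^sup>+z. f z \<partial>chain_kernel d \<omega> e n x \<partial>?C n)"
    proof (rule nn_integral_cong)
      fix x assume "x \<in> space (?C n)"
      then have "x \<in> space (PiM {0..<n} ?M)" using sets_eq_imp_space_eq[OF sC] by simp
      from IT.nn_integral_eP[OF this coord, of f]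
      show "(\<integral>\<^sup>+y. f (y n) \<partial>IT.eP n x) = (\<integral>\<^sup>+z. f z \<partial>chain_kernel d \<omega> e n x)" by simp
    qed
    finally show ?thesis .
  qed
  have marg: "(\<integral>\<^sup>+x. f (x n) \<partial>?C (Suc n)) = (transition_op d \<omega> ^^ n) f e" for f :: "edge \<Rightarrow> ennreal" and n
  proof (induction n arbitrary: f)
    case 0
    have "(\<integral>\<^sup>+x. f (x 0) \<partial>?C (Suc 0)) = (\<integral>\<^sup>+x. \<integral>\<^sup>+z. f z \<partial>chain_kernel d \<omega> e 0 x \<partial>?C 0)" by (rule step)
    also have "\<dots> = (\<integral>\<^sup>+x. f e \<partial>?C 0)"
      using e by (intro nn_integral_cong) (simp add: chain_kernel_def nn_integral_return)
    also have "\<dots> = f e" using prob_space.emeasure_space_1[OF IT.prob_space_C[OF u, of 0]] by simp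
    finally show ?case by simp
  next
    case (Suc n)
    have sp: "space (?C (Suc n)) = space (PiM {0..<Suc n} ?M)" using IT.space_C[OF u, of "Suc n"] by simp
    have "(\<integral>\<^sup>+x. f (x (Suc n)) \<partial>?C (Suc (Suc n))) = (\<integral>\<^sup>+x. \<integral>\<^sup>+z. f z \<partial>chain_kernel d \<omega> e (Suc n) x \<partial>?C (Suc n))"
      by (rule step)
    also have "\<dots> = (\<integral>\<^sup>+x. transition_op d \<omega> f (x n) \<partial>?C (Suc n))"
    proof (rule nn_integral_cong)
      fix x assume "x \<in> space (?C (Suc n))"
      then have "x n \<in> edges d" unfolding sp by (auto simp: space_PiM PiE_iff)
      then show "(\<integral>\<^sup>+z. f z \<partial>chain_kernel d \<omega> e (Suc n) x) = transition_op d \<omega> f (x n)"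
        by (simp add: chain_kernel_def nn_integral_transition)
    qed
    also have "\<dots> = (transition_op d \<omega> ^^ n) (transition_op d \<omega> f) e" by (rule Suc.IH)
    finally show ?case by (simp add: funpow_swap1)
  qed
  have Q: "quenched_law d \<omega> e = IT.PF.lim" by (simp add: quenched_law_def)
  have space_Q: "space (quenched_law d \<omega> e) = space (PiM UNIV ?M)" unfolding Q by simp
  let ?X = "PiE {n} (\<lambda>_. {e'})"
  have X: "?X \<in> sets (PiM {n} ?M)" using e' by (intro sets_PiM_I_finite) auto
  have emb: "?A = IT.PF.emb UNIV {n} ?X"
    unfolding space_Q by (auto simp: prod_emb_def space_PiM PiE_iff restrict_singleton_eq)
  show "?A \<in> sets (quenched_law d \<omega> e)"
    unfolding emb unfolding Q using X by (auto intro!: measurable_prod_emb)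
  have "emeasure (quenched_law d \<omega> e) ?A = emeasure (IT.CI {n}) ?X"
    unfolding emb unfolding Q by (rule IT.lim[OF _ X]) simp
  also have "\<dots> = emeasure (?C (Suc n)) (IT.PF.emb {0..<Suc n} {n} ?X)"
    by (rule IT.emeasure_CI[OF _ X]) auto
  also have "\<dots> = (\<integral>\<^sup>+x. indicator (IT.PF.emb {0..<Suc n} {n} ?X) x \<partial>?C (Suc n))"
  proof (rule nn_integral_indicator[symmetric])
    have "IT.PF.emb {0..<Suc n} {n} ?X \<in> sets (PiM {0..<Suc n} ?M)" by (rule measurable_prod_emb[OF _ X]) auto
    then show "IT.PF.emb {0..<Suc n} {n} ?X \<in> sets (?C (Suc n))" using IT.sets_C[OF u, of "Suc n"] by simp
  qed
  also have "\<dots> = (\<integral>\<^sup>+x. indicator {e'} (x n) \<partial>?C (Suc n))"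
  proof (rule nn_integral_cong)
    fix x assume "x \<in> space (?C (Suc n))"
    then have "x \<in> space (PiM {0..<Suc n} ?M)" using IT.space_C[OF u, of "Suc n"] by simp
    then have "x \<in> IT.PF.emb {0..<Suc n} {n} ?X \<longleftrightarrow> x n \<in> {e'}"
      by (auto simp: prod_emb_def space_PiM PiE_iff restrict_singleton_eq)
    then show "indicator (IT.PF.emb {0..<Suc n} {n} ?X) x = (indicator {e'} (x n) :: ennreal)"
      by (simp add: indicator_def)
  qed
  also have "\<dots> = (transition_op d \<omega> ^^ n) (indicator {e'}) e" by (rule marg)
  finally show "emeasure (quenched_law d \<omega> e) ?A =
    (transition_op d \<omega> ^^ n) (indicator {e'}) e" .
  have "emeasure (quenched_law d \<omega> e) (space (quenched_law d \<omega> e)) = emeasure IT.PF.lim (IT.PF.emb UNIV {} (space (PiM {} ?M)))"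
    unfolding space_Q unfolding Q by (simp add: prod_emb_def space_PiM restrict_def vimage_def)
  also have "\<dots> = emeasure (IT.CI {}) (space (PiM {} ?M))"
    by (rule IT.lim) auto
  also have "\<dots> = 1"
  proof -
    have "space (IT.CI {}) = space (PiM {} ?M)" by (rule IT.PF.space_P) auto
    then show ?thesis using prob_space.emeasure_space_1[OF IT.PF.prob_space_P, of "{}"] by simp
  qed
  finally show "prob_space (quenched_law d \<omega> e)" by (rule prob_spaceI)
qed

lemma green_eq:
  assumes "\<omega> \<in> environments d" "e \<in> edges d" "e' \<in> edges d"
  shows "green d \<omega> e e' = (\<Sum>n. (transition_op d \<omega> ^^ n) (indicator {e'}) e)"
  unfolding green_def by (simp add: quenched_marginal(1)[OF assms])

lemma transition_op_Suc:
  "(transition_op d \<omega> ^^ Suc n) f e = (\<Sum>j=1..2*d. ennreal (\<omega> (e, next_edge d e j)) * (transition_op d \<omega> ^^ n) f (next_edge d e j))"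
  unfolding funpow.simps comp_apply by (rule transition_op_def)

lemma transition_op_mono:
  assumes "\<And>e. e \<in> edges d \<Longrightarrow> f e \<le> g e" "e \<in> edges d"
  shows "(transition_op d \<omega> ^^ n) f e \<le> (transition_op d \<omega> ^^ n) g e"
  using assms(2)
proof (induction n arbitrary: e)
  case (Suc n)
  then show ?case
    unfolding transition_op_Suc by (intro sum_mono mult_left_mono Suc.IH next_edge_edges) auto
qed (use assms in auto)

lemma transition_op_cmult: "(transition_op d \<omega> ^^ n) (\<lambda>e. c * f e) e = c * (transition_op d \<omega> ^^ n) f e"
  proof (induction n arbitrary: e)
  case (Suc n)
  show ?case unfolding transition_op_Suc Suc.IH by (simp add: sum_distrib_left mult_ac)
qed simp

text \<open>Irreducibility. An edge with head \<open>z\<close> can be followed by any edge with tail \<open>z\<close>, including its reversal. So it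
suffices to walk from \<open>z\<close> to the tail of \<open>e0\<close>, reducing the distance by one in each step.\<close>

lemma exists_positive_return:
  assumes \<omega>: "\<omega> \<in> environments d" and e0: "e0 \<in> edges d" and e: "e \<in> edges d"
  shows "\<exists>m. (transition_op d \<omega> ^^ m) (indicator {e0}) e > 0"
proof -
  define reach where "reach e \<longleftrightarrow> (\<exists>m. (transition_op d \<omega> ^^ m) (indicator {e0}) e > 0)" for e
  have pull_back: "reach e" if h: "e \<in> edges d" "j \<in> {1..2*d}" "reach (next_edge d e j)" for e j
  proof -
    obtain m where m: "(transition_op d \<omega> ^^ m) (indicator {e0}) (next_edge d e j) > 0" using h(3) by (auto simp: reach_def)
    have "\<omega> (e, next_edge d e j) > 0" using h by (intro environment_pos[OF \<omega>]) (auto simp: edge_pairs_iff)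
    then have "0 < ennreal (\<omega> (e, next_edge d e j)) * (transition_op d \<omega> ^^ m) (indicator {e0}) (next_edge d e j)"
      using m by (simp add: ennreal_zero_less_mult_iff)
    also have "\<dots> \<le> (transition_op d \<omega> ^^ Suc m) (indicator {e0}) e"
      unfolding transition_op_Suc
      using h(2) by (intro member_le_sum[where f = "\<lambda>j. ennreal (\<omega> (e, next_edge d e j)) * (transition_op d \<omega> ^^ m) (indicator {e0}) (next_edge d e j)"]) auto
    finally show ?thesis unfolding reach_def by blast
  qed
  obtain x j0 where x: "x \<in> sites d" "j0 \<in> {1..2*d}" "e0 = (x, x + unit_step d j0)" using e0 by (auto simp: edges_def)
  have "reach e0" unfolding reach_def by (intro exI[of _ 0]) simp
  have "\<forall>e\<in>edges d. snd e = z \<longrightarrow> reach e" if "z \<in> sites d" "(\<Sum>k=1..d. nat \<bar>z k - x k\<bar>) = m" for z m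
    using that
  proof (induction m arbitrary: z rule: less_induct)
    case (less m)
    show ?case
    proof (cases "z = x")
      case True
      show ?thesis
      proof (intro ballI impI)
        fix e assume e: "e \<in> edges d" "snd e = z"
        have "next_edge d e j0 = e0" using e x True by (simp add: next_edge_def)
        then show "reach e" using pull_back[OF e(1) x(2)] \<open>reach e0\<close> by simp
      qed
    next
      case False
      then obtain k where k: "z k \<noteq> x k" by (auto simp: fun_eq_iff)
      have kd: "k \<in> {1..d}"
      proof (rule ccontr)
        assume "k \<notin> {1..d}"
        then have "z k = 0" "x k = 0" using less.prems(1) x(1) unfolding sites_def by blast+
        then show False using k by simp
      qed
      define j where "j = (if z k < x k then k else d + k)"
      have j: "j \<in> {1..2*d}" using kd by (auto simp: j_def)
      define z' where "z' = z + unit_step d j"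
      have z': "z' \<in> sites d" unfolding z'_def using j less.prems(1) by (intro sites_add unit_step_sites)
      have z'k: "z' l = (if l = k then (if z k < x k then z k + 1 else z k - 1) else z l)" for l
        using kd by (auto simp: z'_def j_def unit_step_def)
      have "(\<Sum>l=1..d. nat \<bar>z' l - x l\<bar>) < (\<Sum>l=1..d. nat \<bar>z l - x l\<bar>)"
        by (rule sum_strict_mono_ex1) (use kd k in \<open>auto simp: z'k intro!: bexI[of _ k]\<close>)
      then have IH: "\<forall>e\<in>edges d. snd e = z' \<longrightarrow> reach e"
        using less.IH[OF _ z' refl] less.prems(2) by simp
      show ?thesis
      proof (intro ballI impI)
        fix e assume e: "e \<in> edges d" "snd e = z"
        have "reach (next_edge d e j)"
          using IH next_edge_edges[OF e(1) j] e(2) by (simp add: next_edge_def z'_def)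
        then show "reach e" by (rule pull_back[OF e(1) j])
      qed
    qed
  qed
  then have "reach e" using e snd_edge_sites[OF e] by blast
  then show ?thesis by (simp add: reach_def)
qed

text \<open>If \<open>e0\<close> is reached from \<open>e'\<close> in \<open>m\<close> steps with probability \<open>c > 0\<close>, then \<open>c\<close> times the expected number of
visits to \<open>e'\<close> is at most the expected number of visits to \<open>e0\<close>. Borel-Cantelli concludes.\<close>

lemma transient_of_green_finite:
  assumes \<omega>: "\<omega> \<in> environments d" and e0: "e0 \<in> edges d" and fin: "green d \<omega> e0 e0 < \<infinity>"
  shows "transient_from d \<omega> e0"
  unfolding transient_from_def
proof
  fix e' assume e': "e' \<in> edges d"
  let ?T = "transition_op d \<omega>"
  let ?Q = "quenched_law d \<omega> e0"
  interpret Q: prob_space ?Q by (rule quenched_marginal(3)[OF \<omega> e0 e'])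
  obtain m where m: "(?T ^^ m) (indicator {e0}) e' > 0" using exists_positive_return[OF \<omega> e0 e'] by blast
  define c where "c = (?T ^^ m) (indicator {e0}) e'"
  have "c * (?T ^^ n) (indicator {e'}) e0 \<le> (?T ^^ (n + m)) (indicator {e0}) e0" for n
  proof -
    have "c * (?T ^^ n) (indicator {e'}) e0 = (?T ^^ n) (\<lambda>e. c * indicator {e'} e) e0"
      by (rule transition_op_cmult[symmetric])
    also have "\<dots> \<le> (?T ^^ n) ((?T ^^ m) (indicator {e0})) e0"
      by (rule transition_op_mono[OF _ e0]) (auto simp: c_def indicator_def)
    finally show ?thesis by (simp add: funpow_add)
  qed
  then have "(\<Sum>n. c * (?T ^^ n) (indicator {e'}) e0) \<le> (\<Sum>n. (?T ^^ (n + m)) (indicator {e0}) e0)"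
    by (intro suminf_le) auto
  also have "\<dots> \<le> green d \<omega> e0 e0"
    unfolding green_eq[OF \<omega> e0 e0]
    by (subst (2) suminf_offset[of _ m]) (auto intro: add_increasing)
  finally have "c * green d \<omega> e0 e' \<le> green d \<omega> e0 e0" unfolding green_eq[OF \<omega> e0 e'] by simp
  with fin have "c * green d \<omega> e0 e' < \<infinity>" by (rule le_less_trans[rotated])
  then have G: "green d \<omega> e0 e' < \<infinity>" using m by (auto simp: c_def[symmetric] ennreal_mult_less_top)
  let ?A = "\<lambda>n. {X \<in> space ?Q. X n = e'}"
  have "AE X in ?Q. eventually (\<lambda>n. X \<in> space ?Q - ?A n) sequentially"
  proof (rule borel_cantelli_AE1)
    show "?A n \<in> sets ?Q" for n by (rule quenched_marginal(2)[OF \<omega> e0 e'])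
    show "emeasure ?Q (?A n) < \<infinity>" for n by (simp add: less_top[symmetric])
    have "(\<Sum>n. ennreal (measure ?Q (?A n))) = green d \<omega> e0 e'"
      unfolding green_def by (simp add: Q.emeasure_eq_measure)
    then show "summable (\<lambda>n. measure ?Q (?A n))"
      using G by (intro summable_suminf_not_top) auto
  qed
  then show "AE X in ?Q. finite {n. X n = e'}"
  proof (rule AE_mp, intro AE_I2 impI)
    fix X assume X: "X \<in> space ?Q" and "eventually (\<lambda>n. X \<in> space ?Q - ?A n) sequentially"
    then obtain N where N: "\<And>n. n \<ge> N \<Longrightarrow> X n \<noteq> e'" using X by (auto simp: eventually_sequentially)
    have "{n. X n = e'} \<subseteq> {..<N}" using N not_le by blast
    then show "finite {n. X n = e'}" by (rule finite_subset) simp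
  qed
qed

section \<open>From boxes to the lattice\<close>

lemma site_law_eq_hyp_law: "site_law d \<alpha> Z = hyp_law (2*d) (2*d) \<alpha> \<alpha> Z"
proof -
  have "lebesgue_simplex d = simplex_measure (2*d)"
    by (simp add: lebesgue_simplex_def simplex_measure_def weight_simplex_def open_simplex_def)
  moreover have "phi d \<alpha> Z u = hyp_weight (2*d) (2*d) \<alpha> \<alpha> Z u" for u
    by (simp add: phi_def hyp_weight_def)
  ultimately show ?thesis by (simp add: site_law_def hyp_law_def Phi_def hyp_mass_def)
qed

definition state_edge :: "nat \<Rightarrow> site \<times> nat \<Rightarrow> edge" where
  "state_edge d s = (fst s - unit_step d (snd s), fst s)"

lemma edges_eq_image: "edges d = state_edge d ` (sites d \<times> {1..2*d})"
  unfolding set_eq_iff image_iff by (force simp: edges_head state_edge_def)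

lemma state_edge_inj: "inj_on (state_edge d) (sites d \<times> {1..2*d})"
  by (auto simp: inj_on_def state_edge_def intro: unit_step_inj)

lemma next_edge_state_edge: "next_edge d (state_edge d s) j = state_edge d (fst s + unit_step d j, j)"
  by (simp add: next_edge_def state_edge_def)

lemma direction_state_edge:
  assumes "i \<in> {1..2*d}"
  shows "direction d (state_edge d (y, i)) = i"
  unfolding direction_def
proof (rule the_equality)
  fix k assume k: "k \<in> {1..2*d} \<and> snd (state_edge d (y, i)) = fst (state_edge d (y, i)) + unit_step d k"
  then have "unit_step d k = unit_step d i" by (simp add: state_edge_def algebra_simps)
  then show "k = i" using unit_step_inj k assms by blast
qed (use assms in \<open>simp add: state_edge_def\<close>)

lemma environment_of_value:
  assumes "y \<in> sites d" "i \<in> {1..2*d}" "j \<in> {1..2*d}"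
  shows "environment_of d Z u (state_edge d (y, i), next_edge d (state_edge d (y, i)) j) = site_prob (2*d) Z (u y) i j"
proof -
  have e: "state_edge d (y, i) \<in> edges d" using assms by (auto simp: edges_eq_image)
  then have "(state_edge d (y, i), next_edge d (state_edge d (y, i)) j) \<in> edge_pairs d"
    using assms(3) by (auto simp: edge_pairs_iff)
  moreover have "direction d (next_edge d (state_edge d (y, i)) j) = j"
    unfolding next_edge_state_edge by (simp only: direction_state_edge[OF assms(3)])
  moreover have "fst (next_edge d (state_edge d (y, i)) j) = y" by (simp add: next_edge_def state_edge_def)
  ultimately show ?thesis
    by (simp add: environment_of_def direction_state_edge[OF assms(2)] site_prob_def)
qed

lemma environment_of_in_environments:
  assumes d: "d \<ge> 1" and Z: "positive_matrix (2*d) (2*d) Z"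
    and u: "\<And>y. y \<in> sites d \<Longrightarrow> u y \<in> open_simplex (2*d)"
  shows "environment_of d Z u \<in> environments d"
proof -
  let ?\<omega> = "environment_of d Z u"
  have n: "2 * d \<ge> 1" using d by simp
  have val: "0 < site_prob (2*d) Z (u y) i j \<and> site_prob (2*d) Z (u y) i j \<le> 1"
    and tot: "(\<Sum>j=1..2*d. site_prob (2*d) Z (u y) i j) = 1"
    if "y \<in> sites d" "i \<in> {1..2*d}" "j \<in> {1..2*d}" for y i j
  proof -
    have Zi: "\<forall>j\<in>{1..2*d}. Z i j > 0" using Z that(2) by auto
    note pos = site_prob_pos[where Z = Z and i = i, OF n Zi u[OF that(1)]]
    show t: "(\<Sum>j=1..2*d. site_prob (2*d) Z (u y) i j) = 1"
      by (rule site_prob_sum[where Z = Z and i = i, OF n Zi u[OF that(1)]])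
    have "site_prob (2*d) Z (u y) i j \<le> (\<Sum>j=1..2*d. site_prob (2*d) Z (u y) i j)"
      using that(3) pos by (intro member_le_sum) (auto intro: less_imp_le)
    then show "0 < site_prob (2*d) Z (u y) i j \<and> site_prob (2*d) Z (u y) i j \<le> 1" using pos[OF that(3)] t by simp
  qed
  have "?\<omega> p \<in> {0<..1}" if "p \<in> edge_pairs d" for p
  proof -
    obtain e e' where p: "p = (e, e')" by (cases p)
    from that obtain y i j where "y \<in> sites d" "i \<in> {1..2*d}" "j \<in> {1..2*d}"
      "e = state_edge d (y, i)" "e' = next_edge d e j" by (auto simp: p edge_pairs_iff edges_eq_image)
    then show ?thesis using val[of y i j] by (simp add: p environment_of_value)
  qed
  moreover have "?\<omega> \<in> extensional (edge_pairs d)" by (simp add: environment_of_def)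
  moreover have "(\<Sum>e' | (e, e') \<in> edge_pairs d. ?\<omega> (e, e')) = 1" if e: "e \<in> edges d" for e
  proof -
    obtain y i where yi: "y \<in> sites d" "i \<in> {1..2*d}" "e = state_edge d (y, i)" using e by (auto simp: edges_eq_image)
    have "(\<Sum>e' | (e, e') \<in> edge_pairs d. ?\<omega> (e, e')) = (\<Sum>j=1..2*d. ?\<omega> (e, next_edge d e j))"
      unfolding successors_eq[OF e] by (simp add: sum.reindex[OF next_edge_inj])
    also have "\<dots> = (\<Sum>j=1..2*d. site_prob (2*d) Z (u y) i j)"
      unfolding yi(3) by (intro sum.cong refl environment_of_value yi(1,2))
    also have "\<dots> = 1" using yi by (intro tot[of y i i])
    finally show ?thesis .
  qed
  ultimately show ?thesis by (auto simp: environments_def PiE_def)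
qed

text \<open>The sites that are heads of edges reachable in at most \<open>n\<close> steps from an edge with head \<open>y\<close>.\<close>

fun nbhd :: "nat \<Rightarrow> nat \<Rightarrow> site \<Rightarrow> site set" where
  "nbhd d 0 y = {y}"
| "nbhd d (Suc n) y = insert y (\<Union>j\<in>{1..2*d}. nbhd d n (y + unit_step d j))"

lemma nbhd_finite: "finite (nbhd d n y)"
  by (induction n arbitrary: y) auto

lemma nbhd_self: "y \<in> nbhd d n y"
  by (cases n) auto

lemma nbhd_sites: "y \<in> sites d \<Longrightarrow> nbhd d n y \<subseteq> sites d"
  by (induction n arbitrary: y) (auto intro!: sites_add unit_step_sites)

lemma nbhd_mono: "m \<le> n \<Longrightarrow> nbhd d m y \<subseteq> nbhd d n y"
proof (induction m arbitrary: n y)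
  case (Suc m)
  then obtain k where "n = Suc k" "m \<le> k" by (cases n) auto
  then show ?case using Suc.IH[of k] by auto
qed (simp add: nbhd_self)

text \<open>Within \<open>n\<close> steps the chain does not notice that it is killed outside a box containing the \<open>n\<close>-step neighbourhood.\<close>

lemma transition_op_visit_weight:
  assumes d: "d \<ge> 1" and Z: "positive_matrix (2*d) (2*d) Z" and B: "finite B" "B \<subseteq> sites d"
    and u: "\<And>y. y \<in> B \<Longrightarrow> u y \<in> open_simplex (2*d)" and s0: "s0 \<in> B \<times> {1..2*d}"
    and box: "nbhd d n y \<subseteq> B" and i: "i \<in> {1..2*d}"
  shows "(transition_op d (environment_of d Z u) ^^ n) (indicator {state_edge d s0}) (state_edge d (y, i)) =
    ennreal (visit_weight (box_kernel d Z B u) (B \<times> {1..2*d}) s0 n (y, i))"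
  using box i
proof (induction n arbitrary: y i)
  case 0
  then have "(y, i) \<in> sites d \<times> {1..2*d}" using B by auto
  then show ?case using s0 B inj_onD[OF state_edge_inj, of d "(y, i)" s0] by (auto simp: indicator_def)
next
  case (Suc n)
  let ?T = "transition_op d (environment_of d Z u)" and ?K = "box_kernel d Z B u" and ?S = "B \<times> {1..2*d}"
  let ?h = "\<lambda>j. (y + unit_step d j, j)"
  have yB: "y \<in> B" using Suc.prems(1) by simp
  have sub: "nbhd d n (y + unit_step d j) \<subseteq> B" if "j \<in> {1..2*d}" for j
    using Suc.prems(1) that unfolding nbhd.simps by blast
  have inB: "y + unit_step d j \<in> B" if "j \<in> {1..2*d}" for j using sub[OF that] nbhd_self by blast
  have K: "?K (y, i) (?h j) = site_prob (2*d) Z (u y) i j" if "j \<in> {1..2*d}" for j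
    using that Suc.prems(2) yB inB[OF that] by (simp add: step_kernel_def)
  have "2 * d \<ge> 1" using d by simp
  note nonneg = site_kernel_nonneg[OF this Z u]
  have inj: "inj_on ?h {1..2*d}" by (auto simp: inj_on_def)
  have "(?T ^^ Suc n) (indicator {state_edge d s0}) (state_edge d (y, i)) =
     (\<Sum>j=1..2*d. ennreal (?K (y, i) (?h j) * visit_weight ?K ?S s0 n (?h j)))"
    unfolding transition_op_Suc
  proof (intro sum.cong refl)
    fix j assume j: "j \<in> {1..2*d}"
    have "y \<in> sites d" using yB B by blast
    note env_value = environment_of_value[OF this Suc.prems(2) j, of Z u]
    have "state_edge d (fst (y, i) + unit_step d j, j) = state_edge d (?h j)" by simp
    then show "ennreal (environment_of d Z u (state_edge d (y, i), next_edge d (state_edge d (y, i)) j)) *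
        (?T ^^ n) (indicator {state_edge d s0}) (next_edge d (state_edge d (y, i)) j) =
      ennreal (?K (y, i) (?h j) * visit_weight ?K ?S s0 n (?h j))"
      unfolding env_value unfolding next_edge_state_edge
      by (simp only: Suc.IH[OF sub[OF j] j] K[OF j, symmetric] ennreal_mult'[OF nonneg])
  qed
  also have "\<dots> = ennreal (\<Sum>j=1..2*d. ?K (y, i) (?h j) * visit_weight ?K ?S s0 n (?h j))"
    by (intro sum_ennreal mult_nonneg_nonneg nonneg visit_weight_nonneg)
  also have "(\<Sum>j=1..2*d. ?K (y, i) (?h j) * visit_weight ?K ?S s0 n (?h j)) =
      (\<Sum>s'\<in>?h ` {1..2*d}. ?K (y, i) s' * visit_weight ?K ?S s0 n s')"
    by (simp add: sum.reindex[OF inj])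
  also have "\<dots> = visit_weight ?K ?S s0 (Suc n) (y, i)"
    unfolding visit_weight.simps using B(1) inB
    by (intro sum.mono_neutral_left) (auto simp: step_kernel_def)
  finally show ?case .
qed

lemma discounted_visits_powr_bound:
  assumes d: "d \<ge> 1" and Z: "positive_matrix (2*d) (2*d) Z"
    and u: "\<And>y. y \<in> B \<Longrightarrow> u y \<in> open_simplex (2*d)" and B: "finite B"
    and s0: "s0 \<in> B \<times> {1..2*d}" and \<rho>: "0 \<le> \<rho>" "\<rho> < 1" and s: "s > 0"
  shows "(\<Sum>n\<le>N. \<rho> ^ n * visit_weight (box_kernel d Z B u) (B \<times> {1..2*d}) s0 n s0) powr s \<le>
    (1 - \<rho> * excursion_sum (box_kernel d Z B u) (B \<times> {1..2*d}) s0 N) powr (- s)"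
proof -
  let ?K = "box_kernel d Z B u" and ?S = "B \<times> {1..2*d}"
  have fS: "finite ?S" and n: "2 * d \<ge> 1" using B d by auto
  note nn = site_kernel_nonneg[OF n Z u]
  have "(\<Sum>k<N. excursion_weight ?K ?S s0 k s0) \<le> (\<Sum>b\<in>?S. ?K s0 b)"
    by (intro excursion_sum_le_row_sum fS s0 nn site_kernel_row_sum[OF n Z u B]) auto
  also have "\<dots> \<le> 1" by (intro site_kernel_row_sum[OF n Z u B] s0) auto
  finally have "\<rho> * excursion_sum ?K ?S s0 N \<le> \<rho>" using \<rho> by (simp add: mult_left_le excursion_sum_def)
  then have R: "\<rho> * excursion_sum ?K ?S s0 N < 1" using \<rho> by linarith
  have "(\<Sum>n\<le>N. \<rho> ^ n * visit_weight ?K ?S s0 n s0) \<le> 1 / (1 - \<rho> * excursion_sum ?K ?S s0 N)"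
    unfolding excursion_sum_def
    by (intro discounted_visits_bound fS s0 nn \<rho> less_imp_le[OF \<rho>(2)] R[unfolded excursion_sum_def]) auto
  moreover have "0 \<le> (\<Sum>n\<le>N. \<rho> ^ n * visit_weight ?K ?S s0 n s0)"
    using \<rho> nn by (intro sum_nonneg mult_nonneg_nonneg visit_weight_nonneg) auto
  ultimately have "(\<Sum>n\<le>N. \<rho> ^ n * visit_weight ?K ?S s0 n s0) powr s \<le> (1 / (1 - \<rho> * excursion_sum ?K ?S s0 N)) powr s"
    using s by (intro powr_mono2) auto
  also have "\<dots> = (1 - \<rho> * excursion_sum ?K ?S s0 N) powr (- s)"
    using R by (simp add: powr_divide powr_minus_divide)
  finally show ?thesis .
qed

section \<open>Moments of the Green function and transience\<close>

lemma space_site_law [simp]: "space (site_law d \<alpha> Z) = open_simplex (2*d)"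
  and sets_site_law: "sets (site_law d \<alpha> Z) = sets (simplex_measure (2*d))"
  by (simp_all add: site_law_eq_hyp_law sets_hyp_law)

lemma prob_space_site_law:
  assumes "d \<ge> 1" "\<forall>i\<in>{1..2*d}. \<alpha> i > 0" "positive_matrix (2*d) (2*d) Z"
  shows "prob_space (site_law d \<alpha> Z)"
  unfolding site_law_eq_hyp_law using assms by (intro prob_space_hyp_law) auto

lemma environment_of_measurable:
  assumes d: "d \<ge> 1" and Z: "positive_matrix (2*d) (2*d) Z"
  shows "environment_of d Z \<in> measurable (PiM (sites d) (\<lambda>_. site_law d \<alpha> Z)) (environment_space d)"
  unfolding environment_space_def
proof (rule measurable_restrict_space2)
  show "environment_of d Z \<in> space (PiM (sites d) (\<lambda>_. site_law d \<alpha> Z)) \<rightarrow> environments d"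
    by (intro Pi_I environment_of_in_environments d Z) (auto simp: space_PiM PiE_iff)
  have "(\<lambda>u. \<lambda>p\<in>edge_pairs d. environment_of d Z u p)
      \<in> measurable (PiM (sites d) (\<lambda>_. site_law d \<alpha> Z)) (PiM (edge_pairs d) (\<lambda>_. borel))"
  proof (rule measurable_restrict)
    fix p assume "p \<in> edge_pairs d"
    obtain e e' where p: "p = (e, e')" by (cases p)
    with \<open>p \<in> edge_pairs d\<close> obtain y i j where yij: "y \<in> sites d" "i \<in> {1..2*d}" "j \<in> {1..2*d}"
      "e = state_edge d (y, i)" "e' = next_edge d e j" by (auto simp: edge_pairs_iff edges_eq_image)
    then have "environment_of d Z u p = site_prob (2*d) Z (u y) i j" for u by (simp add: p environment_of_value)
    then show "(\<lambda>u. environment_of d Z u p) \<in> borel_measurable (PiM (sites d) (\<lambda>_. site_law d \<alpha> Z))"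
      using site_prob_component_measurable[OF yij(1,3), of "\<lambda>_. site_law d \<alpha> Z"] by (simp add: sets_site_law)
  qed
  moreover have "(\<lambda>u. \<lambda>p\<in>edge_pairs d. environment_of d Z u p) = environment_of d Z"
    by (auto simp: environment_of_def fun_eq_iff)
  ultimately show "environment_of d Z \<in> measurable (PiM (sites d) (\<lambda>_. site_law d \<alpha> Z)) (PiM (edge_pairs d) (\<lambda>_. borel))"
    by simp
qed

lemma space_environment_space: "space (environment_space d) = environments d"
  by (auto simp: environment_space_def space_restrict_space space_PiM environments_def PiE_def)

lemma transition_op_measurable:
  assumes "e \<in> edges d"
  shows "(\<lambda>\<omega>. (transition_op d \<omega> ^^ n) f e) \<in> borel_measurable (environment_space d)"
  using assms
proof (induction n arbitrary: e)
  case (Suc n)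
  have "(\<lambda>\<omega>. \<omega> (e, next_edge d e j)) \<in> borel_measurable (environment_space d)" if "j \<in> {1..2*d}" for j
    unfolding environment_space_def
    using Suc.prems that by (intro measurable_restrict_space1 measurable_component_singleton) (auto simp: edge_pairs_iff)
  then show ?case
    unfolding transition_op_Suc
    by (intro borel_measurable_sum borel_measurable_times_ennreal measurable_compose[OF _ measurable_ennreal]
        Suc.IH next_edge_edges Suc.prems) auto
qed simp

lemma ennreal_powr_measurable: "(\<lambda>x. ennreal_powr x s) \<in> borel_measurable borel"
  unfolding ennreal_powr_def by measurable

lemma green_measurable:
  assumes "e \<in> edges d" "e' \<in> edges d"
  shows "(\<lambda>\<omega>. green d \<omega> e e') \<in> borel_measurable (environment_space d)"
proof -
  have "(\<lambda>\<omega>. \<Sum>n. (transition_op d \<omega> ^^ n) (indicator {e'}) e) \<in> borel_measurable (environment_space d)"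
    by (intro borel_measurable_suminf_order transition_op_measurable assms)
  then show ?thesis
    by (rule measurable_cong[THEN iffD2, rotated]) (simp add: space_environment_space green_eq assms)
qed

lemma green_ge_1:
  assumes "\<omega> \<in> environments d" "e \<in> edges d"
  shows "green d \<omega> e e \<ge> 1"
proof -
  have "(\<Sum>n\<in>{0}. (transition_op d \<omega> ^^ n) (indicator {e}) e) \<le> green d \<omega> e e"
    unfolding green_eq[OF assms assms(2)] by (rule sum_le_suminf) auto
  then show ?thesis by simp
qed

lemma ennreal_powr_le_1:
  assumes "x \<ge> 1" "s \<le> 0"
  shows "ennreal_powr x s \<le> 1"
proof (cases "x = \<infinity>")
  case False
  have "enn2real x \<ge> 1" using assms(1) False by (metis enn2real_1 enn2real_mono infinity_ennreal_def less_top)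
  then have "enn2real x powr s \<le> 1" using assms(2) powr_mono[of s 0 "enn2real x"] by simp
  then show ?thesis using False by (simp add: ennreal_powr_def)
qed (use assms in \<open>auto simp: ennreal_powr_def\<close>)

text \<open>The truncation level and the discount are sent to their limits simultaneously, along a sequence that increases pointwise.\<close>

lemma abel_partial_sums_incseq:
  fixes a :: "nat \<Rightarrow> real"
  assumes a: "\<And>n. a n \<ge> 0"
  shows "incseq (\<lambda>N. \<Sum>n\<le>N. (1 - 1 / (real N + 1)) ^ n * a n)"
proof (rule incseq_SucI)
  fix N
  have "(\<Sum>n\<le>N. (1 - 1 / (real N + 1)) ^ n * a n) \<le> (\<Sum>n\<le>N. (1 - 1 / (real (Suc N) + 1)) ^ n * a n)"
    using a by (intro sum_mono mult_right_mono power_mono) (auto simp: field_simps)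
  also have "\<dots> \<le> (\<Sum>n\<le>Suc N. (1 - 1 / (real (Suc N) + 1)) ^ n * a n)"
    using a by (simp add: field_simps)
  finally show "(\<Sum>n\<le>N. (1 - 1 / (real N + 1)) ^ n * a n) \<le> (\<Sum>n\<le>Suc N. (1 - 1 / (real (Suc N) + 1)) ^ n * a n)" .
qed

text \<open>This also covers a divergent series, for which the supremum is infinite.\<close>

lemma ennreal_powr_suminf_le:
  fixes a :: "nat \<Rightarrow> real"
  assumes a: "\<And>n. a n \<ge> 0" and s: "s > 0"
  shows "ennreal_powr (\<Sum>n. ennreal (a n)) s \<le> (SUP N. ennreal ((\<Sum>n\<le>N. (1 - 1 / (real N + 1)) ^ n * a n) powr s))"
    (is "_ \<le> ?V")
proof (cases "?V = \<infinity>")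
  case False
  define T where "T N = (\<Sum>n\<le>N. (1 - 1 / (real N + 1)) ^ n * a n)" for N
  have T0: "T N \<ge> 0" for N unfolding T_def using a by (intro sum_nonneg mult_nonneg_nonneg) (auto simp: field_simps)
  define v where "v = enn2real ?V"
  have "ennreal (enn2real x) = x" if "x \<noteq> \<infinity>" for x using that by (cases x) auto
  from this[OF False] have V: "?V = ennreal v" by (simp only: v_def)
  have v0: "v \<ge> 0" by (simp add: v_def)
  have Tv: "T N \<le> v powr (1 / s)" for N
  proof -
    have "ennreal (T N powr s) \<le> ennreal v" unfolding V[symmetric] T_def by (rule SUP_upper) simp
    then have "T N powr s \<le> v" using v0 by simp
    then have "(T N powr s) powr (1 / s) \<le> v powr (1 / s)" using s by (intro powr_mono2) auto
    then show ?thesis using s T0[of N] by (simp add: powr_powr)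
  qed
  have part: "(\<Sum>n<M. a n) \<le> v powr (1 / s)" for M
  proof (rule LIMSEQ_le_const2)
    have "(\<lambda>N. 1 / (real N + 1)) \<longlonglongrightarrow> 0"
      using LIMSEQ_inverse_real_of_nat by (simp add: inverse_eq_divide add.commute)
    then have lim: "(\<lambda>N. 1 - 1 / (real N + 1)) \<longlonglongrightarrow> 1 - 0"
      by (intro tendsto_diff tendsto_const)
    have "(\<lambda>N. \<Sum>n<M. (1 - 1 / (real N + 1)) ^ n * a n) \<longlonglongrightarrow> (\<Sum>n<M. (1 - 0) ^ n * a n)"
      by (intro tendsto_sum tendsto_mult tendsto_power tendsto_const lim)
    then show "(\<lambda>N. \<Sum>n<M. (1 - 1 / (real N + 1)) ^ n * a n) \<longlonglongrightarrow> (\<Sum>n<M. a n)" by simp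
    show "\<exists>N0. \<forall>N\<ge>N0. (\<Sum>n<M. (1 - 1 / (real N + 1)) ^ n * a n) \<le> v powr (1 / s)"
    proof (intro exI[of _ M] allI impI)
      fix N assume "M \<le> N"
      then have "(\<Sum>n<M. (1 - 1 / (real N + 1)) ^ n * a n) \<le> T N"
        unfolding T_def using a by (intro sum_mono2 mult_nonneg_nonneg) (auto simp: field_simps)
      then show "(\<Sum>n<M. (1 - 1 / (real N + 1)) ^ n * a n) \<le> v powr (1 / s)" using Tv[of N] by simp
    qed
  qed
  have "(\<Sum>n. ennreal (a n)) \<le> ennreal (v powr (1 / s))"
  proof (rule suminf_le_const[OF summableI])
    fix M
    show "(\<Sum>n<M. ennreal (a n)) \<le> ennreal (v powr (1 / s))"
      using a part[of M] by (simp add: sum_ennreal ennreal_leI)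
  qed
  then obtain r where r: "(\<Sum>n. ennreal (a n)) = ennreal r" "0 \<le> r" "r \<le> v powr (1 / s)"
    by (cases "\<Sum>n. ennreal (a n)") (auto simp: top_unique)
  have "r powr s \<le> (v powr (1 / s)) powr s" using r s by (intro powr_mono2) auto
  also have "\<dots> = v" using s v0 by (simp add: powr_powr)
  finally show ?thesis unfolding r(1) V using r(2) by (simp add: ennreal_powr_def ennreal_leI)
next
  case True
  then show ?thesis by (simp only: infinity_ennreal_def top_greatest)
qed

text \<open>Monotone convergence along growing boxes, with the bound of \<open>discounted_return_moment\<close>, which depends neither on the box
nor on the discount.\<close>

lemma green_moment_finite:
  fixes d :: nat and \<alpha> :: "nat \<Rightarrow> real" and Z :: "nat \<Rightarrow> nat \<Rightarrow> real"
  assumes d: "d \<ge> 3" and \<alpha>: "\<forall>i\<in>{1..2*d}. \<alpha> i > 0"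
    and Z: "positive_matrix (2*d) (2*d) Z"
    and e0: "e0 \<in> edges d" and s: "0 < s" "s < Min (\<alpha> ` {1..2*d})"
  shows "(\<integral>\<^sup>+\<omega>. ennreal_powr (green d \<omega> e0 e0) s \<partial>environment_law d \<alpha> Z) < \<infinity>"
proof -
  have d1: "d \<ge> 1" using d by simp
  let ?P = "\<lambda>_::site. site_law d \<alpha> Z"
  let ?M = "PiM (sites d) ?P"
  have P: "prob_space (site_law d \<alpha> Z)" by (rule prob_space_site_law[OF d1 \<alpha> Z])
  interpret PP: product_prob_space ?P "sites d" by (intro product_prob_spaceI P)
  obtain y0 j0 where e0': "y0 \<in> sites d" "j0 \<in> {1..2*d}" "e0 = state_edge d (y0, j0)" using e0 by (auto simp: edges_eq_image)
  define s0 where "s0 = (y0, j0)"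
  define x0 where "x0 = y0 - unit_step d j0"
  have x0: "x0 \<in> sites d" unfolding x0_def by (intro sites_diff e0' unit_step_sites)
  have y0: "x0 + unit_step d j0 = y0" by (simp add: x0_def)
  obtain C where C: "\<And>B \<rho> N. finite B \<Longrightarrow> x0 \<in> B \<Longrightarrow> y0 \<in> B \<Longrightarrow> 0 \<le> \<rho> \<Longrightarrow> \<rho> < 1 \<Longrightarrow>
    (\<integral>\<^sup>+u. ennreal ((1 - \<rho> * excursion_sum (box_kernel d Z B u) (B \<times> {1..2*d}) s0 N) powr (- s)) \<partial>PiM B ?P) \<le> ennreal C"
    using discounted_return_moment[OF d \<alpha> Z s e0'(2), of x0] unfolding y0 s0_def site_law_eq_hyp_law by blast
  define v where "v u n = (transition_op d (environment_of d Z u) ^^ n) (indicator {e0}) e0" for u n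
  define a where "a u n = enn2real (v u n)" for u n
  define T where "T N u = (\<Sum>n\<le>N. (1 - 1 / (real N + 1)) ^ n * a u n)" for N u
  have usp: "u y \<in> open_simplex (2*d)" if "u \<in> space ?M" "y \<in> sites d" for u y
    using that by (auto simp: space_PiM PiE_iff)
  have v_box: "v u n = ennreal (visit_weight (box_kernel d Z B u) (B \<times> {1..2*d}) s0 n s0)"
    if "u \<in> space ?M" "finite B" "B \<subseteq> sites d" "nbhd d n y0 \<subseteq> B" for u n B
    unfolding v_def e0'(3) s0_def using that(3,4) nbhd_self[of y0 d n] e0'(2)
    by (intro transition_op_visit_weight d1 Z that(2-4) usp[OF that(1)]) auto
  have v: "v u n = ennreal (a u n)" if u: "u \<in> space ?M" for u n
    unfolding a_def using v_box[OF u nbhd_finite nbhd_sites[OF e0'(1)] order_refl, of n] by simp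
  have a_box: "a u n = visit_weight (box_kernel d Z B u) (B \<times> {1..2*d}) s0 n s0"
    if "u \<in> space ?M" "finite B" "B \<subseteq> sites d" "nbhd d n y0 \<subseteq> B" for u n B
  proof -
    have "2 * d \<ge> 1" using d1 by simp
    then have "0 \<le> visit_weight (box_kernel d Z B u) (B \<times> {1..2*d}) s0 n s0"
      using that(3) by (intro visit_weight_nonneg site_kernel_nonneg Z usp[OF that(1)]) auto
    then show ?thesis unfolding a_def v_box[OF that] by simp
  qed
  have a0: "a u n \<ge> 0" for u n by (simp add: a_def)
  have g: "green d (environment_of d Z u) e0 e0 = (\<Sum>n. ennreal (a u n))" if u: "u \<in> space ?M" for u
  proof -
    have "environment_of d Z u \<in> environments d" by (intro environment_of_in_environments d1 Z usp[OF u])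
    from green_eq[OF this e0 e0] show ?thesis by (simp only: v_def[symmetric] v[OF u])
  qed
  have Tm: "(\<lambda>u. T N u) \<in> borel_measurable ?M" for N
    unfolding T_def a_def v_def
    by (intro borel_measurable_sum borel_measurable_times borel_measurable_const
        measurable_compose[OF measurable_compose[OF environment_of_measurable[OF d1 Z] transition_op_measurable[OF e0]] borel_measurable_enn2real])
      simp
  have bound: "(\<integral>\<^sup>+u. ennreal (T N u powr s) \<partial>?M) \<le> ennreal C" for N
  proof -
    define B where "B = insert x0 (nbhd d N y0)"
    have B: "finite B" "x0 \<in> B" "y0 \<in> B" "B \<subseteq> sites d"
      using nbhd_finite nbhd_self nbhd_sites[OF e0'(1), of N] x0 by (auto simp: B_def)
    define \<rho> where "\<rho> = 1 - 1 / (real N + 1)"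
    have \<rho>: "0 \<le> \<rho>" "\<rho> < 1" by (auto simp: \<rho>_def field_simps)
    define F where "F u = ennreal ((1 - \<rho> * excursion_sum (box_kernel d Z B u) (B \<times> {1..2*d}) s0 N) powr (- s))" for u
    have s0B: "s0 \<in> B \<times> {1..2*d}" using B(3) e0'(2) by (simp add: s0_def)
    have "(\<integral>\<^sup>+u. ennreal (T N u powr s) \<partial>?M) \<le> (\<integral>\<^sup>+u. F u \<partial>?M)"
    proof (intro nn_integral_mono)
      fix u assume u: "u \<in> space ?M"
      have "a u n = visit_weight (box_kernel d Z B u) (B \<times> {1..2*d}) s0 n s0" if "n \<le> N" for n
        using nbhd_mono[OF that, of d y0] by (intro a_box u B) (auto simp: B_def)
      then have "T N u = (\<Sum>n\<le>N. \<rho> ^ n * visit_weight (box_kernel d Z B u) (B \<times> {1..2*d}) s0 n s0)"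
        unfolding T_def \<rho>_def by simp
      then show "ennreal (T N u powr s) \<le> F u"
        unfolding F_def using B(4) usp[OF u]
        by (simp only:) (intro ennreal_leI discounted_visits_powr_bound d1 Z B(1) s0B \<rho> s(1), blast)
    qed
    also have "\<dots> = (\<integral>\<^sup>+u. F (restrict u B) \<partial>?M)"
    proof -
      have "box_kernel d Z B (restrict u B) = box_kernel d Z B u" for u
        by (auto simp: fun_eq_iff step_kernel_def)
      then show ?thesis by (simp add: F_def)
    qed
    also have "\<dots> = (\<integral>\<^sup>+u. F u \<partial>PiM B ?P)"
    proof -
      have km: "(\<lambda>u. box_kernel d Z B u s s') \<in> borel_measurable (PiM B ?P)" for s s'
        by (intro step_kernel_measurable site_prob_component_measurable) (auto simp: sets_site_law)
      have Fm: "F \<in> borel_measurable (PiM B ?P)"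
        unfolding F_def[abs_def]
        by (intro measurable_compose[OF _ measurable_ennreal] powr_real_measurable borel_measurable_diff borel_measurable_times
            excursion_sum_measurable km) auto
      have "(\<integral>\<^sup>+u. F u \<partial>PiM B ?P) = (\<integral>\<^sup>+u. F u \<partial>distr ?M (PiM B ?P) (\<lambda>u. restrict u B))"
        using PP.distr_PiM_restrict_finite[OF B(1,4)] by simp
      also have "\<dots> = (\<integral>\<^sup>+u. F (restrict u B) \<partial>?M)"
      proof (rule nn_integral_distr)
        show "(\<lambda>u. restrict u B) \<in> measurable ?M (PiM B ?P)" by (rule measurable_restrict_subset[OF B(4)])
      qed (use Fm in simp)
      finally show ?thesis by simp
    qed
    also have "\<dots> \<le> ennreal C" unfolding F_def by (rule C[OF B(1-3) \<rho>])
    finally show ?thesis .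
  qed
  have "(\<integral>\<^sup>+\<omega>. ennreal_powr (green d \<omega> e0 e0) s \<partial>environment_law d \<alpha> Z) =
      (\<integral>\<^sup>+u. ennreal_powr (green d (environment_of d Z u) e0 e0) s \<partial>?M)"
    unfolding environment_law_def
    by (rule nn_integral_distr[OF environment_of_measurable[OF d1 Z]])
      (simp add: measurable_compose[OF green_measurable[OF e0 e0] ennreal_powr_measurable])
  also have "\<dots> \<le> (\<integral>\<^sup>+u. (SUP N. ennreal (T N u powr s)) \<partial>?M)"
  proof (intro nn_integral_mono)
    fix u assume u: "u \<in> space ?M"
    show "ennreal_powr (green d (environment_of d Z u) e0 e0) s \<le> (SUP N. ennreal (T N u powr s))"
      unfolding g[OF u] T_def by (intro ennreal_powr_suminf_le a0 s(1))
  qed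
  also have "\<dots> = (SUP N. \<integral>\<^sup>+u. ennreal (T N u powr s) \<partial>?M)"
  proof (rule nn_integral_monotone_convergence_SUP_AE)
    show "AE u in ?M. ennreal (T N u powr s) \<le> ennreal (T (Suc N) u powr s)" for N
    proof (rule AE_I2)
      fix u assume u: "u \<in> space ?M"
      have "T N u \<le> T (Suc N) u" unfolding T_def
        using abel_partial_sums_incseq[of "a u", OF a0] by (rule incseqD) simp
      moreover have "0 \<le> T N u" unfolding T_def using a0 by (intro sum_nonneg mult_nonneg_nonneg) (auto simp: field_simps)
      ultimately show "ennreal (T N u powr s) \<le> ennreal (T (Suc N) u powr s)"
        using s(1) by (intro ennreal_leI powr_mono2) auto
    qed
    show "(\<lambda>u. ennreal (T N u powr s)) \<in> borel_measurable ?M" for N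
      by (intro measurable_compose[OF _ measurable_ennreal] powr_real_measurable Tm) auto
  qed
  also have "\<dots> \<le> ennreal C" by (intro SUP_least bound)
  also have "\<dots> < \<infinity>" by simp
  finally show ?thesis .
qed

theorem theorem2p1:
  fixes d :: nat and \<alpha> :: "nat \<Rightarrow> real" and Z :: "nat \<Rightarrow> nat \<Rightarrow> real" and e\<^sub>0 :: edge
  assumes "d \<ge> 3"
    and "\<forall>i\<in>{1..2*d}. \<alpha> i > 0"
    and "\<forall>i\<in>{1..2*d}. \<forall>j\<in>{1..2*d}. Z i j > 0"
    and "e\<^sub>0 \<in> edges d"
  shows "(\<forall>s::real. s < Min (\<alpha> ` {1..2*d}) \<longrightarrow>
            (\<integral>\<^sup>+\<omega>. ennreal_powr (green d \<omega> e\<^sub>0 e\<^sub>0) s \<partial>environment_law d \<alpha> Z) < \<infinity>) \<and>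
         (AE \<omega> in environment_law d \<alpha> Z. transient_from d \<omega> e\<^sub>0)"
proof
  have d1: "d \<ge> 1" using assms(1) by simp
  let ?E = "environment_law d \<alpha> Z"
  have P: "prob_space (site_law d \<alpha> Z)" by (rule prob_space_site_law[OF d1 assms(2,3)])
  have prob: "prob_space ?E"
    unfolding environment_law_def
    by (intro prob_space.prob_space_distr prob_space_PiM P environment_of_measurable d1 assms)
  have space_E: "space ?E = environments d" by (simp add: environment_law_def space_environment_space)
  show "\<forall>s::real. s < Min (\<alpha> ` {1..2*d}) \<longrightarrow> (\<integral>\<^sup>+\<omega>. ennreal_powr (green d \<omega> e\<^sub>0 e\<^sub>0) s \<partial>?E) < \<infinity>"
  proof (intro allI impI)
    fix s :: real assume s: "s < Min (\<alpha> ` {1..2*d})"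
    show "(\<integral>\<^sup>+\<omega>. ennreal_powr (green d \<omega> e\<^sub>0 e\<^sub>0) s \<partial>?E) < \<infinity>"
    proof (cases "s > 0")
      case True
      then show ?thesis using s by (intro green_moment_finite assms)
    next
      case False
      have "(\<integral>\<^sup>+\<omega>. ennreal_powr (green d \<omega> e\<^sub>0 e\<^sub>0) s \<partial>?E) \<le> (\<integral>\<^sup>+\<omega>. 1 \<partial>?E)"
        using False assms(4) by (intro nn_integral_mono ennreal_powr_le_1 green_ge_1) (auto simp: space_E)
      also have "\<dots> = 1" using prob_space.emeasure_space_1[OF prob] by simp
      finally show ?thesis by (rule le_less_trans) simp
    qed
  qed
  define s where "s = Min (\<alpha> ` {1..2*d}) / 2"
  have "Min (\<alpha> ` {1..2*d}) > 0" using assms(2) d1 by (subst Min_gr_iff) auto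
  then have s: "0 < s" "s < Min (\<alpha> ` {1..2*d})" by (auto simp: s_def)
  have m: "(\<lambda>\<omega>. ennreal_powr (green d \<omega> e\<^sub>0 e\<^sub>0) s) \<in> borel_measurable ?E"
    using measurable_compose[OF green_measurable[OF assms(4,4)] ennreal_powr_measurable]
    by (simp add: environment_law_def)
  have "(\<integral>\<^sup>+\<omega>. ennreal_powr (green d \<omega> e\<^sub>0 e\<^sub>0) s \<partial>?E) \<noteq> \<infinity>"
    using green_moment_finite[OF assms s] by simp
  from nn_integral_PInf_AE[OF m this]
  show "AE \<omega> in ?E. transient_from d \<omega> e\<^sub>0"
  proof (rule AE_mp, intro AE_I2 impI)
    fix \<omega> assume "\<omega> \<in> space ?E" and fin: "ennreal_powr (green d \<omega> e\<^sub>0 e\<^sub>0) s \<noteq> \<infinity>"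
    then have "green d \<omega> e\<^sub>0 e\<^sub>0 \<noteq> \<infinity>" using s(1) by (auto simp: ennreal_powr_def)
    then have "green d \<omega> e\<^sub>0 e\<^sub>0 < \<infinity>" by (simp add: less_top)
    then show "transient_from d \<omega> e\<^sub>0"
      using \<open>\<omega> \<in> space ?E\<close> assms(4) by (intro transient_of_green_finite) (auto simp: space_E)
  qed
qed

end
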